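(* Let $\mathfrak{h}$ be a finite-dimensional Lie algebra over $\mathbb{C}$, let $\lambda$ be a character of $\mathfrak{h}$, and let $$0 \to \mathbb{C}_\lambda\to \mathfrak{g} \xrightarrow{\ \pi\ } \mathfrak{h} \to 0$$ be a one-dimensional extension of $\mathfrak{h}$. Let $V$ be a left $\mathfrak{h}$-module and let $V^\pi$ be the $\mathfrak{g}$-module obtained from $V$ via the homomorphism $\pi$. Then: (1) $\sigma_{\mathfrak{g}}(V^\pi) \subset \hat{\mathfrak{h}} \subset \hat{\mathfrak{g}}$; (2) if $S\in \sigma_{\mathfrak{g}}(V^\pi)$, then $S \in \sigma_{\mathfrak{h}}(V)$ or $S_{-\lambda}\in \sigma_{\mathfrak{h}}(V)$; (3) if the extension is central, i.e. $\lambda=0$, then $\sigma_{\mathfrak{g}}(V^\pi) = \sigma_{\mathfrak{h}}(V)$.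
   Context: All Lie algebras are over $\mathbb{C}$. For a finite-dimensional Lie algebra $\mathfrak{a}$, $U\mathfrak{a}$ is its universal enveloping algebra and $\hat{\mathfrak{a}}$ is the set of isomorphism classes of simple finite-dimensional left $\mathfrak{a}$-modules (a simple module and its class are denoted by the same letter). The Taylor spectrum of a left $\mathfrak{a}$-module $V$ is $$\sigma_{\mathfrak{a}}(V)=\{ S\in \hat{\mathfrak{a}} : \operatorname{Tor}^{U\mathfrak{a}}_k(S^*,V)\neq 0 \text{ for some } k\geq 0 \},$$ where $S^*$ is the dual vector space of $S$ with the right $\mathfrak{a}$-action $(f\cdot x)(s)=f(x\cdot s)$. A character of $\mathfrak{h}$ is an element $\lambda\in(\mathfrak{h}/[\mathfrak{h},\mathfrak{h}])^*$; $\mathbb{C}_\lambda$ denotes the one-dimensional $\mathfrak{h}$-module on which $h$ acts by multiplication by $\lambda(h)$. A one-dimensional extension of $\mathfrak{h}$ is an exact sequence of Lie algebras $0 \to \mathbb{C}_\lambda\to \mathfrak{g} \xrightarrow{\pi} \mathfrak{h} \to 0$ in which $\mathbb{C}_\lambda$ is a one-dimensional ideal of $\mathfrak{g}$ with $[g,c]=\lambda(\pi(g))c$ for all $g\in\mathfrak{g}$, $c\in\mathbb{C}_\lambda$. If $S$ is a simple $\mathfrak{h}$-module then $S^\pi$ (the same space, with $\mathfrak{g}$ acting through $\pi$) is a simple $\mathfrak{g}$-module, and $\hat{\mathfrak{h}}$ is identified with a subset of $\hat{\mathfrak{g}}$ by $S\mapsto S^\pi$. For an $\mathfrak{h}$-module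 $S$, $S_{-\lambda}$ denotes the $\mathfrak{h}$-module $\mathbb{C}_{-\lambda}\otimes_{\mathbb{C}} S$ (usual tensor product of Lie algebra representations). *)

theory Defs
  imports Complex_Main "HOL-Algebra.Module" "HOL-Algebra.AbelCoset"
    "HOL-Algebra.Free_Abelian_Groups" "HOL-Library.Poly_Mapping"
begin

section \<open>Complex Lie algebras\<close>

class complex_lie_algebra = ab_group_add +
  fixes scaleC :: "complex \<Rightarrow> 'a \<Rightarrow> 'a" (infixr "*\<^sub>C" 75)
    and bracket :: "'a \<Rightarrow> 'a \<Rightarrow> 'a"
  assumes scaleC_add_right: "c *\<^sub>C (x + y) = c *\<^sub>C x + c *\<^sub>C y"
    and scaleC_add_left: "(c + d) *\<^sub>C x = c *\<^sub>C x + d *\<^sub>C x"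
    and scaleC_scaleC: "c *\<^sub>C (d *\<^sub>C x) = (c * d) *\<^sub>C x"
    and scaleC_one: "1 *\<^sub>C x = x"
    and bracket_add_left: "bracket (x + y) z = bracket x z + bracket y z"
    and bracket_add_right: "bracket x (y + z) = bracket x y + bracket x z"
    and bracket_scaleC_left: "bracket (c *\<^sub>C x) y = c *\<^sub>C bracket x y"
    and bracket_scaleC_right: "bracket x (c *\<^sub>C y) = c *\<^sub>C bracket x y"
    and bracket_self: "bracket x x = 0"
    and jacobi: "bracket x (bracket y z) + bracket y (bracket z x) + bracket z (bracket x y) = 0"

class fd_complex_lie_algebra = complex_lie_algebra +
  assumes finite_dimensional: "\<exists>B. finite B \<and> (\<forall>x. \<exists>c. x = (\<Sum>b\<in>B. c b *\<^sub>C b))"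

definition lie_hom :: "('g::complex_lie_algebra \<Rightarrow> 'h::complex_lie_algebra) \<Rightarrow> bool" where
  "lie_hom f \<longleftrightarrow> (\<forall>x y. f (x + y) = f x + f y) \<and> (\<forall>c x. f (c *\<^sub>C x) = c *\<^sub>C f x) \<and>
     (\<forall>x y. f (bracket x y) = bracket (f x) (f y))"

text \<open>A linear functional on the quotient of the Lie algebra by its derived algebra is given as a
  linear functional on the Lie algebra that vanishes on all brackets.\<close>

definition lie_character :: "('h::complex_lie_algebra \<Rightarrow> complex) \<Rightarrow> bool" where
  "lie_character \<chi> \<longleftrightarrow> (\<forall>x y. \<chi> (x + y) = \<chi> x + \<chi> y) \<and> (\<forall>c x. \<chi> (c *\<^sub>C x) = c * \<chi> x) \<and>
     (\<forall>x y. \<chi> (bracket x y) = 0)"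

text \<open>The exact sequence \<open>0 \<rightarrow> \<complex> \<rightarrow> \<gg> \<rightarrow> \<hh> \<rightarrow> 0\<close> with maps \<open>\<iota>\<close> and \<open>\<pi>\<close>, in which \<open>\<gg>\<close> acts on
  the ideal \<open>range \<iota>\<close> through \<open>\<chi> \<circ> \<pi>\<close>.\<close>

definition one_dim_extension ::
    "(complex \<Rightarrow> 'g::complex_lie_algebra) \<Rightarrow> ('g \<Rightarrow> 'h::complex_lie_algebra) \<Rightarrow> ('h \<Rightarrow> complex) \<Rightarrow> bool"
  where
  "one_dim_extension \<iota> \<pi> \<chi> \<longleftrightarrow>
     (\<forall>a b. \<iota> (a + b) = \<iota> a + \<iota> b) \<and> (\<forall>c a. \<iota> (c * a) = c *\<^sub>C \<iota> a) \<and> inj \<iota> \<and>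
     lie_hom \<pi> \<and> surj \<pi> \<and> range \<iota> = {x. \<pi> x = 0} \<and>
     (\<forall>x a. bracket x (\<iota> a) = \<chi> (\<pi> x) *\<^sub>C \<iota> a)"


section \<open>The universal enveloping algebra\<close>

text \<open>Words over the Lie algebra form a free monoid, so \<open>'g word \<Rightarrow>\<^sub>0 complex\<close>, with the convolution
  product of \<open>Poly_Mapping\<close>, is the free associative algebra on the underlying set of the Lie algebra.
  Modulo the relators \<open>add\<close> and \<open>scale\<close> below it is the tensor algebra.\<close>

datatype 'a word = Word (letters: "'a list")

instantiation word :: (type) monoid_add
begin

definition "0 = Word []"
definition "v + w = Word (letters v @ letters w)"

instance
  by standard (simp_all add: zero_word_def plus_word_def)

end

type_synonym 'g free_algebra = "'g word \<Rightarrow>\<^sub>0 complex"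

abbreviation uea_gen :: "'g \<Rightarrow> 'g free_algebra" where
  "uea_gen x \<equiv> Poly_Mapping.single (Word [x]) 1"

abbreviation uea_scalar :: "complex \<Rightarrow> 'g free_algebra" where
  "uea_scalar c \<equiv> Poly_Mapping.single 0 c"

inductive_set uea_relators :: "'g::complex_lie_algebra free_algebra set" where
  add: "uea_gen (x + y) - (uea_gen x + uea_gen y) \<in> uea_relators"
| scale: "uea_gen (c *\<^sub>C x) - uea_scalar c * uea_gen x \<in> uea_relators"
| bracket: "uea_gen x * uea_gen y - uea_gen y * uea_gen x - uea_gen (bracket x y) \<in> uea_relators"

text \<open>The two-sided ideal generated by the relators.\<close>

inductive_set uea_ideal :: "'g::complex_lie_algebra free_algebra set" where
  zero: "0 \<in> uea_ideal"
| mult: "r \<in> uea_relators \<Longrightarrow> a * r * b \<in> uea_ideal"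
| plus: "p \<in> uea_ideal \<Longrightarrow> q \<in> uea_ideal \<Longrightarrow> p + q \<in> uea_ideal"

lemma uea_ideal_mult_left: "p \<in> uea_ideal \<Longrightarrow> a * p \<in> uea_ideal"
proof (induction rule: uea_ideal.induct)
  case (mult r b c)
  then show ?case using uea_ideal.mult[of r "a * b" c] by (simp add: mult.assoc)
qed (auto simp: distrib_left intro: uea_ideal.intros)

lemma uea_ideal_mult_right: "p \<in> uea_ideal \<Longrightarrow> p * a \<in> uea_ideal"
proof (induction rule: uea_ideal.induct)
  case (mult r b c)
  then show ?case using uea_ideal.mult[of r b "c * a"] by (simp add: mult.assoc)
qed (auto simp: distrib_right intro: uea_ideal.intros)

lemma uea_ideal_uminus: "p \<in> uea_ideal \<Longrightarrow> - p \<in> uea_ideal"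
  using uea_ideal_mult_left[of p "-1"] by simp

lemma uea_ideal_minus: "p \<in> uea_ideal \<Longrightarrow> q \<in> uea_ideal \<Longrightarrow> p - q \<in> uea_ideal"
  using uea_ideal.plus[of p "- q"] uea_ideal_uminus[of q] by simp

quotient_type (overloaded) 'g uea = "'g::complex_lie_algebra free_algebra" / "\<lambda>p q. p - q \<in> uea_ideal"
proof (rule equivpI)
  show "reflp (\<lambda>p q. p - q \<in> uea_ideal)"
    by (simp add: reflp_def uea_ideal.zero)
  show "symp (\<lambda>p q. p - q \<in> uea_ideal)"
    using uea_ideal_uminus by (force simp: symp_def)
  show "transp (\<lambda>p q. p - q \<in> uea_ideal)"
    using uea_ideal.plus by (force simp: transp_def)
qed

lemma lookup_times_zero:
  fixes p q :: "'g free_algebra"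
  shows "Poly_Mapping.lookup (p * q) 0 = Poly_Mapping.lookup p 0 * Poly_Mapping.lookup q 0"
proof -
  have *: "(0 = l + r) \<longleftrightarrow> l = 0 \<and> r = 0" for l r :: "'g word"
    by (cases l; cases r) (auto simp: zero_word_def plus_word_def)
  have "(\<Sum>r. Poly_Mapping.lookup q r when 0 = l + r) = (Poly_Mapping.lookup q 0 when l = 0)" for l
  proof (cases "l = 0")
    case True
    then have "(\<lambda>r. Poly_Mapping.lookup q r when 0 = l + r) = (\<lambda>r. Poly_Mapping.lookup q r when r = 0)"
      by (simp add: *)
    with True show ?thesis by simp
  next
    case False
    then show ?thesis by (simp add: *)
  qed
  then show ?thesis
    by (simp add: lookup_mult mult_when)
qed

lemma uea_ideal_lookup_zero: "p \<in> uea_ideal \<Longrightarrow> Poly_Mapping.lookup p 0 = 0"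
proof (induction rule: uea_ideal.induct)
  case (mult r a b)
  have "Poly_Mapping.lookup r 0 = 0"
    using mult
    by cases (simp_all add: lookup_minus lookup_add lookup_times_zero,
        simp_all add: lookup_single zero_word_def when_def)
  then show ?case by (simp add: lookup_times_zero)
qed (simp_all add: lookup_add)

instantiation uea :: (complex_lie_algebra) ring_1
begin

lift_definition zero_uea :: "'a uea" is 0 .
lift_definition one_uea :: "'a uea" is 1 .

lift_definition plus_uea :: "'a uea \<Rightarrow> 'a uea \<Rightarrow> 'a uea" is "(+)"
  using uea_ideal.plus by (force simp: algebra_simps)

lift_definition uminus_uea :: "'a uea \<Rightarrow> 'a uea" is uminus
  using uea_ideal_uminus by force

lift_definition minus_uea :: "'a uea \<Rightarrow> 'a uea \<Rightarrow> 'a uea" is "(-)"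
  using uea_ideal_minus by (force simp: algebra_simps)

lift_definition times_uea :: "'a uea \<Rightarrow> 'a uea \<Rightarrow> 'a uea" is "(*)"
proof -
  fix p p' q q' :: "'a free_algebra"
  assume "p - p' \<in> uea_ideal" "q - q' \<in> uea_ideal"
  then have "(p - p') * q + p' * (q - q') \<in> uea_ideal"
    by (intro uea_ideal.plus uea_ideal_mult_left uea_ideal_mult_right)
  then show "p * q - p' * q' \<in> uea_ideal" by (simp add: algebra_simps)
qed

instance
proof
  show "(0::'a uea) \<noteq> 1"
  proof transfer
    show "(0::'a free_algebra) - 1 \<notin> uea_ideal"
      using uea_ideal_lookup_zero[of "- 1 :: 'a free_algebra"] by (auto simp: lookup_one)
  qed
qed (transfer; simp add: algebra_simps uea_ideal.zero)+

end


section \<open>Modules over noncommutative rings and Tor\<close>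

text \<open>The scalars are a type of class \<open>ring_1\<close>. Modules are records of the type \<open>module\<close> of
  HOL-Algebra, whose fields \<open>mult\<close> and \<open>one\<close> play no role for modules. In a right module
  \<open>r \<odot>\<^bsub>M\<^esub> m\<close> denotes the product of \<open>m\<close> with \<open>r\<close> from the right.\<close>

locale scalar_action = abelian_group M
  for M :: "('r::ring_1, 'm, 'z) module_scheme" (structure) +
  assumes smult_closed: "m \<in> carrier M \<Longrightarrow> r \<odot> m \<in> carrier M"
    and smult_add_left: "m \<in> carrier M \<Longrightarrow> (r + s) \<odot> m = r \<odot> m \<oplus> s \<odot> m"
    and smult_add_right:
      "m \<in> carrier M \<Longrightarrow> n \<in> carrier M \<Longrightarrow> r \<odot> (m \<oplus> n) = r \<odot> m \<oplus> r \<odot> n"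
    and smult_one: "m \<in> carrier M \<Longrightarrow> 1 \<odot> m = m"

locale left_module = scalar_action +
  assumes smult_assoc: "m \<in> carrier M \<Longrightarrow> (r * s) \<odot> m = r \<odot> (s \<odot> m)"

locale right_module = scalar_action +
  assumes smult_assoc: "m \<in> carrier M \<Longrightarrow> (r * s) \<odot> m = s \<odot> (r \<odot> m)"

definition module_hom ::
    "('r::ring_1, 'm, 'y) module_scheme \<Rightarrow> ('r, 'n, 'z) module_scheme \<Rightarrow> ('m \<Rightarrow> 'n) set" where
  "module_hom M N = {f \<in> hom (add_monoid M) (add_monoid N).
     \<forall>r. \<forall>m\<in>carrier M. f (r \<odot>\<^bsub>M\<^esub> m) = r \<odot>\<^bsub>N\<^esub> f m}"

definition free_module :: "('r::ring_1, 'm) module \<Rightarrow> bool" where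
  "free_module M \<longleftrightarrow> left_module M \<and>
     (\<exists>B\<subseteq>carrier M. \<forall>m\<in>carrier M. \<exists>!c :: 'm \<Rightarrow> 'r.
        finite {b. c b \<noteq> 0} \<and> {b. c b \<noteq> 0} \<subseteq> B \<and> m = (\<Oplus>\<^bsub>M\<^esub>b\<in>{b. c b \<noteq> 0}. c b \<odot>\<^bsub>M\<^esub> b))"

definition free_resolution ::
    "('r::ring_1, 'n) module \<Rightarrow> (nat \<Rightarrow> ('r, 'p) module) \<Rightarrow> (nat \<Rightarrow> 'p \<Rightarrow> 'p) \<Rightarrow> ('p \<Rightarrow> 'n) \<Rightarrow> bool"
  where
  "free_resolution N P d \<epsilon> \<longleftrightarrow>
     (\<forall>k. free_module (P k)) \<and>
     \<epsilon> \<in> module_hom (P 0) N \<and> (\<forall>k. d k \<in> module_hom (P (Suc k)) (P k)) \<and>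
     \<epsilon> ` carrier (P 0) = carrier N \<and>
     d 0 ` carrier (P (Suc 0)) = a_kernel (P 0) N \<epsilon> \<and>
     (\<forall>k. d (Suc k) ` carrier (P (Suc (Suc k))) = a_kernel (P (Suc k)) (P k) (d k))"

text \<open>The tensor product of a right module \<open>M\<close> and a left module \<open>N\<close>, as a group: the free abelian
  group on \<open>M \<times> N\<close> modulo biadditivity and balancedness.\<close>

definition tensor_relations ::
    "('r::ring_1, 'm, 'y) module_scheme \<Rightarrow> ('r, 'n, 'z) module_scheme \<Rightarrow> ('m \<times> 'n \<Rightarrow>\<^sub>0 int) set"
  where
  "tensor_relations M N = generate (free_Abelian_group (carrier M \<times> carrier N))
    ({frag_of (m \<oplus>\<^bsub>M\<^esub> m', n) - frag_of (m, n) - frag_of (m', n) | m m' n.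
        m \<in> carrier M \<and> m' \<in> carrier M \<and> n \<in> carrier N} \<union>
     {frag_of (m, n \<oplus>\<^bsub>N\<^esub> n') - frag_of (m, n) - frag_of (m, n') | m n n'.
        m \<in> carrier M \<and> n \<in> carrier N \<and> n' \<in> carrier N} \<union>
     {frag_of (r \<odot>\<^bsub>M\<^esub> m, n) - frag_of (m, r \<odot>\<^bsub>N\<^esub> n) | r m n.
        m \<in> carrier M \<and> n \<in> carrier N})"

definition tensor_group ::
    "('r::ring_1, 'm, 'y) module_scheme \<Rightarrow> ('r, 'n, 'z) module_scheme \<Rightarrow> ('m \<times> 'n \<Rightarrow>\<^sub>0 int) set monoid"
  where
  "tensor_group M N = free_Abelian_group (carrier M \<times> carrier N) Mod tensor_relations M N"

text \<open>The map \<open>f \<otimes> g\<close> into \<open>tensor_group M' N'\<close>. For module homomorphisms \<open>f\<close> and \<open>g\<close> all elements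
  \<open>z\<close> of a coset \<open>X\<close> give the same coset, so that the union is this coset.\<close>

definition tensor_map ::
    "('r::ring_1, 'm', 'y) module_scheme \<Rightarrow> ('r, 'n', 'z) module_scheme \<Rightarrow>
     ('m \<Rightarrow> 'm') \<Rightarrow> ('n \<Rightarrow> 'n') \<Rightarrow> ('m \<times> 'n \<Rightarrow>\<^sub>0 int) set \<Rightarrow> ('m' \<times> 'n' \<Rightarrow>\<^sub>0 int) set" where
  "tensor_map M' N' f g X =
     (\<Union>z\<in>X. tensor_relations M' N' #>\<^bsub>free_Abelian_group (carrier M' \<times> carrier N')\<^esub>
               frag_extend (\<lambda>(m, n). frag_of (f m, g n)) z)"

text \<open>The homology groups of the complex \<open>M \<otimes> P\<^sub>0 \<leftarrow> M \<otimes> P\<^sub>1 \<leftarrow> \<dots>\<close>.\<close>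

fun tensor_cycles ::
    "('r::ring_1, 'm) module \<Rightarrow> (nat \<Rightarrow> ('r, 'p) module) \<Rightarrow> (nat \<Rightarrow> 'p \<Rightarrow> 'p) \<Rightarrow> nat \<Rightarrow>
     ('m \<times> 'p \<Rightarrow>\<^sub>0 int) set set" where
  "tensor_cycles M P d 0 = carrier (tensor_group M (P 0))"
| "tensor_cycles M P d (Suc k) =
     kernel (tensor_group M (P (Suc k))) (tensor_group M (P k)) (tensor_map M (P k) id (d k))"

definition tensor_boundaries ::
    "('r::ring_1, 'm) module \<Rightarrow> (nat \<Rightarrow> ('r, 'p) module) \<Rightarrow> (nat \<Rightarrow> 'p \<Rightarrow> 'p) \<Rightarrow> nat \<Rightarrow>
     ('m \<times> 'p \<Rightarrow>\<^sub>0 int) set set" where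
  "tensor_boundaries M P d k =
     tensor_map M (P k) id (d k) ` carrier (tensor_group M (P (Suc k)))"

definition tensor_homology ::
    "('r::ring_1, 'm) module \<Rightarrow> (nat \<Rightarrow> ('r, 'p) module) \<Rightarrow> (nat \<Rightarrow> 'p \<Rightarrow> 'p) \<Rightarrow> nat \<Rightarrow>
     ('m \<times> 'p \<Rightarrow>\<^sub>0 int) set set monoid" where
  "tensor_homology M P d k =
     (tensor_group M (P k))\<lparr>carrier := tensor_cycles M P d k\<rparr> Mod tensor_boundaries M P d k"

text \<open>\<open>Tor\<close> is computed from a chosen free resolution of the second argument. The elements of the
  resolution are taken from \<open>('n \<times> 'r) list\<close>. This type is large enough for a free resolution of any
  module on \<open>'n\<close> to exist: it is infinite, at least as large as \<open>'n\<close> and \<open>'r\<close>, and has as many elements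
  as there are lists over it, so that the free module on the elements of a module contained in it can
  again be realised inside it.\<close>

definition chosen_resolution ::
    "('r::ring_1, 'n) module \<Rightarrow>
     (nat \<Rightarrow> ('r, ('n \<times> 'r) list) module) \<times> (nat \<Rightarrow> ('n \<times> 'r) list \<Rightarrow> ('n \<times> 'r) list)" where
  "chosen_resolution N = (SOME (P, d). \<exists>\<epsilon>. free_resolution N P d \<epsilon>)"

definition Tor ::
    "nat \<Rightarrow> ('r::ring_1, 'm) module \<Rightarrow> ('r, 'n) module \<Rightarrow>
     ('m \<times> ('n \<times> 'r) list \<Rightarrow>\<^sub>0 int) set set monoid" where
  "Tor k M N = (case chosen_resolution N of (P, d) \<Rightarrow> tensor_homology M P d k)"


section \<open>Modules over Lie algebras\<close>

record ('g, 'm) lie_mod = "(complex, 'm) module" +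
  lact :: "'g \<Rightarrow> 'm \<Rightarrow> 'm"

locale lie_module = left_module M for M :: "('g::complex_lie_algebra, 'm) lie_mod" (structure) +
  assumes lact_closed: "m \<in> carrier M \<Longrightarrow> lact M x m \<in> carrier M"
    and lact_add_right:
      "m \<in> carrier M \<Longrightarrow> n \<in> carrier M \<Longrightarrow> lact M x (m \<oplus> n) = lact M x m \<oplus> lact M x n"
    and lact_smult_right: "m \<in> carrier M \<Longrightarrow> lact M x (c \<odot> m) = c \<odot> lact M x m"
    and lact_add_left: "m \<in> carrier M \<Longrightarrow> lact M (x + y) m = lact M x m \<oplus> lact M y m"
    and lact_smult_left: "m \<in> carrier M \<Longrightarrow> lact M (c *\<^sub>C x) m = c \<odot> lact M x m"
    and lact_bracket:
      "m \<in> carrier M \<Longrightarrow> lact M (bracket x y) m = lact M x (lact M y m) \<ominus> lact M y (lact M x m)"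

definition lie_submodule :: "'m set \<Rightarrow> ('g, 'm) lie_mod \<Rightarrow> bool" where
  "lie_submodule N M \<longleftrightarrow> N \<subseteq> carrier M \<and> \<zero>\<^bsub>M\<^esub> \<in> N \<and> (\<forall>m\<in>N. \<forall>n\<in>N. m \<oplus>\<^bsub>M\<^esub> n \<in> N) \<and>
     (\<forall>c. \<forall>m\<in>N. c \<odot>\<^bsub>M\<^esub> m \<in> N) \<and> (\<forall>x. \<forall>m\<in>N. lact M x m \<in> N)"

definition simple_fd :: "('g::complex_lie_algebra, 'm) lie_mod \<Rightarrow> bool" where
  "simple_fd M \<longleftrightarrow> lie_module M \<and>
     (\<exists>B. finite B \<and> B \<subseteq> carrier M \<and>
        (\<forall>m\<in>carrier M. \<exists>c. m = (\<Oplus>\<^bsub>M\<^esub>b\<in>B. c b \<odot>\<^bsub>M\<^esub> b))) \<and>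
     carrier M \<noteq> {\<zero>\<^bsub>M\<^esub>} \<and>
     (\<forall>N. lie_submodule N M \<longrightarrow> N = {\<zero>\<^bsub>M\<^esub>} \<or> N = carrier M)"

definition lie_module_iso :: "('g, 'm) lie_mod \<Rightarrow> ('g, 'n) lie_mod \<Rightarrow> bool" where
  "lie_module_iso M N \<longleftrightarrow> (\<exists>f \<in> module_hom M N. bij_betw f (carrier M) (carrier N) \<and>
     (\<forall>x. \<forall>m\<in>carrier M. f (lact M x m) = lact N x (f m)))"

text \<open>Isomorphism classes are formed among the modules whose elements belong to the type
  \<open>nat \<Rightarrow> complex\<close>; every finite-dimensional module is isomorphic to one of these.\<close>

type_synonym 'g lie_class = "('g, nat \<Rightarrow> complex) lie_mod set"

definition iso_class :: "('g::complex_lie_algebra, 'm) lie_mod \<Rightarrow> 'g lie_class" where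
  "iso_class M = {N. lie_module N \<and> lie_module_iso M N}"

definition simple_classes :: "'g::complex_lie_algebra lie_class set" where
  "simple_classes = iso_class ` {S :: ('g, nat \<Rightarrow> complex) lie_mod. simple_fd S}"

definition lie_pullback ::
    "('g \<Rightarrow> 'h) \<Rightarrow> ('h, 'm) lie_mod \<Rightarrow> ('g, 'm) lie_mod" where
  "lie_pullback f M =
     \<lparr>carrier = carrier M, monoid.mult = monoid.mult M, monoid.one = monoid.one M,
      ring.zero = ring.zero M, ring.add = ring.add M, smult = smult M, lact = (\<lambda>x. lact M (f x))\<rparr>"

text \<open>The map of isomorphism classes induced by \<open>lie_pullback\<close>.\<close>

definition pullback_class ::
    "('g::complex_lie_algebra \<Rightarrow> 'h) \<Rightarrow> 'h lie_class \<Rightarrow> 'g lie_class" where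
  "pullback_class f X = (\<Union>S\<in>X. iso_class (lie_pullback f S))"

definition character_module :: "('h \<Rightarrow> complex) \<Rightarrow> ('h, complex) lie_mod" where
  "character_module \<chi> =
     \<lparr>carrier = UNIV, monoid.mult = (*), monoid.one = 1, ring.zero = 0, ring.add = (+),
      smult = (*), lact = (\<lambda>h z. \<chi> h * z)\<rparr>"

definition lie_tensor ::
    "('h, 'm) lie_mod \<Rightarrow> ('h, 'n) lie_mod \<Rightarrow> ('h, ('m \<times> 'n \<Rightarrow>\<^sub>0 int) set) lie_mod" where
  "lie_tensor M N = (let T = tensor_group M N in
     \<lparr>carrier = carrier T, monoid.mult = undefined, monoid.one = undefined,
      ring.zero = \<one>\<^bsub>T\<^esub>, ring.add = (\<lambda>s t. s \<otimes>\<^bsub>T\<^esub> t),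
      smult = (\<lambda>c. tensor_map M N (\<lambda>m. c \<odot>\<^bsub>M\<^esub> m) id),
      lact = (\<lambda>h t. tensor_map M N (lact M h) id t \<otimes>\<^bsub>T\<^esub> tensor_map M N id (lact N h) t)\<rparr>)"

text \<open>The dual space, consisting of the linear functionals extended by \<open>undefined\<close> outside of the
  carrier. Here \<open>lact\<close> is the right action \<open>(f \<cdot> x) s = f (x \<cdot> s)\<close>.\<close>

definition lie_dual :: "('g, 'm) lie_mod \<Rightarrow> ('g, 'm \<Rightarrow> complex) lie_mod" where
  "lie_dual S =
     \<lparr>carrier = {f \<in> extensional (carrier S).
        (\<forall>s\<in>carrier S. \<forall>t\<in>carrier S. f (s \<oplus>\<^bsub>S\<^esub> t) = f s + f t) \<and>
        (\<forall>c. \<forall>s\<in>carrier S. f (c \<odot>\<^bsub>S\<^esub> s) = c * f s)},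
      monoid.mult = undefined, monoid.one = undefined,
      ring.zero = (\<lambda>s\<in>carrier S. 0),
      ring.add = (\<lambda>f g. \<lambda>s\<in>carrier S. f s + g s),
      smult = (\<lambda>c f. \<lambda>s\<in>carrier S. c * f s),
      lact = (\<lambda>x f. \<lambda>s\<in>carrier S. f (lact S x s))\<rparr>"

text \<open>A word \<open>x\<^sub>1 \<dots> x\<^sub>n\<close> acts on a left module by \<open>m \<mapsto> x\<^sub>1 \<cdot> (\<dots> (x\<^sub>n \<cdot> m))\<close> and on a right
  module by \<open>m \<mapsto> ((m \<cdot> x\<^sub>1) \<dots>) \<cdot> x\<^sub>n\<close>. On (left or right) modules over the Lie algebra the ideal
  \<open>uea_ideal\<close> acts as zero, so that it does not matter which representative \<open>rep_uea u\<close> is.\<close>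

definition free_algebra_act ::
    "('g list \<Rightarrow> 'm \<Rightarrow> 'm) \<Rightarrow> ('g, 'm) lie_mod \<Rightarrow> 'g free_algebra \<Rightarrow> 'm \<Rightarrow> 'm" where
  "free_algebra_act act M p m =
     (\<Oplus>\<^bsub>M\<^esub>w\<in>Poly_Mapping.keys p. Poly_Mapping.lookup p w \<odot>\<^bsub>M\<^esub> act (letters w) m)"

definition uea_left_module :: "('g::complex_lie_algebra, 'm) lie_mod \<Rightarrow> ('g uea, 'm) module" where
  "uea_left_module M =
     \<lparr>carrier = carrier M, monoid.mult = monoid.mult M, monoid.one = monoid.one M,
      ring.zero = ring.zero M, ring.add = ring.add M,
      smult = (\<lambda>u. free_algebra_act (foldr (lact M)) M (rep_uea u))\<rparr>"

definition uea_right_module :: "('g::complex_lie_algebra, 'm) lie_mod \<Rightarrow> ('g uea, 'm) module" where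
  "uea_right_module M =
     \<lparr>carrier = carrier M, monoid.mult = monoid.mult M, monoid.one = monoid.one M,
      ring.zero = ring.zero M, ring.add = ring.add M,
      smult = (\<lambda>u. free_algebra_act (fold (lact M)) M (rep_uea u))\<rparr>"

definition taylor_spectrum :: "('g::complex_lie_algebra, 'v) lie_mod \<Rightarrow> 'g lie_class set" where
  "taylor_spectrum V = {iso_class S | S :: ('g, nat \<Rightarrow> complex) lie_mod.
     simple_fd S \<and>
     (\<exists>k. let T = Tor k (uea_right_module (lie_dual S)) (uea_left_module V)
          in carrier T \<noteq> {\<one>\<^bsub>T\<^esub>})}"

end

theory Submission
  imports Defs "HOL-Library.Multiset" "HOL-Library.Function_Algebras"
begin

text \<open>Let \<open>c\<close> span the ideal \<open>\<complex>\<^sub>\<lambda>\<close> and let \<open>R = U\<gg>\<close>. Then \<open>U\<hh> = R/Rc\<close>, and \<open>cu = \<sigma>(u)c\<close> for the automorphism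
  \<open>\<sigma>(x) = x - \<lambda>(x)\<close> of \<open>R\<close>. By the Poincare--Birkhoff--Witt theorem \<open>c\<close> is not a zero divisor. Lift the
  differentials of a free \<open>U\<hh>\<close>-resolution \<open>F\<close> of \<open>V\<close> to matrices \<open>L\<close> over \<open>R\<close>; then \<open>L\<^sup>2 = Tc\<close>, and the
  sum of \<open>F\<close> and a shifted copy of \<open>F\<close>, both with coefficients in \<open>R\<close>, is a free \<open>R\<close>-resolution \<open>G\<close>
  of \<open>V\<^sup>\<pi>\<close> with differential \<open>(x, y) \<mapsto> (xL + yc, - y\<sigma>(L) - xT)\<close>.
  Let \<open>N\<close> be the dual of a simple \<open>\<gg>\<close>-module. Either \<open>c\<close> is invertible on \<open>N\<close>, and then \<open>N \<otimes> G\<close> is exact,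
  or \<open>c\<close> is zero on \<open>N\<close>, and then \<open>N \<otimes> G\<close> is an extension of \<open>N \<otimes> F\<close> by a shift of \<open>N' \<otimes> F\<close>, where
  \<open>N'\<close> is \<open>N\<close> with the action twisted by \<open>\<sigma>\<close>; for \<open>N = S\<^sup>*\<close> this is the dual of \<open>S\<^bsub>-\<lambda>\<^esub>\<close>.
  If \<open>\<lambda> = 0\<close>, then \<open>N' = N\<close>, and since the connecting map lowers the degree by 2, the nonzero homology
  group of \<open>N \<otimes> F\<close> of lowest degree is a quotient of a homology group of \<open>N \<otimes> G\<close>.\<close>

text \<open>\<open>Tor\<close> is defined through a resolution picked by choice and through tensor
  products made of cosets of a free abelian group. Both are eliminated once and for all: vanishing
  of \<open>Tor\<close> becomes solvability of linear systems over the module, for any resolution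
  written as matrices, and only such systems occur afterwards. The obvious candidate for G, the cone
  of multiplication by c on the lifted matrices, fails to be a complex because L^2 vanishes only
  modulo c. The correction T is forced, and no higher corrections arise: the remaining identities TS
  = LT and SS = cT, with S = \<sigma>(L), become true after right multiplication by c, where both
  sides are L^3 respectively cL^2, and c can be cancelled. The map \<sigma> is the price of moving c
  past the entries of a matrix. What the proof takes from the Poincare--Birkhoff--Witt theorem is
  the injectivity of multiplication by c. It is read off from an action of U\<gg> on polynomials in
  which c is the first basis vector and therefore acts as multiplication by a variable.\<close>

abbreviation "lookup \<equiv> Poly_Mapping.lookup"
abbreviation "single \<equiv> Poly_Mapping.single"
abbreviation "keys \<equiv> Poly_Mapping.keys"

section \<open>Finitely supported row vectors and matrices\<close>

text \<open>The coefficient is an argument of \<open>g\<close> instead of a scalar multiplying it,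
  so that one sum covers products with matrices, evaluation of noncommutative polynomials, expansion
  in a basis and ordered monomials, whose values lie in unrelated types.\<close>

definition lext :: "('k \<Rightarrow> 'a::zero \<Rightarrow> 'c::comm_monoid_add) \<Rightarrow> ('k \<Rightarrow>\<^sub>0 'a) \<Rightarrow> 'c" where
  "lext g x = (\<Sum>k\<in>keys x. g k (lookup x k))"

lemma lext_superset:
  assumes "finite A" "keys x \<subseteq> A" "\<And>k. g k 0 = 0"
  shows "lext g x = (\<Sum>k\<in>A. g k (lookup x k))"
  unfolding lext_def
  by (rule sum.mono_neutral_left) (use assms in \<open>auto simp: in_keys_iff\<close>)

lemma lext_zero [simp]: "lext g 0 = 0"
  by (simp add: lext_def)

text \<open>Additivity of \<open>g k\<close> is asked only at the two coefficients in question: the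
  actions used later are additive only on the carrier of a module, not on the whole type.\<close>

lemma lext_add:
  fixes x y :: "'k \<Rightarrow>\<^sub>0 'a::monoid_add"
  assumes "\<And>k. g k 0 = 0"
    and "\<And>k. g k (lookup x k + lookup y k) =
          g k (lookup x k) + g k (lookup y k)"
  shows "lext g (x + y) = lext g x + lext g y"
proof -
  let ?A = "keys x \<union> keys y"
  have "lext g z = (\<Sum>k\<in>?A. g k (lookup z k))" if "z = x \<or> z = y \<or> z = x + y" for z
    by (rule lext_superset) (use that assms(1) Poly_Mapping.keys_add[of x y] in auto)
  then show ?thesis
    by (simp add: lookup_add assms sum.distrib)
qed

lemma lext_single: "g k 0 = 0 \<Longrightarrow> lext g (single k a) = g k a"
  by (simp add: lext_def)

lemma lext_cong:
  assumes "\<And>k. k \<in> keys x \<Longrightarrow>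
    g k (lookup x k) = h k (lookup x k)"
  shows "lext g x = lext h x"
  unfolding lext_def using assms by (rule sum.cong[OF refl])

lemma poly_mapping_sum_single:
  "x = (\<Sum>k\<in>keys x. single k (lookup x k))"
proof (rule poly_mapping_eqI)
  fix j
  show "lookup x j =
    lookup (\<Sum>k\<in>keys x. single k (lookup x k)) j"
    by (cases "j \<in> keys x")
      (auto simp: lookup_sum lookup_single when_def sum.delta' in_keys_iff)
qed

text \<open>A module is a subset of a group type here (the dual of S will be a subset of a function
  type), so membership of the entries has to be carried along; \<open>B\<close> stands for the basis
  of a free module.\<close>

definition FV :: "'b set \<Rightarrow> 'm::zero set \<Rightarrow> ('b \<Rightarrow>\<^sub>0 'm) set" where
  "FV B M = {x. keys x \<subseteq> B \<and> (\<forall>k. lookup x k \<in> M)}"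

lemma FV_UNIV [simp]: "FV UNIV UNIV = UNIV"
  by (simp add: FV_def)

lemma FV_lookup: "x \<in> FV B M \<Longrightarrow> lookup x k \<in> M"
  by (simp add: FV_def)

lemma FV_mono: "x \<in> FV B M \<Longrightarrow> B \<subseteq> B' \<Longrightarrow> x \<in> FV B' M"
  by (auto simp: FV_def)

lemma FV_single: "0 \<in> M \<Longrightarrow> b \<in> B \<Longrightarrow> m \<in> M \<Longrightarrow> single b m \<in> FV B M"
  by (auto simp: FV_def lookup_single when_def)

lemma FV_zero: "0 \<in> M \<Longrightarrow> 0 \<in> FV B M"
  by (simp add: FV_def)

lemma FV_R_iff: "x \<in> FV B UNIV \<longleftrightarrow> keys x \<subseteq> B"
  by (simp add: FV_def)

locale right_action =
  fixes M :: "'m::ab_group_add set" and act :: "'m \<Rightarrow> 'r::ring_1 \<Rightarrow> 'm"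
  assumes zero_mem: "0 \<in> M"
    and add_mem: "m \<in> M \<Longrightarrow> n \<in> M \<Longrightarrow> m + n \<in> M"
    and uminus_mem: "m \<in> M \<Longrightarrow> - m \<in> M"
    and act_mem: "m \<in> M \<Longrightarrow> act m r \<in> M"
    and act_add_left: "m \<in> M \<Longrightarrow> n \<in> M \<Longrightarrow> act (m + n) r = act m r + act n r"
    and act_add_right: "m \<in> M \<Longrightarrow> act m (r + s) = act m r + act m s"
    and act_mult: "m \<in> M \<Longrightarrow> act m (r * s) = act (act m r) s"
    and act_one: "m \<in> M \<Longrightarrow> act m 1 = m"

text \<open>\<open>Poly_Mapping.map\<close> leaves entries outside the support at 0, which is the
  intended product because \<open>act m 0 = 0\<close> on \<open>M\<close>.\<close>

definition rscale :: "('m \<Rightarrow> 'r::zero \<Rightarrow> 'm::zero) \<Rightarrow> 'm \<Rightarrow> ('b \<Rightarrow>\<^sub>0 'r) \<Rightarrow> ('b \<Rightarrow>\<^sub>0 'm)" where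
  "rscale act m p = Poly_Mapping.map (act m) p"

text \<open>The product of a row vector with a matrix; the matrix is the family of its rows.\<close>

definition vm :: "('m \<Rightarrow> 'r::zero \<Rightarrow> 'm) \<Rightarrow> ('b \<Rightarrow>\<^sub>0 'm) \<Rightarrow> ('b \<Rightarrow> ('c \<Rightarrow>\<^sub>0 'r)) \<Rightarrow> ('c \<Rightarrow>\<^sub>0 'm::ab_group_add)"
  where "vm act x D = lext (\<lambda>b m. rscale act m (D b)) x"

context right_action
begin

lemma act_zero_right: "m \<in> M \<Longrightarrow> act m 0 = 0"
  using act_add_right[of m 0 0] by simp

lemma act_zero_left: "act 0 r = 0"
  using act_add_left[of 0 0 r] zero_mem by simp

lemma FV_add: "x \<in> FV B M \<Longrightarrow> y \<in> FV B M \<Longrightarrow> x + y \<in> FV B M"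
  using Poly_Mapping.keys_add[of x y] by (auto simp: FV_def lookup_add add_mem)

lemma FV_uminus: "x \<in> FV B M \<Longrightarrow> - x \<in> FV B M"
  by (auto simp: FV_def uminus_mem in_keys_iff)

lemma FV_diff: "x \<in> FV B M \<Longrightarrow> y \<in> FV B M \<Longrightarrow> x - y \<in> FV B M"
  using FV_add[of x B "- y"] FV_uminus[of y] by simp

lemma FV_sum: "(\<And>i. i \<in> I \<Longrightarrow> f i \<in> FV B M) \<Longrightarrow> sum f I \<in> FV B M"
  by (induction I rule: infinite_finite_induct) (auto simp: FV_zero zero_mem FV_add)

text \<open>Vectors are generated additively by those with one entry. The \<open>add\<close> case
  carries no disjointness condition on supports, so linear identities pass through it
  directly.\<close>

lemma FV_induct [consumes 1, case_names zero single add]: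
  fixes x :: "'b \<Rightarrow>\<^sub>0 'm"
  assumes "x \<in> FV B M"
    and "P 0"
    and "\<And>b m. b \<in> B \<Longrightarrow> m \<in> M \<Longrightarrow> P (single b m)"
    and "\<And>x y. x \<in> FV B M \<Longrightarrow> y \<in> FV B M \<Longrightarrow> P x \<Longrightarrow> P y \<Longrightarrow> P (x + y)"
  shows "P x"
proof -
  have s: "single k (lookup x k) \<in> FV B M" 
    if "k \<in> keys x" for k
    using that assms(1) by (intro FV_single zero_mem) (auto simp: FV_def)
  have "sum f I \<in> FV B M \<and> P (sum f I)"
    if "finite I" "\<And>k. k \<in> I \<Longrightarrow> f k \<in> FV B M \<and> P (f k)" for I and f :: "'c \<Rightarrow> 'b \<Rightarrow>\<^sub>0 'm"
    using that
  proof (induction I rule: finite_induct)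
    case empty
    then show ?case by (simp add: FV_zero zero_mem assms(2))
  next
    case (insert a I)
    then show ?case by (simp add: FV_add assms(4))
  qed
  from this[of "keys x" "\<lambda>k. single k (lookup x k)"]
  show ?thesis
    using poly_mapping_sum_single[of x] s assms(1,3) by (force simp: FV_def)
qed

lemma lookup_rscale: "m \<in> M \<Longrightarrow> lookup (rscale act m p) c = act m (lookup p c)"
  by (auto simp: rscale_def Poly_Mapping.map.rep_eq when_def act_zero_right)

lemma rscale_mem: "m \<in> M \<Longrightarrow> p \<in> FV B UNIV \<Longrightarrow> rscale act m p \<in> FV B M"
  by (auto simp: FV_def lookup_rscale act_mem in_keys_iff act_zero_right subset_iff) (metis act_zero_right)

lemma rscale_add_left: "m \<in> M \<Longrightarrow> n \<in> M \<Longrightarrow> rscale act (m + n) p = rscale act m p + rscale act n p"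
  by (rule poly_mapping_eqI) (simp add: lookup_rscale lookup_add act_add_left add_mem)

lemma rscale_add_right: "m \<in> M \<Longrightarrow> rscale act m (p + q) = rscale act m p + rscale act m q"
  by (rule poly_mapping_eqI) (simp add: lookup_rscale lookup_add act_add_right)

lemma rscale_zero_left: "rscale act 0 p = 0"
  by (rule poly_mapping_eqI) (simp add: lookup_rscale zero_mem act_zero_left)

lemma rscale_zero_right: "m \<in> M \<Longrightarrow> rscale act m 0 = 0"
  by (rule poly_mapping_eqI) (simp add: lookup_rscale act_zero_right)

lemma rscale_single: "m \<in> M \<Longrightarrow> rscale act m (single c r) = single c (act m r)"
  by (rule poly_mapping_eqI) (simp add: lookup_rscale lookup_single act_zero_right when_def)

lemma rscale_rscale: "m \<in> M \<Longrightarrow> rscale act (act m r) p = rscale act m (rscale (*) r p)"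
  by (rule poly_mapping_eqI)
     (auto simp: lookup_rscale act_mem act_mult rscale_def[of "(*)"] Poly_Mapping.map.rep_eq when_def act_zero_right)

lemma vm_zero [simp]: "vm act 0 D = 0"
  by (simp add: vm_def)

lemma vm_add: "x \<in> FV B M \<Longrightarrow> y \<in> FV B' M \<Longrightarrow> vm act (x + y) D = vm act x D + vm act y D"
  unfolding vm_def
  by (rule lext_add) (auto simp: rscale_zero_left rscale_add_left FV_lookup)

lemma vm_single: "vm act (single b m) D = rscale act m (D b)"
  unfolding vm_def by (simp add: lext_single rscale_zero_left)

lemma vm_mem: "x \<in> FV B M \<Longrightarrow> (\<And>b. b \<in> B \<Longrightarrow> D b \<in> FV C UNIV) \<Longrightarrow> vm act x D \<in> FV C M"
  unfolding vm_def lext_def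
  by (rule FV_sum) (auto simp: FV_def[of B] intro: rscale_mem)

lemma vm_mem_UNIV: "x \<in> FV B M \<Longrightarrow> vm act x D \<in> FV UNIV M"
  by (rule vm_mem[where B = B]) (auto)

lemma vm_uminus: "x \<in> FV B M \<Longrightarrow> vm act (- x) D = - vm act x D"
  using vm_add[of x B "- x" B D] FV_uminus[of x] by (simp add: add_eq_0_iff2)

lemma vm_diff: "x \<in> FV B M \<Longrightarrow> y \<in> FV B' M \<Longrightarrow> vm act (x - y) D = vm act x D - vm act y D"
  using vm_add[of x B "- y" B' D] FV_uminus[of y] vm_uminus[of y B' D] by simp

lemma lookup_vm:
  "x \<in> FV B M \<Longrightarrow> lookup (vm act x D) c =
     (\<Sum>b\<in>keys x. act (lookup x b) (lookup (D b) c))"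
  by (simp add: vm_def lext_def lookup_sum lookup_rscale FV_lookup)

lemma vm_cong:
  "x \<in> FV B M \<Longrightarrow> (\<And>b. b \<in> B \<Longrightarrow> D b = E b) \<Longrightarrow> vm act x D = vm act x E"
  unfolding vm_def by (rule lext_cong) (auto simp: FV_def)

lemma vm_mat_add: "x \<in> FV B M \<Longrightarrow> vm act x (\<lambda>b. D b + E b) = vm act x D + vm act x E"
  unfolding vm_def lext_def by (simp add: rscale_add_right FV_lookup sum.distrib)

lemma vm_mat_zero: "x \<in> FV B M \<Longrightarrow> vm act x (\<lambda>b. 0) = 0"
  unfolding vm_def lext_def by (simp add: rscale_zero_right FV_lookup)

lemma vm_mat_uminus:
  assumes "x \<in> FV B M"
  shows "vm act x (\<lambda>b. - D b) = - vm act x D"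
proof -
  have "vm act x D + vm act x (\<lambda>b. - D b) = 0"
    using assms by (simp add: vm_mat_add[symmetric] vm_mat_zero)
  then show ?thesis
    by (simp add: eq_neg_iff_add_eq_0 add.commute)
qed

lemma vm_mat_diff: "x \<in> FV B M \<Longrightarrow> vm act x (\<lambda>b. D b - E b) = vm act x D - vm act x E"
  using vm_mat_add[of x B D "\<lambda>b. - E b"] vm_mat_uminus[of x B E] by simp

lemma vm_id: "x \<in> FV B M \<Longrightarrow> vm act x (\<lambda>b. single b 1) = x"
  by (induction rule: FV_induct) (auto simp: vm_add vm_single rscale_single act_one)

end

text \<open>Vectors over the ring itself are elements of free modules and rows of matrices; reading
  the ring as a right module over itself makes every fact about \<open>vm\<close> available for
  matrix products, under the prefix \<open>reg\<close>.\<close>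

lemma right_action_regular: "right_action (UNIV :: 'r::ring_1 set) (*)"
  by standard (auto simp: algebra_simps)

interpretation reg: right_action "UNIV :: 'r::ring_1 set" "(*)"
  by (rule right_action_regular)

context right_action
begin

lemma vm_rscale:
  assumes "m \<in> M"
  shows "vm act (rscale act m p) E = rscale act m (vm (*) p E)"
proof -
  have "p \<in> FV UNIV UNIV" by simp
  then show ?thesis
  proof (induction rule: reg.FV_induct)
    case zero
    then show ?case by (simp add: rscale_zero_right assms)
  next
    case (single b r)
    then show ?case by (simp add: rscale_single assms vm_single reg.vm_single rscale_rscale)
  next
    case (add x y)
    have "rscale act m x \<in> FV UNIV M" "rscale act m y \<in> FV UNIV M"
      by (auto intro!: rscale_mem simp: assms)
    then show ?case
      using add by (simp add: rscale_add_right assms vm_add[where B = UNIV and B' = UNIV]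
          reg.vm_add[where B = UNIV and B' = UNIV])
  qed
qed

text \<open>The inner product on the right is the product of two matrices over the ring, the others
  act on entries in \<open>M\<close>. With row vectors the matrices stand on the right and commute
  with left multiplication, as differentials of left modules must.\<close>

lemma vm_assoc:
  assumes "x \<in> FV B M"
  shows "vm act (vm act x D) E = vm act x (\<lambda>b. vm (*) (D b) E)"
  using assms
proof (induction rule: FV_induct)
  case (add x y)
  then have "vm act x D \<in> FV UNIV M" "vm act y D \<in> FV UNIV M"
    by (auto intro: vm_mem_UNIV)
  then show ?case
    using add by (simp add: vm_add)
qed (auto simp: vm_single vm_rscale)

end

section \<open>Resolutions given by matrices, and their comparison\<close>

lemma vm_single_one: "vm (*) (single b (1::'r::ring_1)) D = D b"
  by (rule poly_mapping_eqI) (simp add: reg.vm_single reg.lookup_rscale)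

lemma rscale_one: "rscale (*) (1::'r::ring_1) x = x"
  by (rule poly_mapping_eqI) (simp add: reg.lookup_rscale)

text \<open>Degree 0 of an augmented complex is governed by the augmentation and the others by a
  differential; the case distinction lets exactness be one axiom for all degrees.\<close>

fun rcycle where
  "rcycle V D \<epsilon> 0 x \<longleftrightarrow> \<epsilon> x = \<zero>\<^bsub>V\<^esub>"
| "rcycle V D \<epsilon> (Suc k) x \<longleftrightarrow> vm (*) x (D k) = 0"

text \<open>A free resolution with bases: the module in degree k consists of the vectors supported
  in \<open>B k\<close>, and row b of \<open>D k\<close> is the boundary of the basis element b of
  \<open>B (Suc k)\<close>. One index type serves all degrees; the subsets vary because the
  resolution G has a smaller basis in degree 0.\<close>

locale based_resolution = V: left_module V
  for V :: "('r::ring_1, 'v) module" (structure) +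
  fixes B :: "nat \<Rightarrow> 'b set" and D :: "nat \<Rightarrow> 'b \<Rightarrow> ('b \<Rightarrow>\<^sub>0 'r)" and \<epsilon> :: "('b \<Rightarrow>\<^sub>0 'r) \<Rightarrow> 'v"
  assumes eps_closed: "x \<in> FV (B 0) UNIV \<Longrightarrow> \<epsilon> x \<in> carrier V"
    and eps_add: "x \<in> FV (B 0) UNIV \<Longrightarrow> y \<in> FV (B 0) UNIV \<Longrightarrow> \<epsilon> (x + y) = \<epsilon> x \<oplus> \<epsilon> y"
    and eps_rscale: "x \<in> FV (B 0) UNIV \<Longrightarrow> \<epsilon> (rscale (*) r x) = r \<odot> \<epsilon> x"
    and eps_surj: "v \<in> carrier V \<Longrightarrow> \<exists>x\<in>FV (B 0) UNIV. \<epsilon> x = v"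
    and D_closed: "b \<in> B (Suc k) \<Longrightarrow> D k b \<in> FV (B k) UNIV"
    and exact: "x \<in> FV (B k) UNIV \<Longrightarrow>
      rcycle V D \<epsilon> k x \<longleftrightarrow> (\<exists>w\<in>FV (B (Suc k)) UNIV. x = vm (*) w (D k))"
begin

lemma eps_zero: "\<epsilon> 0 = \<zero>"
proof -
  have "\<epsilon> 0 \<oplus> \<epsilon> 0 = \<epsilon> 0"
    using eps_add[of 0 0] by (simp add: FV_zero)
  then show ?thesis
    using eps_closed[of 0] V.add.l_cancel_one'[of "\<epsilon> 0" "\<epsilon> 0"] by (simp add: FV_zero)
qed

lemma eps_diff:
  assumes "x \<in> FV (B 0) UNIV" "y \<in> FV (B 0) UNIV"
  shows "\<epsilon> (x - y) = \<zero> \<longleftrightarrow> \<epsilon> x = \<epsilon> y"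
proof -
  have "\<epsilon> x = \<epsilon> (x - y) \<oplus> \<epsilon> y"
    using eps_add[of "x - y" y] assms by (simp add: reg.FV_diff)
  moreover have "\<epsilon> (x - y) \<in> carrier V" "\<epsilon> y \<in> carrier V"
    using assms by (auto intro!: eps_closed reg.FV_diff)
  ultimately show ?thesis
    using V.add.right_cancel[of "\<epsilon> y" "\<epsilon> (x - y)" \<zero>] by simp
qed

lemma D_mem: "x \<in> FV (B (Suc k)) UNIV \<Longrightarrow> vm (*) x (D k) \<in> FV (B k) UNIV"
  by (rule reg.vm_mem[where B = "B (Suc k)"]) (auto intro: D_closed)

lemma single_mem: "b \<in> B k \<Longrightarrow> single b (r::'r) \<in> FV (B k) UNIV"
  by (simp add: FV_single)

lemma vm_D_cycle: "x \<in> FV (B (Suc k)) UNIV \<Longrightarrow> rcycle V D \<epsilon> k (vm (*) x (D k))"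
  using exact[OF D_mem[of x k]] by blast

lemma D_cycle: "b \<in> B (Suc k) \<Longrightarrow> rcycle V D \<epsilon> k (D k b)"
  using vm_D_cycle[OF single_mem, of b k 1] by (simp only: vm_single_one)

lemma rcycle_obtain:
  assumes "x \<in> FV (B k) UNIV" "rcycle V D \<epsilon> k x"
  shows "\<exists>w. w \<in> FV (B (Suc k)) UNIV \<and> x = vm (*) w (D k)"
  using exact[OF assms(1)] assms(2) by blast

end

section \<open>The comparison theorem for resolutions\<close>

lemma augmentation_lift:
  fixes V :: "('r::ring_1, 'v) module"
  assumes P: "based_resolution V B D \<epsilon>" and Q: "based_resolution V B' D' \<epsilon>'"
    and f: "\<And>b. b \<in> B 0 \<Longrightarrow> f b \<in> FV (B' 0) UNIV"
      "\<And>b. b \<in> B 0 \<Longrightarrow> \<epsilon>' (f b) = \<epsilon> (single b 1)"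
    and x: "x \<in> FV (B 0) UNIV"
  shows "\<epsilon>' (vm (*) x f) = \<epsilon> x"
proof -
  interpret P: based_resolution V B D \<epsilon> by (rule P)
  interpret Q: based_resolution V B' D' \<epsilon>' by (rule Q)
  show ?thesis
    using x
  proof (induction rule: reg.FV_induct)
    case zero
    then show ?case by (simp add: P.eps_zero Q.eps_zero)
  next
    case (single b r)
    have "\<epsilon>' (vm (*) (single b r) f) = r \<odot>\<^bsub>V\<^esub> \<epsilon> (single b 1)"
      using f single by (simp add: reg.vm_single Q.eps_rscale)
    also have "\<dots> = \<epsilon> (single b r)"
      using P.eps_rscale[OF P.single_mem, of b r 1] single by (simp add: reg.rscale_single)
    finally show ?case .
  next
    case (add x y)
    have "vm (*) x f \<in> FV (B' 0) UNIV" "vm (*) y f \<in> FV (B' 0) UNIV"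
      using add f by (auto intro: reg.vm_mem)
    with add show ?case
      by (simp add: reg.vm_add[OF add(1,2)] P.eps_add Q.eps_add)
  qed
qed

text \<open>Free modules are projective: lifts are chosen degree by degree on basis elements and
  extend by matrix multiplication.\<close>

lemma chain_map_exists:
  fixes V :: "('r::ring_1, 'v) module"
  assumes P: "based_resolution V B D \<epsilon>" and Q: "based_resolution V B' D' \<epsilon>'"
  obtains f where "\<And>k b. b \<in> B k \<Longrightarrow> f k b \<in> FV (B' k) UNIV"
    "\<And>b. b \<in> B 0 \<Longrightarrow> \<epsilon>' (f 0 b) = \<epsilon> (single b 1)"
    "\<And>k b. b \<in> B (Suc k) \<Longrightarrow> vm (*) (f (Suc k) b) (D' k) = vm (*) (D k b) (f k)"
proof -
  interpret P: based_resolution V B D \<epsilon> by (rule P)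
  interpret Q: based_resolution V B' D' \<epsilon>' by (rule Q)
  \<comment> \<open>Besides the range of \<open>f\<close>, the invariant records that
    \<open>f\<close> sends boundaries to cycles; this is exactly what exactness of the target needs
    to find the next \<open>f\<close>.\<close>
  let ?P = "\<lambda>k f. (\<forall>b\<in>B k. f b \<in> FV (B' k) UNIV) \<and>
    (\<forall>b\<in>B (Suc k). rcycle V D' \<epsilon>' k (vm (*) (D k b) f)) \<and>
    (k = 0 \<longrightarrow> (\<forall>b\<in>B 0. \<epsilon>' (f b) = \<epsilon> (single b 1)))"
  let ?Q = "\<lambda>k f g. \<forall>b\<in>B (Suc k). vm (*) (g b) (D' k) = vm (*) (D k b) f"
  have "\<exists>f. \<forall>k. ?P k (f k) \<and> ?Q k (f k) (f (Suc k))"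
  proof (rule dependent_nat_choice)
    have "\<forall>b\<in>B 0. \<exists>x. x \<in> FV (B' 0) UNIV \<and> \<epsilon>' x = \<epsilon> (single b 1)"
      using Q.eps_surj P.eps_closed P.single_mem by (metis (no_types))
    then obtain f where f: "\<forall>b\<in>B 0. f b \<in> FV (B' 0) UNIV \<and> \<epsilon>' (f b) = \<epsilon> (single b 1)"
      by metis
    have "\<epsilon>' (vm (*) x f) = \<epsilon> x" if "x \<in> FV (B 0) UNIV" for x
      by (rule augmentation_lift[OF P Q]) (use f that in auto)
    then have "rcycle V D' \<epsilon>' 0 (vm (*) (D 0 b) f)" if "b \<in> B (Suc 0)" for b
      using that P.D_cycle[of b 0] P.D_closed[of b 0] by simp
    then show "\<exists>f. ?P 0 f"
      using f by (intro exI[of _ f]) auto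
  next
    fix f k
    assume f: "?P k f"
    have "\<exists>w. w \<in> FV (B' (Suc k)) UNIV \<and> vm (*) (D k b) f = vm (*) w (D' k)" if "b \<in> B (Suc k)" for b
      using f that P.D_closed[of b k] by (intro Q.rcycle_obtain reg.vm_mem[of _ "B k"]) auto
    then obtain g where g: "\<And>b. b \<in> B (Suc k) \<Longrightarrow> g b \<in> FV (B' (Suc k)) UNIV"
      "\<And>b. b \<in> B (Suc k) \<Longrightarrow> vm (*) (D k b) f = vm (*) (g b) (D' k)"
      by metis
    have "rcycle V D' \<epsilon>' (Suc k) (vm (*) (D (Suc k) b) g)" if b: "b \<in> B (Suc (Suc k))" for b
    proof -
      note Db = P.D_closed[OF b]
      have "vm (*) (vm (*) (D (Suc k) b) g) (D' k) = vm (*) (D (Suc k) b) (\<lambda>b. vm (*) (g b) (D' k))"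
        by (rule reg.vm_assoc[OF Db])
      also have "\<dots> = vm (*) (D (Suc k) b) (\<lambda>b. vm (*) (D k b) f)"
        using g by (intro reg.vm_cong[OF Db]) auto
      also have "\<dots> = vm (*) (vm (*) (D (Suc k) b) (D k)) f"
        by (rule reg.vm_assoc[OF Db, symmetric])
      also have "\<dots> = 0"
        using P.D_cycle[OF b] by simp
      finally show ?thesis by simp
    qed
    then show "\<exists>g. ?P (Suc k) g \<and> ?Q k f g"
      using g by (intro exI[of _ g]) auto
  qed
  then obtain f where "\<And>k. ?P k (f k) \<and> ?Q k (f k) (f (Suc k))" by metis
  then show ?thesis by (intro that[of f]) blast+
qed

text \<open>A chain endomorphism that induces 0 on the resolved module is null-homotopic. It will be
  applied to the difference between the identity and a round trip between two resolutions.\<close>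

lemma (in based_resolution) null_homotopy:
  assumes \<psi>: "\<And>k b. b \<in> B k \<Longrightarrow> \<psi> k b \<in> FV (B k) UNIV"
    and \<psi>0: "\<And>b. b \<in> B 0 \<Longrightarrow> \<epsilon> (\<psi> 0 b) = \<zero>"
    and ch: "\<And>k b. b \<in> B (Suc k) \<Longrightarrow> vm (*) (\<psi> (Suc k) b) (D k) = vm (*) (D k b) (\<psi> k)"
  obtains h where "\<And>k b. b \<in> B k \<Longrightarrow> h k b \<in> FV (B (Suc k)) UNIV"
    "\<And>b. b \<in> B 0 \<Longrightarrow> \<psi> 0 b = vm (*) (h 0 b) (D 0)"
    "\<And>k b. b \<in> B (Suc k) \<Longrightarrow> \<psi> (Suc k) b = vm (*) (h (Suc k) b) (D (Suc k)) + vm (*) (D k b) (h k)"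
proof -
  \<comment> \<open>The invariant says that \<psi> in the next degree, corrected by the homotopy
    found so far, is a cycle, hence a boundary by exactness.\<close>
  let ?P = "\<lambda>k h. (\<forall>b\<in>B k. h b \<in> FV (B (Suc k)) UNIV) \<and>
    (\<forall>b\<in>B (Suc k). vm (*) (\<psi> (Suc k) b - vm (*) (D k b) h) (D k) = 0) \<and>
    (k = 0 \<longrightarrow> (\<forall>b\<in>B 0. \<psi> 0 b = vm (*) (h b) (D 0)))"
  let ?Q = "\<lambda>k h h'. \<forall>b\<in>B (Suc k). \<psi> (Suc k) b = vm (*) (h' b) (D (Suc k)) + vm (*) (D k b) h"
  have hD: "vm (*) (D k b) h \<in> FV (B (Suc k)) UNIV"
    if "b \<in> B (Suc k)" "\<And>b. b \<in> B k \<Longrightarrow> h b \<in> FV (B (Suc k)) UNIV" for k b h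
    using that D_closed by (intro reg.vm_mem[of _ "B k"]) auto
  have "\<exists>h. \<forall>k. ?P k (h k) \<and> ?Q k (h k) (h (Suc k))"
  proof (rule dependent_nat_choice)
    have "\<exists>w. w \<in> FV (B (Suc 0)) UNIV \<and> \<psi> 0 b = vm (*) w (D 0)" if "b \<in> B 0" for b
      using \<psi> \<psi>0 that by (intro rcycle_obtain) auto
    then obtain h where h: "\<And>b. b \<in> B 0 \<Longrightarrow> h b \<in> FV (B (Suc 0)) UNIV"
       "\<And>b. b \<in> B 0 \<Longrightarrow> \<psi> 0 b = vm (*) (h b) (D 0)"
      by metis
    have "vm (*) (\<psi> (Suc 0) b - vm (*) (D 0 b) h) (D 0) = 0" if b: "b \<in> B (Suc 0)" for b
    proof -
      note Db = D_closed[OF b]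
      have "vm (*) (vm (*) (D 0 b) h) (D 0) = vm (*) (D 0 b) (\<lambda>b. vm (*) (h b) (D 0))"
        by (rule reg.vm_assoc[OF Db])
      also have "\<dots> = vm (*) (D 0 b) (\<psi> 0)"
        using h by (intro reg.vm_cong[OF Db]) auto
      moreover have "vm (*) (D 0 b) h \<in> FV (B (Suc 0)) UNIV"
        using hD[OF b, of h] h by blast
      ultimately show ?thesis
        using ch[OF b] by (simp add: reg.vm_diff[OF \<psi>[OF b]])
    qed
    then show "\<exists>h. ?P 0 h"
      using h by (intro exI[of _ h]) auto
  next
    fix h k
    assume h: "?P k h"
    have "\<exists>w. w \<in> FV (B (Suc (Suc k))) UNIV \<and> \<psi> (Suc k) b - vm (*) (D k b) h = vm (*) w (D (Suc k))"
      if b: "b \<in> B (Suc k)" for b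
      using h that \<psi>[OF b] hD[OF b, of h] by (intro rcycle_obtain reg.FV_diff) auto
    then obtain g where g: "\<And>b. b \<in> B (Suc k) \<Longrightarrow> g b \<in> FV (B (Suc (Suc k))) UNIV"
      "\<And>b. b \<in> B (Suc k) \<Longrightarrow> \<psi> (Suc k) b - vm (*) (D k b) h = vm (*) (g b) (D (Suc k))"
      by metis
    then have g': "\<And>b. b \<in> B (Suc k) \<Longrightarrow> \<psi> (Suc k) b = vm (*) (g b) (D (Suc k)) + vm (*) (D k b) h"
      by (metis diff_add_cancel)
    have "vm (*) (\<psi> (Suc (Suc k)) b - vm (*) (D (Suc k) b) g) (D (Suc k)) = 0"
      if b: "b \<in> B (Suc (Suc k))" for b
    proof -
      note Db = D_closed[OF b]
      have "vm (*) (vm (*) (D (Suc k) b) g) (D (Suc k)) =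
          vm (*) (D (Suc k) b) (\<lambda>b. vm (*) (g b) (D (Suc k)))"
        by (rule reg.vm_assoc[OF Db])
      also have "\<dots> = vm (*) (D (Suc k) b) (\<lambda>b. \<psi> (Suc k) b - vm (*) (D k b) h)"
        using g by (intro reg.vm_cong[OF Db]) auto
      also have "\<dots> = vm (*) (D (Suc k) b) (\<psi> (Suc k)) - vm (*) (vm (*) (D (Suc k) b) (D k)) h"
        by (simp add: reg.vm_mat_diff[OF Db] reg.vm_assoc[OF Db])
      also have "\<dots> = vm (*) (D (Suc k) b) (\<psi> (Suc k))"
        using D_cycle[OF b] by simp
      moreover have "vm (*) (D (Suc k) b) g \<in> FV (B (Suc (Suc k))) UNIV"
        using hD[OF b, of g] g by blast
      ultimately show ?thesis
        using ch[OF b] by (simp add: reg.vm_diff[OF \<psi>[OF b]])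
    qed
    then show "\<exists>g. ?P (Suc k) g \<and> ?Q k h g"
      using g(1) g' by (intro exI[of _ g]) auto
  qed
  then obtain h where "\<And>k. ?P k (h k) \<and> ?Q k (h k) (h (Suc k))" by metis
  then show ?thesis by (intro that[of h]) blast+
qed

text \<open>In degree 0 the inner premise is void: after tensoring there is no augmentation, so
  exactness at 0 says that the lowest homology group, the tensor product with the resolved module,
  is zero.\<close>

definition exact_at ::
    "'m::ab_group_add set \<Rightarrow> ('m \<Rightarrow> 'r::ring_1 \<Rightarrow> 'm) \<Rightarrow> (nat \<Rightarrow> 'b set) \<Rightarrow> (nat \<Rightarrow> 'b \<Rightarrow> ('b \<Rightarrow>\<^sub>0 'r)) \<Rightarrow>
     nat \<Rightarrow> bool" where
  "exact_at M act B D k \<longleftrightarrow> (\<forall>x\<in>FV (B k) M. (\<forall>j. k = Suc j \<longrightarrow> vm act x (D j) = 0) \<longrightarrow>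
     (\<exists>w\<in>FV (B (Suc k)) M. x = vm act w (D k)))"

text \<open>A cycle is pushed to the other resolution, filled there and pulled back; the round trip
  is homotopic to the identity. Thus vanishing does not depend on the chosen resolution.\<close>

lemma exact_at_transfer:
  fixes V :: "('r::ring_1, 'v) module"
  assumes N: "right_action M act"
    and P: "based_resolution V B D \<epsilon>" and Q: "based_resolution V B' D' \<epsilon>'"
    and ex: "exact_at M act B' D' k"
  shows "exact_at M act B D k"
proof -
  interpret N: right_action M act by (rule N)
  interpret P: based_resolution V B D \<epsilon> by (rule P)
  interpret Q: based_resolution V B' D' \<epsilon>' by (rule Q)
  obtain f where f: "\<And>k b. b \<in> B k \<Longrightarrow> f k b \<in> FV (B' k) UNIV"
    "\<And>b. b \<in> B 0 \<Longrightarrow> \<epsilon>' (f 0 b) = \<epsilon> (single b 1)"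
    "\<And>k b. b \<in> B (Suc k) \<Longrightarrow> vm (*) (f (Suc k) b) (D' k) = vm (*) (D k b) (f k)"
    by (rule chain_map_exists[OF P Q]) blast
  obtain g where g: "\<And>k b. b \<in> B' k \<Longrightarrow> g k b \<in> FV (B k) UNIV"
    "\<And>b. b \<in> B' 0 \<Longrightarrow> \<epsilon> (g 0 b) = \<epsilon>' (single b 1)"
    "\<And>k b. b \<in> B' (Suc k) \<Longrightarrow> vm (*) (g (Suc k) b) (D k) = vm (*) (D' k b) (g k)"
    by (rule chain_map_exists[OF Q P]) blast
  \<comment> \<open>The identity minus the round trip; it induces 0 on V, so
    \<open>null_homotopy\<close> applies.\<close>
  define \<psi> where "\<psi> k b = single b 1 - vm (*) (f k b) (g k)" for k b
  have fg: "vm (*) (f k b) (g k) \<in> FV (B k) UNIV" if "b \<in> B k" for k b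
    using that f(1) g(1) by (intro reg.vm_mem[of _ "B' k"]) auto
  have \<psi>_mem: "\<psi> k b \<in> FV (B k) UNIV" if "b \<in> B k" for k b
    using fg P.single_mem that unfolding \<psi>_def by (intro reg.FV_diff) auto
  have eg: "\<epsilon> (vm (*) x (g 0)) = \<epsilon>' x" if "x \<in> FV (B' 0) UNIV" for x
    by (rule augmentation_lift[OF Q P]) (use g that in auto)
  have \<psi>_ch: "vm (*) (\<psi> (Suc k) b) (D k) = vm (*) (D k b) (\<psi> k)" if b: "b \<in> B (Suc k)" for k b
  proof -
    note Db = P.D_closed[OF b]
    have "vm (*) (vm (*) (f (Suc k) b) (g (Suc k))) (D k) =
        vm (*) (f (Suc k) b) (\<lambda>b. vm (*) (g (Suc k) b) (D k))"
      by (rule reg.vm_assoc[OF f(1)[OF b]])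
    also have "\<dots> = vm (*) (f (Suc k) b) (\<lambda>b. vm (*) (D' k b) (g k))"
      by (rule reg.vm_cong[OF f(1)[OF b]]) (rule g(3))
    also have "\<dots> = vm (*) (vm (*) (f (Suc k) b) (D' k)) (g k)"
      by (rule reg.vm_assoc[OF f(1)[OF b], symmetric])
    also have "\<dots> = vm (*) (vm (*) (D k b) (f k)) (g k)"
      using f(3)[OF b] by simp
    also have "\<dots> = vm (*) (D k b) (\<lambda>b. vm (*) (f k b) (g k))"
      by (rule reg.vm_assoc[OF Db])
    finally have "vm (*) (vm (*) (f (Suc k) b) (g (Suc k))) (D k) = \<dots>" .
    then show ?thesis
      unfolding \<psi>_def reg.vm_diff[OF P.single_mem[OF b] fg[OF b]]
      by (simp add: reg.vm_mat_diff[OF Db] reg.vm_id[OF Db] vm_single_one)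
  qed
  have \<psi>_0: "\<epsilon> (\<psi> 0 b) = \<zero>\<^bsub>V\<^esub>" if "b \<in> B 0" for b
    unfolding \<psi>_def using that P.eps_diff[OF P.single_mem[OF that] fg[OF that]] eg f by simp
  obtain h where h: "\<And>k b. b \<in> B k \<Longrightarrow> h k b \<in> FV (B (Suc k)) UNIV"
    "\<And>b. b \<in> B 0 \<Longrightarrow> \<psi> 0 b = vm (*) (h 0 b) (D 0)"
    "\<And>k b. b \<in> B (Suc k) \<Longrightarrow> \<psi> (Suc k) b = vm (*) (h (Suc k) b) (D (Suc k)) + vm (*) (D k b) (h k)"
    using P.null_homotopy[OF \<psi>_mem \<psi>_0 \<psi>_ch] by metis
  show ?thesis
    unfolding exact_at_def
  proof (intro ballI impI)
    fix z
    assume z: "z \<in> FV (B k) M" and cyc: "\<forall>j. k = Suc j \<longrightarrow> vm act z (D j) = 0"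
    have fz: "vm act z (f k) \<in> FV (B' k) M"
      using z f(1) by (intro N.vm_mem[of _ "B k"]) auto
    have "vm act (vm act z (f k)) (D' j) = 0" if k: "k = Suc j" for j
    proof -
      have "vm act (vm act z (f k)) (D' j) = vm act z (\<lambda>b. vm (*) (f k b) (D' j))"
        by (rule N.vm_assoc[OF z])
      also have "\<dots> = vm act z (\<lambda>b. vm (*) (D j b) (f j))"
        by (rule N.vm_cong[OF z]) (simp add: k f(3))
      also have "\<dots> = vm act (vm act z (D j)) (f j)"
        by (rule N.vm_assoc[OF z, symmetric])
      finally show ?thesis using cyc k by simp
    qed
    then obtain w where w: "w \<in> FV (B' (Suc k)) M" "vm act z (f k) = vm act w (D' k)"
      using ex fz unfolding exact_at_def by meson
    have wg: "vm act w (g (Suc k)) \<in> FV (B (Suc k)) M"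
      using w g(1) by (intro N.vm_mem[of _ "B' (Suc k)"]) auto
    have zh: "vm act z (h k) \<in> FV (B (Suc k)) M"
      using z h(1) by (intro N.vm_mem[of _ "B k"]) auto
    have "vm act z (\<lambda>b. vm (*) (f k b) (g k)) = vm act (vm act z (f k)) (g k)"
      by (rule N.vm_assoc[OF z, symmetric])
    also have "\<dots> = vm act w (\<lambda>b. vm (*) (D' k b) (g k))"
      by (simp add: w(2) N.vm_assoc[OF w(1)])
    also have "\<dots> = vm act w (\<lambda>b. vm (*) (g (Suc k) b) (D k))"
      by (rule N.vm_cong[OF w(1)]) (simp add: g(3))
    also have "\<dots> = vm act (vm act w (g (Suc k))) (D k)"
      by (rule N.vm_assoc[OF w(1), symmetric])
    finally have 1: "vm act z (\<lambda>b. vm (*) (f k b) (g k)) = vm act (vm act w (g (Suc k))) (D k)" .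
    \<comment> \<open>On a cycle z the part of the homotopy that passes through the lower degree
      drops out, so z\<psi> is a boundary.\<close>
    have 2: "vm act z (\<psi> k) = vm act (vm act z (h k)) (D k)"
    proof (cases k)
      case 0
      have "vm act z (\<psi> k) = vm act z (\<lambda>b. vm (*) (h k b) (D k))"
        by (rule N.vm_cong[OF z]) (simp add: 0 h(2))
      then show ?thesis by (simp add: N.vm_assoc[OF z])
    next
      case (Suc j)
      have "vm act z (\<psi> k) = vm act z (\<lambda>b. vm (*) (h k b) (D k) + vm (*) (D j b) (h j))"
        by (rule N.vm_cong[OF z]) (simp add: Suc h(3))
      also have "\<dots> = vm act (vm act z (h k)) (D k) + vm act (vm act z (D j)) (h j)"
        by (simp add: N.vm_mat_add[OF z] N.vm_assoc[OF z])
      finally show ?thesis using cyc Suc by simp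
    qed
    have "z = vm act z (\<lambda>b. single b 1)"
      by (simp add: N.vm_id[OF z])
    also have "\<dots> = vm act z (\<lambda>b. \<psi> k b + vm (*) (f k b) (g k))"
      by (simp add: \<psi>_def)
    also have "\<dots> = vm act (vm act z (h k)) (D k) + vm act (vm act w (g (Suc k))) (D k)"
      by (simp only: N.vm_mat_add[OF z] 1 2)
    also have "\<dots> = vm act (vm act z (h k) + vm act w (g (Suc k))) (D k)"
      by (simp add: N.vm_add[OF zh wg])
    finally show "\<exists>w\<in>FV (B (Suc k)) M. z = vm act w (D k)"
      using zh wg by (blast intro: N.FV_add)
  qed
qed

section \<open>Tensor products\<close>

context scalar_action
begin

lemma smult_zero_left: "m \<in> carrier M \<Longrightarrow> 0 \<odot> m = \<zero>"
  using smult_add_left[of m 0 0] smult_closed[of m 0] add.l_cancel_one'[of "0 \<odot> m" "0 \<odot> m"] by simp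

lemma smult_zero_right: "r \<odot> \<zero> = \<zero>"
  using smult_add_right[of \<zero> \<zero> r] smult_closed[of \<zero> r] add.l_cancel_one'[of "r \<odot> \<zero>" "r \<odot> \<zero>"] by simp

lemma smult_uminus_left:
  assumes "m \<in> carrier M"
  shows "(- r) \<odot> m = \<ominus> (r \<odot> m)"
proof -
  have "(- r) \<odot> m \<oplus> r \<odot> m = \<zero>"
    using smult_add_left[of m "- r" r] assms smult_zero_left by simp
  then show ?thesis
    using assms by (simp add: minus_equality smult_closed)
qed

end

locale tensor_pair = M: scalar_action M + N: scalar_action N
  for M :: "('r::ring_1, 'm, 'y) module_scheme" and N :: "('r, 'n, 'z) module_scheme"
begin

abbreviation "F \<equiv> free_Abelian_group (carrier M \<times> carrier N)"
abbreviation "rel \<equiv> tensor_relations M N"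

lemma rel_subgroup: "subgroup rel F"
  unfolding tensor_relations_def
proof (rule group.generate_is_subgroup)
  have s1: "frag_of x - frag_of y \<in> carrier F"
    if "x \<in> carrier M \<times> carrier N" "y \<in> carrier M \<times> carrier N" for x y
    using that keys_diff[of "frag_of x" "frag_of y"] by (auto simp: keys_frag_of)
  have s2: "frag_of x - frag_of y - frag_of z \<in> carrier F"
    if "x \<in> carrier M \<times> carrier N" "y \<in> carrier M \<times> carrier N" "z \<in> carrier M \<times> carrier N" for x y z
    using that s1[of x y] keys_diff[of "frag_of x - frag_of y" "frag_of z"] by (auto simp: keys_frag_of)
  show "{frag_of (m \<oplus>\<^bsub>M\<^esub> m', n) - frag_of (m, n) - frag_of (m', n) | m m' n.
        m \<in> carrier M \<and> m' \<in> carrier M \<and> n \<in> carrier N} \<union>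
     {frag_of (m, n \<oplus>\<^bsub>N\<^esub> n') - frag_of (m, n) - frag_of (m, n') | m n n'.
        m \<in> carrier M \<and> n \<in> carrier N \<and> n' \<in> carrier N} \<union>
     {frag_of (r \<odot>\<^bsub>M\<^esub> m, n) - frag_of (m, r \<odot>\<^bsub>N\<^esub> n) | r m n.
        m \<in> carrier M \<and> n \<in> carrier N} \<subseteq> carrier F"
    by (intro subsetI; elim UnE CollectE exE conjE; hypsubst; intro s1 s2)
      (auto simp: M.smult_closed N.smult_closed)
qed simp

lemma rel_carrier: "z \<in> rel \<Longrightarrow> keys z \<subseteq> carrier M \<times> carrier N"
  using subgroup.mem_carrier[OF rel_subgroup, of z] by (simp only: carrier_free_Abelian_group_iff)

lemma rel_zero: "0 \<in> rel"
  using subgroup.one_closed[OF rel_subgroup] by simp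

lemma rel_add: "z \<in> rel \<Longrightarrow> w \<in> rel \<Longrightarrow> z + w \<in> rel"
  using subgroup.m_closed[OF rel_subgroup] by simp

lemma rel_uminus: "z \<in> rel \<Longrightarrow> - z \<in> rel"
  using subgroup.m_inv_closed[OF rel_subgroup, of z] rel_carrier[of z] by simp

lemma rel_diff: "z \<in> rel \<Longrightarrow> w \<in> rel \<Longrightarrow> z - w \<in> rel"
  using rel_add[of z "- w"] rel_uminus[of w] by simp

lemma rel_sum: "(\<And>i. i \<in> I \<Longrightarrow> f i \<in> rel) \<Longrightarrow> sum f I \<in> rel"
  by (induction I rule: infinite_finite_induct) (auto simp: rel_zero rel_add)

lemma rel_left: "m \<in> carrier M \<Longrightarrow> m' \<in> carrier M \<Longrightarrow> n \<in> carrier N \<Longrightarrow>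
    frag_of (m \<oplus>\<^bsub>M\<^esub> m', n) - frag_of (m, n) - frag_of (m', n) \<in> rel"
  unfolding tensor_relations_def by (rule generate.incl) blast

lemma rel_right: "m \<in> carrier M \<Longrightarrow> n \<in> carrier N \<Longrightarrow> n' \<in> carrier N \<Longrightarrow>
    frag_of (m, n \<oplus>\<^bsub>N\<^esub> n') - frag_of (m, n) - frag_of (m, n') \<in> rel"
  unfolding tensor_relations_def by (rule generate.incl) blast

lemma rel_balanced: "m \<in> carrier M \<Longrightarrow> n \<in> carrier N \<Longrightarrow>
    frag_of (r \<odot>\<^bsub>M\<^esub> m, n) - frag_of (m, r \<odot>\<^bsub>N\<^esub> n) \<in> rel"
  unfolding tensor_relations_def by (rule generate.incl) blast

lemma rel_zero_left: "n \<in> carrier N \<Longrightarrow> frag_of (\<zero>\<^bsub>M\<^esub>, n) \<in> rel"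
  using rel_uminus[OF rel_left[of "\<zero>\<^bsub>M\<^esub>" "\<zero>\<^bsub>M\<^esub>" n]] by simp

lemma rel_zero_right: "m \<in> carrier M \<Longrightarrow> frag_of (m, \<zero>\<^bsub>N\<^esub>) \<in> rel"
  using rel_uminus[OF rel_right[of m "\<zero>\<^bsub>N\<^esub>" "\<zero>\<^bsub>N\<^esub>"]] by simp

text \<open>The universal property of the tensor product, phrased for a homomorphism on the free
  abelian group, since maps out of that group are what its own universal property supplies.\<close>

lemma rel_kernel:
  assumes G: "comm_group G" and h: "h \<in> hom F G"
    and l: "\<And>m m' n. m \<in> carrier M \<Longrightarrow> m' \<in> carrier M \<Longrightarrow> n \<in> carrier N \<Longrightarrow>
      h (frag_of (m \<oplus>\<^bsub>M\<^esub> m', n)) = h (frag_of (m, n)) \<otimes>\<^bsub>G\<^esub> h (frag_of (m', n))"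
    and r: "\<And>m n n'. m \<in> carrier M \<Longrightarrow> n \<in> carrier N \<Longrightarrow> n' \<in> carrier N \<Longrightarrow>
      h (frag_of (m, n \<oplus>\<^bsub>N\<^esub> n')) = h (frag_of (m, n)) \<otimes>\<^bsub>G\<^esub> h (frag_of (m, n'))"
    and b: "\<And>r m n. m \<in> carrier M \<Longrightarrow> n \<in> carrier N \<Longrightarrow>
      h (frag_of (r \<odot>\<^bsub>M\<^esub> m, n)) = h (frag_of (m, r \<odot>\<^bsub>N\<^esub> n))"
    and z: "z \<in> rel"
  shows "h z = \<one>\<^bsub>G\<^esub>"
proof -
  interpret group_hom F G h
    by (intro group_hom.intro group_hom_axioms.intro group_free_Abelian_group comm_group.axioms(2)[OF G] h)
  have ker: "x - y \<in> kernel F G h" if "x \<in> carrier F" "y \<in> carrier F" "h x = h y" for x y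
  proof -
    have xy: "x - y \<in> carrier F"
      using that keys_diff[of x y] by (simp only: carrier_free_Abelian_group_iff) blast
    have "h (x - y) \<otimes>\<^bsub>G\<^esub> h y = h y"
      using hom_mult[OF xy that(2)] that(3) by simp
    then show ?thesis
      using xy that(2) by (simp only: kernel_def mem_Collect_eq) (metis H.l_cancel_one' H.r_cancel_one hom_closed)
  qed
  have ker1: "frag_of x - frag_of y \<in> kernel F G h"
    if "x \<in> carrier M \<times> carrier N" "y \<in> carrier M \<times> carrier N" "h (frag_of x) = h (frag_of y)" for x y
    using that by (intro ker) auto
  have ker2: "frag_of x - frag_of y - frag_of y' \<in> kernel F G h"
    if "x \<in> carrier M \<times> carrier N" "y \<in> carrier M \<times> carrier N" "y' \<in> carrier M \<times> carrier N"
      "h (frag_of x) = h (frag_of y) \<otimes>\<^bsub>G\<^esub> h (frag_of y')" for x y y'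
  proof -
    have "frag_of y + frag_of y' \<in> carrier F"
      using that Poly_Mapping.keys_add[of "frag_of y" "frag_of y'"]
      by (simp only: carrier_free_Abelian_group_iff keys_frag_of) blast
    moreover have "h (frag_of y + frag_of y') = h (frag_of y) \<otimes>\<^bsub>G\<^esub> h (frag_of y')"
      using hom_mult[of "frag_of y" "frag_of y'"] that by simp
    ultimately have "frag_of x - (frag_of y + frag_of y') \<in> kernel F G h"
      using that by (intro ker) auto
    then show ?thesis by (simp only: diff_diff_add)
  qed
  have "rel \<subseteq> kernel F G h"
    unfolding tensor_relations_def
    by (rule G.generate_subgroup_incl[OF _ subgroup_kernel], intro subsetI, elim UnE CollectE exE conjE; hypsubst)
      (auto intro!: ker1 ker2 simp: l r b M.smult_closed N.smult_closed)
  then show ?thesis using z by (auto simp: kernel_def)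
qed

lemma coset_eq: "rel #>\<^bsub>F\<^esub> z = (\<lambda>r. r + z) ` rel"
  by (auto simp: r_coset_def)

text \<open>Elements of a tensor product are handled through representatives from here on; equality
  becomes membership of a difference in the relations.\<close>

lemma coset_eq_iff: "rel #>\<^bsub>F\<^esub> z = rel #>\<^bsub>F\<^esub> w \<longleftrightarrow> z - w \<in> rel"
proof
  assume "rel #>\<^bsub>F\<^esub> z = rel #>\<^bsub>F\<^esub> w"
  moreover have "z \<in> rel #>\<^bsub>F\<^esub> z"
    unfolding coset_eq using rel_zero by force
  ultimately obtain r where "r \<in> rel" "z = r + w"
    unfolding coset_eq by auto
  then show "z - w \<in> rel" by simp
next
  have *: "rel #>\<^bsub>F\<^esub> z \<subseteq> rel #>\<^bsub>F\<^esub> w" if zw: "z - w \<in> rel" for z w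
  proof -
    have "r + z = (r + (z - w)) + w" for r by simp
    then show ?thesis
      unfolding coset_eq using zw rel_add by blast
  qed
  assume "z - w \<in> rel"
  with *[of z w] *[of w z] rel_uminus[of "z - w"] show "rel #>\<^bsub>F\<^esub> z = rel #>\<^bsub>F\<^esub> w"
    by simp
qed

lemma coset_zero: "rel #>\<^bsub>F\<^esub> 0 = rel"
  unfolding coset_eq by simp

lemma rel_normal: "rel \<lhd> F"
  by (rule comm_group.normal_iff_subgroup[THEN iffD2, OF abelian_free_Abelian_group rel_subgroup])

lemma tensor_group_comm_group: "comm_group (tensor_group M N)"
  unfolding tensor_group_def
  by (rule comm_group.abelian_FactGroup[OF abelian_free_Abelian_group rel_subgroup])

lemma tensor_group_group: "group (tensor_group M N)"
  using tensor_group_comm_group by (simp add: comm_group_def)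

lemma tensor_carrier: "carrier (tensor_group M N) = {rel #>\<^bsub>F\<^esub> z | z. z \<in> carrier F}"
  by (auto simp: tensor_group_def FactGroup_def RCOSETS_def)

lemma tensor_one: "\<one>\<^bsub>tensor_group M N\<^esub> = rel"
  by (simp add: tensor_group_def FactGroup_def)

lemma tensor_mult:
  assumes "z \<in> carrier F" "w \<in> carrier F"
  shows "(rel #>\<^bsub>F\<^esub> z) \<otimes>\<^bsub>tensor_group M N\<^esub> (rel #>\<^bsub>F\<^esub> w) = rel #>\<^bsub>F\<^esub> (z + w)"
  using normal.rcos_sum[OF rel_normal assms] by (simp add: tensor_group_def FactGroup_def)

end

lemma module_hom_add:
  "f \<in> module_hom M N \<Longrightarrow> m \<in> carrier M \<Longrightarrow> n \<in> carrier M \<Longrightarrow> f (m \<oplus>\<^bsub>M\<^esub> n) = f m \<oplus>\<^bsub>N\<^esub> f n"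
  by (auto simp: module_hom_def hom_def)

lemma module_hom_closed: "f \<in> module_hom M N \<Longrightarrow> m \<in> carrier M \<Longrightarrow> f m \<in> carrier N"
  by (auto simp: module_hom_def hom_def)

lemma module_hom_smult: "f \<in> module_hom M N \<Longrightarrow> m \<in> carrier M \<Longrightarrow> f (r \<odot>\<^bsub>M\<^esub> m) = r \<odot>\<^bsub>N\<^esub> f m"
  by (auto simp: module_hom_def)

lemma id_module_hom: "scalar_action M \<Longrightarrow> id \<in> module_hom M M"
  by (auto simp: module_hom_def hom_def)

locale tensor_maps = T: tensor_pair M N + T': tensor_pair M' N'
  for M :: "('r::ring_1, 'm, 'y) module_scheme" and N :: "('r, 'n, 'z) module_scheme"
    and M' :: "('r, 'm', 'y') module_scheme" and N' :: "('r, 'n', 'z') module_scheme" +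
  fixes f g
  assumes f: "f \<in> module_hom M M'" and g: "g \<in> module_hom N N'"
begin

abbreviation "fg \<equiv> frag_extend (\<lambda>(m, n). frag_of (f m, g n))"

lemma fg_carrier:
  assumes "z \<in> carrier T.F"
  shows "fg z \<in> carrier T'.F"
proof -
  have "keys (case x of (m, n) \<Rightarrow> frag_of (f m, g n)) \<subseteq> carrier M' \<times> carrier N'"
    if "x \<in> keys z" for x
    using that assms module_hom_closed[OF f] module_hom_closed[OF g]
    by (cases x) (auto simp: keys_frag_of)
  then show ?thesis
    using keys_frag_extend[of "\<lambda>(m, n). frag_of (f m, g n)" z]
    by (simp only: carrier_free_Abelian_group_iff) blast
qed

lemma fg_rel: "z \<in> T.rel \<Longrightarrow> fg z \<in> T'.rel"
proof -
  assume z: "z \<in> T.rel"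
  show ?thesis
    using z unfolding tensor_relations_def[of M N]
  proof (induction rule: generate.induct)
    case one
    then show ?case by (simp add: T'.rel_zero)
  next
    case (incl w)
    then show ?case
      using T'.rel_left T'.rel_right T'.rel_balanced
      by (auto simp: frag_extend_diff module_hom_add[OF f] module_hom_add[OF g] module_hom_smult[OF f]
          module_hom_smult[OF g] module_hom_closed[OF f] module_hom_closed[OF g])
  next
    \<comment> \<open>Inverses in the free abelian group are negatives, which \<open>fg\<close>
      respects; the generator itself is treated as in the case \<open>incl\<close>.\<close>
    case (inv w)
    then have "w \<in> T.rel" unfolding tensor_relations_def by (rule generate.incl)
    then have "fg (- w) = - fg w" "inv\<^bsub>T.F\<^esub> w = - w"
      using T.rel_carrier by (auto simp: frag_extend_minus)
    moreover have "fg w \<in> T'.rel"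
      using inv T'.rel_left T'.rel_right T'.rel_balanced
      by (auto simp: frag_extend_diff module_hom_add[OF f] module_hom_add[OF g] module_hom_smult[OF f]
          module_hom_smult[OF g] module_hom_closed[OF f] module_hom_closed[OF g])
    ultimately show ?case by (simp add: T'.rel_uminus)
  next
    case (eng v w)
    then show ?case by (simp add: frag_extend_add T'.rel_add)
  qed
qed

text \<open>The union in \<open>tensor_map\<close> runs over equal cosets, because images of
  relations are relations; this is well-definedness.\<close>

lemma tensor_map_coset:
  "tensor_map M' N' f g (T.rel #>\<^bsub>T.F\<^esub> z) = T'.rel #>\<^bsub>T'.F\<^esub> fg z"
proof -
  have "T'.rel #>\<^bsub>T'.F\<^esub> fg (r + z) = T'.rel #>\<^bsub>T'.F\<^esub> fg z" if "r \<in> T.rel" for r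
    using that by (simp add: T'.coset_eq_iff frag_extend_add fg_rel)
  then show ?thesis
    unfolding tensor_map_def T.coset_eq using T.rel_zero by auto
qed

lemma tensor_map_hom: "tensor_map M' N' f g \<in> hom (tensor_group M N) (tensor_group M' N')"
proof (rule homI)
  fix x assume "x \<in> carrier (tensor_group M N)"
  then show "tensor_map M' N' f g x \<in> carrier (tensor_group M' N')"
    unfolding T.tensor_carrier T'.tensor_carrier using fg_carrier tensor_map_coset by blast
next
  fix x y assume "x \<in> carrier (tensor_group M N)" "y \<in> carrier (tensor_group M N)"
  then obtain z w where zw: "x = T.rel #>\<^bsub>T.F\<^esub> z" "y = T.rel #>\<^bsub>T.F\<^esub> w" "z \<in> carrier T.F" "w \<in> carrier T.F"
    unfolding T.tensor_carrier by blast
  show "tensor_map M' N' f g (x \<otimes>\<^bsub>tensor_group M N\<^esub> y) =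
    tensor_map M' N' f g x \<otimes>\<^bsub>tensor_group M' N'\<^esub> tensor_map M' N' f g y"
    unfolding zw T.tensor_mult[OF zw(3,4)] tensor_map_coset T'.tensor_mult[OF fg_carrier[OF zw(3)] fg_carrier[OF zw(4)]]
    by (simp add: frag_extend_add)
qed

end

section \<open>Tor computed from matrices\<close>

definition lcomb :: "('r::ring_1, 'm, 'z) module_scheme \<Rightarrow> ('b \<Rightarrow> 'm) \<Rightarrow> ('b \<Rightarrow>\<^sub>0 'r) \<Rightarrow> 'm" where
  "lcomb V \<eta> x = (\<Oplus>\<^bsub>V\<^esub>b\<in>keys x. lookup x b \<odot>\<^bsub>V\<^esub> \<eta> b)"

context scalar_action
begin

lemma lcomb_superset:
  assumes "finite A" "keys x \<subseteq> A" "\<And>b. b \<in> A \<Longrightarrow> \<eta> b \<in> carrier M"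
  shows "lcomb M \<eta> x = (\<Oplus>b\<in>A. lookup x b \<odot> \<eta> b)"
  unfolding lcomb_def
  by (rule add.finprod_mono_neutral_cong_left)
    (use assms in \<open>auto simp: in_keys_iff smult_zero_left smult_closed\<close>)

lemma lcomb_closed:
  "x \<in> FV B UNIV \<Longrightarrow> (\<And>b. b \<in> B \<Longrightarrow> \<eta> b \<in> carrier M) \<Longrightarrow> lcomb M \<eta> x \<in> carrier M"
  unfolding lcomb_def by (rule finsum_closed) (auto simp: FV_def smult_closed)

lemma lcomb_add:
  assumes x: "x \<in> FV B UNIV" and y: "y \<in> FV B UNIV" and \<eta>: "\<And>b. b \<in> B \<Longrightarrow> \<eta> b \<in> carrier M"
  shows "lcomb M \<eta> (x + y) = lcomb M \<eta> x \<oplus> lcomb M \<eta> y"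
proof -
  let ?A = "keys x \<union> keys y"
  have \<eta>A: "\<eta> b \<in> carrier M" if "b \<in> ?A" for b
    using that x y \<eta> by (auto simp: FV_def)
  have *: "lcomb M \<eta> z = (\<Oplus>b\<in>?A. lookup z b \<odot> \<eta> b)" if "keys z \<subseteq> ?A" for z
    by (rule lcomb_superset) (use that \<eta>A in auto)
  have "lcomb M \<eta> (x + y) =
      (\<Oplus>b\<in>?A. lookup x b \<odot> \<eta> b \<oplus> lookup y b \<odot> \<eta> b)"
    unfolding *[OF Poly_Mapping.keys_add]
    by (rule finsum_cong') (use \<eta>A in \<open>auto simp: lookup_add smult_add_left smult_closed\<close>)
  also have "\<dots> = lcomb M \<eta> x \<oplus> lcomb M \<eta> y"
    using *[of x] *[of y] \<eta>A by (simp add: finsum_addf Pi_iff smult_closed)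
  finally show ?thesis .
qed

lemma lcomb_zero [simp]: "lcomb M \<eta> 0 = \<zero>"
  by (simp add: lcomb_def)

lemma lcomb_single: "\<eta> b \<in> carrier M \<Longrightarrow> lcomb M \<eta> (single b r) = r \<odot> \<eta> b"
  by (subst lcomb_superset[of "{b}"]) (auto simp: smult_closed)

end

lemma (in left_module) lcomb_rscale:
  assumes x: "x \<in> FV B UNIV" and \<eta>: "\<And>b. b \<in> B \<Longrightarrow> \<eta> b \<in> carrier M"
  shows "lcomb M \<eta> (rscale (*) r x) = r \<odot> lcomb M \<eta> x"
  using x
proof (induction rule: reg.FV_induct)
  case zero
  then show ?case by (simp add: reg.rscale_zero_right smult_zero_right)
next
  case (single b s)
  then show ?case using \<eta> by (simp add: reg.rscale_single lcomb_single smult_assoc)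
next
  case (add x y)
  have "rscale (*) r x \<in> FV B UNIV" "rscale (*) r y \<in> FV B UNIV"
    using add by (auto intro: reg.rscale_mem)
  then show ?case
    using add lcomb_closed[OF add(1) \<eta>] lcomb_closed[OF add(2) \<eta>]
    by (simp add: reg.rscale_add_right lcomb_add[OF _ _ \<eta>] smult_add_right)
qed

text \<open>Unique existence of coefficients, given for each element separately, is turned into one
  coordinate map; from then on a free module is a set of vectors.\<close>

lemma free_module_coords:
  fixes P :: "('r::ring_1, 'p) module"
  assumes "free_module P"
  obtains B cf where "B \<subseteq> carrier P" "\<And>p. p \<in> carrier P \<Longrightarrow> cf p \<in> FV B UNIV"
    "\<And>p. p \<in> carrier P \<Longrightarrow> lcomb P (\<lambda>b. b) (cf p) = p"
    "\<And>x. x \<in> FV B UNIV \<Longrightarrow> cf (lcomb P (\<lambda>b. b) x) = x"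
proof -
  from assms interpret P: left_module P by (simp add: free_module_def)
  from assms obtain B where B: "B \<subseteq> carrier P"
    and ex1: "\<And>m. m \<in> carrier P \<Longrightarrow> \<exists>!c :: 'p \<Rightarrow> 'r. finite {b. c b \<noteq> 0} \<and> {b. c b \<noteq> 0} \<subseteq> B \<and>
      m = (\<Oplus>\<^bsub>P\<^esub>b\<in>{b. c b \<noteq> 0}. c b \<odot>\<^bsub>P\<^esub> b)"
    unfolding free_module_def by meson
  have keys: "keys x = {b. lookup x b \<noteq> 0}" for x :: "'p \<Rightarrow>\<^sub>0 'r"
    by (auto simp: in_keys_iff)
  have ex: "\<exists>x. x \<in> FV B UNIV \<and> lcomb P (\<lambda>b. b) x = m" if m: "m \<in> carrier P" for m
  proof -
    from ex1[OF m] obtain c :: "'p \<Rightarrow> 'r" where c: "finite {b. c b \<noteq> 0}" "{b. c b \<noteq> 0} \<subseteq> B"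
      "m = (\<Oplus>\<^bsub>P\<^esub>b\<in>{b. c b \<noteq> 0}. c b \<odot>\<^bsub>P\<^esub> b)" by blast
    then show ?thesis
      unfolding FV_R_iff lcomb_def keys by (intro exI[of _ "Abs_poly_mapping c"]) simp
  qed
  have un: "x = y" if "x \<in> FV B UNIV" "y \<in> FV B UNIV" "lcomb P (\<lambda>b. b) x = lcomb P (\<lambda>b. b) y" for x y
  proof -
    have "lcomb P (\<lambda>b. b) x \<in> carrier P"
      using that(1) B by (intro P.lcomb_closed[where B = B]) auto
    from ex1[OF this] have "c = c'"
      if "finite {b. c b \<noteq> 0} \<and> {b. c b \<noteq> 0} \<subseteq> B \<and> lcomb P (\<lambda>b. b) x = (\<Oplus>\<^bsub>P\<^esub>b\<in>{b. c b \<noteq> 0}. c b \<odot>\<^bsub>P\<^esub> b)"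
        "finite {b. c' b \<noteq> 0} \<and> {b. c' b \<noteq> 0} \<subseteq> B \<and> lcomb P (\<lambda>b. b) x = (\<Oplus>\<^bsub>P\<^esub>b\<in>{b. c' b \<noteq> 0}. c' b \<odot>\<^bsub>P\<^esub> b)"
      for c c' using that by blast
    from this[of "lookup x" "lookup y"]
    have "lookup x = lookup y"
      using that[unfolded FV_R_iff keys] by (simp add: lcomb_def keys)
    then show ?thesis by (simp only: poly_mapping_eq_iff)
  qed
  have "\<exists>cf. \<forall>m\<in>carrier P. cf m \<in> FV B UNIV \<and> lcomb P (\<lambda>b. b) (cf m) = m"
    by (rule bchoice) (use ex in blast)
  then obtain cf where cf: "\<And>m. m \<in> carrier P \<Longrightarrow> cf m \<in> FV B UNIV \<and> lcomb P (\<lambda>b. b) (cf m) = m"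
    by blast
  show ?thesis
  proof (rule that[OF B, of cf])
    fix x assume x: "x \<in> FV B (UNIV :: 'r set)"
    have "lcomb P (\<lambda>b. b) x \<in> carrier P"
      using x B by (intro P.lcomb_closed[where B = B]) auto
    from cf[OF this] show "cf (lcomb P (\<lambda>b. b) x) = x"
      by (intro un[OF _ x]) simp_all
  qed (use cf in blast)+
qed

text \<open>The universal property of free abelian groups speaks about monoid records, while vectors
  form a type of class \<open>ab_group_add\<close>; this record mediates.\<close>

definition additive_monoid :: "'a::ab_group_add monoid" where
  "additive_monoid = \<lparr>carrier = UNIV, monoid.mult = (+), one = 0\<rparr>"

lemma additive_monoid_comm_group: "comm_group (additive_monoid :: 'a::ab_group_add monoid)"
proof (rule comm_groupI)
  fix x :: 'a
  show "\<exists>y\<in>carrier additive_monoid. y \<otimes>\<^bsub>additive_monoid\<^esub> x = \<one>\<^bsub>additive_monoid\<^esub>"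
    by (rule bexI[of _ "- x"]) (auto simp: additive_monoid_def)
qed (auto simp: additive_monoid_def algebra_simps)

text \<open>Vectors with entries in a module need a type of class \<open>ab_group_add\<close>, while the modules at hand
  are records; hence the transport along an additive injection \<open>\<phi>\<close> into such a type.\<close>

locale embedded_right_module = right_module N for N :: "('r::ring_1, 'n) module" (structure) +
  fixes \<phi> :: "'n \<Rightarrow> 'm::ab_group_add"
  assumes phi_add: "n \<in> carrier N \<Longrightarrow> n' \<in> carrier N \<Longrightarrow> \<phi> (n \<oplus> n') = \<phi> n + \<phi> n'"
    and phi_inj: "inj_on \<phi> (carrier N)"
begin

definition "img = \<phi> ` carrier N"
definition "iact m r = \<phi> (r \<odot> inv_into (carrier N) \<phi> m)"

lemma phi_inv [simp]: "n \<in> carrier N \<Longrightarrow> inv_into (carrier N) \<phi> (\<phi> n) = n"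
  by (rule inv_into_f_f[OF phi_inj])

lemma iact_phi: "n \<in> carrier N \<Longrightarrow> iact (\<phi> n) r = \<phi> (r \<odot> n)"
  by (simp add: iact_def)

lemma phi_zero: "\<phi> \<zero> = 0"
  using phi_add[of \<zero> \<zero>] by simp

lemma phi_minus: "n \<in> carrier N \<Longrightarrow> \<phi> (\<ominus> n) = - \<phi> n"
  using phi_add[of n "\<ominus> n"] phi_zero by (simp add: r_neg eq_neg_iff_add_eq_0 add.commute)

lemma right_action_img: "right_action img iact"
proof
  show "0 \<in> img"
    unfolding img_def using phi_zero by (metis imageI zero_closed)
  show "m + n \<in> img" if "m \<in> img" "n \<in> img" for m n
    using that unfolding img_def by (auto simp flip: phi_add)
  show "- m \<in> img" if "m \<in> img" for m
    using that unfolding img_def by (auto simp flip: phi_minus)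
  show "iact m r \<in> img" if "m \<in> img" for m r
    using that by (auto simp: img_def iact_phi smult_closed)
  show "iact (m + n) r = iact m r + iact n r" if "m \<in> img" "n \<in> img" for m n r
    using that by (auto simp: img_def iact_phi smult_closed smult_add_right simp flip: phi_add)
  show "iact m (r + s) = iact m r + iact m s" if "m \<in> img" for m r s
    using that by (auto simp: img_def iact_phi smult_closed smult_add_left simp flip: phi_add)
  show "iact m (r * s) = iact (iact m r) s" if "m \<in> img" for m r s
    using that by (auto simp: img_def iact_phi smult_closed smult_assoc)
  show "iact m 1 = m" if "m \<in> img" for m
    using that by (auto simp: img_def iact_phi smult_one)
qed

end

sublocale embedded_right_module \<subseteq> img: right_action img iact
  by (rule right_action_img)

section \<open>The tensor product with a free module in coordinates\<close>

locale tensor_free = N: embedded_right_module N \<phi> + P: left_module P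
  for N :: "('r::ring_1, 'n) module" and \<phi> :: "'n \<Rightarrow> 'm::ab_group_add" and P :: "('r, 'p) module" +
  fixes B and cf :: "'p \<Rightarrow> 'p \<Rightarrow>\<^sub>0 'r"
  assumes B: "B \<subseteq> carrier P"
    and cf_closed: "p \<in> carrier P \<Longrightarrow> cf p \<in> FV B UNIV"
    and lcomb_cf: "p \<in> carrier P \<Longrightarrow> lcomb P (\<lambda>b. b) (cf p) = p"
    and cf_lcomb: "x \<in> FV B UNIV \<Longrightarrow> cf (lcomb P (\<lambda>b. b) x) = x"

sublocale tensor_free \<subseteq> T: tensor_pair N P ..

context tensor_free
begin

abbreviation "lc \<equiv> lcomb P (\<lambda>b. b)"

lemma BP: "b \<in> B \<Longrightarrow> b \<in> carrier P"
  using B by auto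

lemma lc_closed: "x \<in> FV B UNIV \<Longrightarrow> lc x \<in> carrier P"
  by (rule P.lcomb_closed[OF _ BP])

lemma cf_add: "p \<in> carrier P \<Longrightarrow> q \<in> carrier P \<Longrightarrow> cf (p \<oplus>\<^bsub>P\<^esub> q) = cf p + cf q"
  using cf_lcomb[of "cf p + cf q"] P.lcomb_add[OF cf_closed[of p] cf_closed[of q] BP]
  by (simp add: cf_closed lcomb_cf reg.FV_add)

lemma cf_smult: "p \<in> carrier P \<Longrightarrow> cf (r \<odot>\<^bsub>P\<^esub> p) = rscale (*) r (cf p)"
  using cf_lcomb[of "rscale (*) r (cf p)"] P.lcomb_rscale[OF cf_closed[of p] BP]
  by (simp add: cf_closed lcomb_cf reg.rscale_mem)

lemma cf_basis: "b \<in> B \<Longrightarrow> cf b = single b 1"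
  using cf_lcomb[of "single b 1"] P.lcomb_single[of "\<lambda>b. b" b 1] BP[of b]
  by (simp add: FV_single P.smult_one)

text \<open>For P free on \<open>B\<close>, the tensor product is the group of
  \<open>B\<close>-indexed vectors over N; this is the vector belonging to n \<otimes> p.\<close>

definition coord :: "'n \<times> 'p \<Rightarrow> 'p \<Rightarrow>\<^sub>0 'm" where
  "coord = (\<lambda>(n, p). rscale N.iact (\<phi> n) (cf p))"

lemma phi_mem: "n \<in> carrier N \<Longrightarrow> \<phi> n \<in> N.img"
  by (simp add: N.img_def)

lemma coord_mem: "n \<in> carrier N \<Longrightarrow> p \<in> carrier P \<Longrightarrow> coord (n, p) \<in> FV B N.img"
  by (simp add: coord_def N.img.rscale_mem phi_mem cf_closed)

lemma coordinate_map_exists: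
  "\<exists>h. (\<forall>z\<in>carrier T.F. \<forall>w\<in>carrier T.F. h (z + w) = h z + h w) \<and>
     (\<forall>n\<in>carrier N. \<forall>p\<in>carrier P. h (frag_of (n, p)) = coord (n, p))"
proof -
  obtain h where h: "h \<in> hom T.F additive_monoid"
    "\<And>x. x \<in> carrier N \<times> carrier P \<Longrightarrow> h (frag_of x) = coord x"
    by (rule comm_group.free_Abelian_group_universal[OF additive_monoid_comm_group, of coord "carrier N \<times> carrier P"])
      (auto simp: additive_monoid_def)
  then show ?thesis
    by (intro exI[of _ h]) (auto simp: hom_def additive_monoid_def)
qed

text \<open>The universal property yields only existence of the additive map, hence the choice; its
  values matter on the carrier of the free group alone.\<close>

definition "hc = (SOME h. (\<forall>z\<in>carrier T.F. \<forall>w\<in>carrier T.F. h (z + w) = h z + h w) \<and>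
     (\<forall>n\<in>carrier N. \<forall>p\<in>carrier P. h (frag_of (n, p)) = coord (n, p)))"

lemma hc_add: "z \<in> carrier T.F \<Longrightarrow> w \<in> carrier T.F \<Longrightarrow> hc (z + w) = hc z + hc w"
  and hc_frag: "n \<in> carrier N \<Longrightarrow> p \<in> carrier P \<Longrightarrow> hc (frag_of (n, p)) = coord (n, p)"
  using someI_ex[OF coordinate_map_exists] unfolding hc_def by blast+

lemma hc_zero: "hc 0 = 0"
  using hc_add[of 0 0] by simp

lemma hc_uminus: "z \<in> carrier T.F \<Longrightarrow> hc (- z) = - hc z"
  using hc_add[of z "- z"] by (simp add: hc_zero eq_neg_iff_add_eq_0 add.commute)

lemma hc_diff: "z \<in> carrier T.F \<Longrightarrow> w \<in> carrier T.F \<Longrightarrow> hc (z - w) = hc z - hc w"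
  using hc_add[of z "- w"] hc_uminus[of w] by simp

lemma hc_mem: 
  assumes "z \<in> carrier T.F" 
  shows "hc z \<in> FV B N.img"
proof -
  have "keys z \<subseteq> carrier N \<times> carrier P" using assms by simp
  then show ?thesis
  proof (induction z rule: free_Abelian_group_induct[consumes 1, case_names zero diff single])
    case zero
    then show ?case by (simp add: hc_zero FV_zero N.img.zero_mem)
  next
    case (diff x y)
    then show ?case by (simp add: hc_diff N.img.FV_diff)
  next
    case (single a)
    then show ?case by (cases a) (simp add: hc_frag coord_mem)
  qed
qed

lemma hc_rel:
  assumes z: "z \<in> T.rel"
  shows "hc z = 0"
proof -
  have "hc \<in> hom T.F additive_monoid"
    by (auto simp: hom_def hc_add additive_monoid_def)
  then have "hc z = \<one>\<^bsub>additive_monoid\<^esub>"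
  proof (rule T.rel_kernel[OF additive_monoid_comm_group _ _ _ _ z])
    fix n n' p assume "n \<in> carrier N" "n' \<in> carrier N" "p \<in> carrier P"
    then show "hc (frag_of (n \<oplus>\<^bsub>N\<^esub> n', p)) = hc (frag_of (n, p)) \<otimes>\<^bsub>additive_monoid\<^esub> hc (frag_of (n', p))"
      by (simp add: hc_frag coord_def N.phi_add N.img.rscale_add_left phi_mem additive_monoid_def)
  next
    fix n p p' assume "n \<in> carrier N" "p \<in> carrier P" "p' \<in> carrier P"
    then show "hc (frag_of (n, p \<oplus>\<^bsub>P\<^esub> p')) = hc (frag_of (n, p)) \<otimes>\<^bsub>additive_monoid\<^esub> hc (frag_of (n, p'))"
      by (simp add: hc_frag coord_def N.img.rscale_add_right phi_mem cf_add additive_monoid_def)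
  next
    fix r n p assume "n \<in> carrier N" "p \<in> carrier P"
    then show "hc (frag_of (r \<odot>\<^bsub>N\<^esub> n, p)) = hc (frag_of (n, r \<odot>\<^bsub>P\<^esub> p))"
      by (simp add: hc_frag coord_def phi_mem cf_smult N.smult_closed P.smult_closed
          N.img.rscale_rscale[symmetric] N.iact_phi)
  qed
  then show ?thesis by (simp add: additive_monoid_def)
qed

text \<open>A section of \<open>hc\<close> on the level of representatives. As
  \<open>frag_of\<close> is not additive in its argument, \<open>can\<close> is additive only modulo
  the relations, and the lemmas about it place differences in \<open>T.rel\<close>.\<close>

definition can :: "('p \<Rightarrow>\<^sub>0 'm) \<Rightarrow> ('n \<times> 'p \<Rightarrow>\<^sub>0 int)" where
  "can x = (\<Sum>b\<in>keys x. frag_of (inv_into (carrier N) \<phi> (lookup x b), b))"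

lemma inv_mem: "m \<in> N.img \<Longrightarrow> inv_into (carrier N) \<phi> m \<in> carrier N"
  by (auto simp: N.img_def)

lemma phi_inv_into: "m \<in> N.img \<Longrightarrow> \<phi> (inv_into (carrier N) \<phi> m) = m"
  by (auto simp: N.img_def)

text \<open>An index outside the support contributes 0 \<otimes> b, which is a relation.\<close>

lemma can_superset:
  assumes "finite A" "keys x \<subseteq> A" "A \<subseteq> B"
  shows "(\<Sum>b\<in>A. frag_of (inv_into (carrier N) \<phi> (lookup x b), b)) - can x \<in> T.rel"
proof -
  have "(\<Sum>b\<in>A. frag_of (inv_into (carrier N) \<phi> (lookup x b), b)) =
    can x + (\<Sum>b\<in>A - keys x. frag_of (inv_into (carrier N) \<phi> (lookup x b), b))"
    unfolding can_def using assms by (subst add.commute) (rule sum.subset_diff)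
  moreover have "(\<Sum>b\<in>A - keys x. frag_of (inv_into (carrier N) \<phi> (lookup x b), b)) \<in> T.rel"
  proof (rule T.rel_sum)
    fix b assume b: "b \<in> A - keys x"
    then have "lookup x b = \<phi> \<zero>\<^bsub>N\<^esub>"
      by (simp add: in_keys_iff N.phi_zero)
    then show "frag_of (inv_into (carrier N) \<phi> (lookup x b), b) \<in> T.rel"
      using b assms(3) BP by (auto intro!: T.rel_zero_left)
  qed
  ultimately show ?thesis by simp
qed

lemma can_add:
  assumes x: "x \<in> FV B N.img" and y: "y \<in> FV B N.img"
  shows "can (x + y) - can x - can y \<in> T.rel"
proof -
  let ?i = "inv_into (carrier N) \<phi>"
  let ?A = "keys x \<union> keys y"
  let ?s = "\<lambda>z. \<Sum>b\<in>?A. frag_of (?i (lookup z b), b)"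
  have A: "?A \<subseteq> B" using x y by (auto simp: FV_def)
  have s: "?s z - can z \<in> T.rel" if "z = x \<or> z = y \<or> z = x + y" for z
    by (rule can_superset) (use A that Poly_Mapping.keys_add[of x y] in auto)
  have "?s (x + y) - ?s x - ?s y = (\<Sum>b\<in>?A. frag_of (?i (lookup x b) \<oplus>\<^bsub>N\<^esub> ?i (lookup y b), b)
     - frag_of (?i (lookup x b), b) - frag_of (?i (lookup y b), b))"
  proof -
    have "?i (m + m') = ?i m \<oplus>\<^bsub>N\<^esub> ?i m'" if "m \<in> N.img" "m' \<in> N.img" for m m'
      using that by (auto simp: N.img_def simp flip: N.phi_add)
    then show ?thesis
      using FV_lookup[OF x] FV_lookup[OF y] by (simp add: lookup_add sum_subtractf)
  qed
  also have "\<dots> \<in> T.rel"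
    using A BP FV_lookup[OF x] FV_lookup[OF y] by (intro T.rel_sum T.rel_left inv_mem) auto
  finally have r: "?s (x + y) - ?s x - ?s y \<in> T.rel" .
  \<comment> \<open>Three comparisons of the sum over the common index set with the sums over the
    supports, combined so that everything but the claim cancels.\<close>
  have "?s (x + y) - ?s x - ?s y - (?s (x + y) - can (x + y)) + (?s x - can x) + (?s y - can y) \<in> T.rel"
    by (rule T.rel_add[OF T.rel_add[OF T.rel_diff[OF r]]]; rule s; simp)
  then show ?thesis by (simp add: algebra_simps)
qed

lemma can_zero: "can 0 = 0"
  by (simp add: can_def)

lemma can_single:
  assumes "m \<in> N.img" "b \<in> B"
  shows "frag_of (inv_into (carrier N) \<phi> m, b) - can (single b m) \<in> T.rel"
  using can_superset[of "{b}" "single b m"] assms by auto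

lemma can_diff:
  assumes x: "x \<in> FV B N.img" and y: "y \<in> FV B N.img"
  shows "can (x - y) - (can x - can y) \<in> T.rel"
  using T.rel_uminus[OF can_add[OF N.img.FV_diff[OF x y] y]] by (simp add: algebra_simps)

lemma can_carrier: "x \<in> FV B N.img \<Longrightarrow> can x \<in> carrier T.F"
  unfolding can_def
  by (rule sum_closed_free_Abelian_group) (auto simp: FV_def keys_frag_of intro!: inv_mem BP)

lemma hc_can:
  assumes x: "x \<in> FV B N.img"
  shows "hc (can x) = x"
proof -
  have "hc (sum f I) = (\<Sum>i\<in>I. hc (f i)) \<and> sum f I \<in> carrier T.F" 
    if "finite I" "\<And>i. i \<in> I \<Longrightarrow> f i \<in> carrier T.F"
    for I and f :: "'p \<Rightarrow> 'n \<times> 'p \<Rightarrow>\<^sub>0 int"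
    using that
    by (induction I rule: finite_induct) (simp_all add: hc_zero hc_add subset_trans[OF Poly_Mapping.keys_add])
  from this[of "keys x" "\<lambda>b. frag_of (inv_into (carrier N) \<phi> (lookup x b), b)"]
  have "hc (can x) = (\<Sum>b\<in>keys x. hc (frag_of (inv_into (carrier N) \<phi> (lookup x b), b)))"
    unfolding can_def using x by (auto simp: FV_def intro!: inv_mem BP)
  also have "\<dots> = (\<Sum>b\<in>keys x. single b (lookup x b))"
  proof (rule sum.cong[OF refl])
    fix b assume "b \<in> keys x"
    then have "b \<in> B" "lookup x b \<in> N.img" using x by (auto simp: FV_def)
    then show "hc (frag_of (inv_into (carrier N) \<phi> (lookup x b), b)) =
      single b (lookup x b)"
      by (simp add: hc_frag inv_mem BP coord_def phi_inv_into cf_basis N.img.rscale_single N.img.act_one)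
  qed
  finally show ?thesis using poly_mapping_sum_single[of x] by simp
qed

lemma can_hc:
  assumes "z \<in> carrier T.F"
  shows "z - can (hc z) \<in> T.rel"
proof -
  have "keys z \<subseteq> carrier N \<times> carrier P" using assms by simp
  then show ?thesis
  proof (induction z rule: free_Abelian_group_induct[consumes 1, case_names zero diff single])
    case zero
    then show ?case by (simp add: hc_zero can_zero T.rel_zero)
  next
    case (diff x y)
    have "can (hc x - hc y) - (can (hc x) - can (hc y)) \<in> T.rel"
      using diff by (intro can_diff hc_mem) auto
    with T.rel_diff[OF diff(3,4)]
    have "(x - can (hc x)) - (y - can (hc y)) - (can (hc x - hc y) - (can (hc x) - can (hc y))) \<in> T.rel"
      by (rule T.rel_diff)
    then show ?case using diff by (simp add: hc_diff algebra_simps)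
  next
    case (single a)
    then obtain n p where a: "a = (n, p)" and n: "n \<in> carrier N" and p: "p \<in> carrier P" by auto
    \<comment> \<open>For a pure tensor the second factor is expanded in the basis; balancedness
      moves the coefficients over to n.\<close>
    have "frag_of (n, lc y) - can (rscale N.iact (\<phi> n) y) \<in> T.rel" if "y \<in> FV B UNIV" for y
      using that
    proof (induction rule: reg.FV_induct)
      case zero
      then show ?case using n by (simp add: N.img.rscale_zero_right phi_mem can_zero T.rel_zero_right)
    next
      case (single b r)
      have "frag_of (r \<odot>\<^bsub>N\<^esub> n, b) - can (single b (\<phi> (r \<odot>\<^bsub>N\<^esub> n))) \<in> T.rel"
        using can_single[of "\<phi> (r \<odot>\<^bsub>N\<^esub> n)" b] single n by (simp add: phi_mem N.smult_closed)
      then have "frag_of (r \<odot>\<^bsub>N\<^esub> n, b) - can (single b (\<phi> (r \<odot>\<^bsub>N\<^esub> n))) -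
        (frag_of (r \<odot>\<^bsub>N\<^esub> n, b) - frag_of (n, r \<odot>\<^bsub>P\<^esub> b)) \<in> T.rel"
        by (rule T.rel_diff[OF _ T.rel_balanced[OF n BP[OF single(1)]]])
      then show ?case
        using n single BP by (simp add: P.lcomb_single N.img.rscale_single phi_mem N.iact_phi)
    next
      case (add x y)
      let ?c = "\<lambda>x. rscale N.iact (\<phi> n) x"
      have c: "?c x \<in> FV B N.img" "?c y \<in> FV B N.img"
        using add n by (auto intro!: N.img.rscale_mem phi_mem)
      have "frag_of (n, lc x \<oplus>\<^bsub>P\<^esub> lc y) - frag_of (n, lc x) - frag_of (n, lc y) \<in> T.rel"
        using n add lc_closed by (intro T.rel_right) auto
      from T.rel_diff[OF T.rel_add[OF T.rel_add[OF this add(3)] add(4)] can_add[OF c]]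
      have "(frag_of (n, lc x \<oplus>\<^bsub>P\<^esub> lc y) - frag_of (n, lc x) - frag_of (n, lc y)) +
         (frag_of (n, lc x) - can (?c x)) + (frag_of (n, lc y) - can (?c y)) - (can (?c x + ?c y) - can (?c x) - can (?c y)) \<in> T.rel" .
      then show ?case
        using add(1,2) n by (simp add: P.lcomb_add[OF _ _ BP] N.img.rscale_add_right phi_mem)
    qed
    from this[OF cf_closed[OF p]] show ?case
      using n p by (simp add: a hc_frag coord_def lcomb_cf)
  qed
qed

text \<open>With \<open>hc_can\<close> for surjectivity, this identifies the tensor product with the
  group of vectors.\<close>

lemma hc_eq_zero_iff: "z \<in> carrier T.F \<Longrightarrow> hc z = 0 \<longleftrightarrow> z \<in> T.rel"
  using hc_rel[of z] can_hc[of z] by (auto simp: can_zero)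

end

text \<open>Homology is a quotient of the cycles, which inherit the operation of the ambient group.
  The cosets are therefore cosets in G, and the one of x is H exactly for x in H.\<close>

lemma factor_group_trivial_iff:
  assumes "group G" "subgroup H G" "K \<subseteq> carrier G" "K \<noteq> {}"
  shows "carrier ((G\<lparr>carrier := K\<rparr>) Mod H) = {\<one>\<^bsub>(G\<lparr>carrier := K\<rparr>) Mod H\<^esub>} \<longleftrightarrow> K \<subseteq> H"
proof -
  interpret group G by (rule assms(1))
  have "carrier ((G\<lparr>carrier := K\<rparr>) Mod H) = (\<lambda>x. H #>\<^bsub>G\<^esub> x) ` K"
    by (auto simp: FactGroup_def RCOSETS_def r_coset_def)
  moreover have "\<one>\<^bsub>(G\<lparr>carrier := K\<rparr>) Mod H\<^esub> = H"
    by (simp add: FactGroup_def)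
  moreover have "H #>\<^bsub>G\<^esub> x = H \<longleftrightarrow> x \<in> H" if "x \<in> K" for x
    using that assms(3) coset_join1[of H x] coset_join2[of x H] assms(2) subgroup.subset by blast
  moreover have "(\<lambda>x. H #>\<^bsub>G\<^esub> x) ` K = {H} \<longleftrightarrow> (\<forall>x\<in>K. H #>\<^bsub>G\<^esub> x = H)"
    using assms(4) by blast
  ultimately show ?thesis
    by (simp add: subset_eq)
qed

section \<open>Homology of a tensored free resolution in coordinates\<close>

locale free_resolution_coords = V: left_module V
  for V :: "('r::ring_1, 'v) module" and P :: "nat \<Rightarrow> ('r, 'p) module" and d \<epsilon> +
  fixes B :: "nat \<Rightarrow> 'p set" and cf :: "nat \<Rightarrow> 'p \<Rightarrow> 'p \<Rightarrow>\<^sub>0 'r"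
  assumes res: "free_resolution V P d \<epsilon>"
    and B: "B k \<subseteq> carrier (P k)"
    and cf_closed: "p \<in> carrier (P k) \<Longrightarrow> cf k p \<in> FV (B k) UNIV"
    and lcomb_cf: "p \<in> carrier (P k) \<Longrightarrow> lcomb (P k) (\<lambda>b. b) (cf k p) = p"
    and cf_lcomb: "x \<in> FV (B k) UNIV \<Longrightarrow> cf k (lcomb (P k) (\<lambda>b. b) x) = x"
begin

abbreviation "lc k \<equiv> lcomb (P k) (\<lambda>b. b)"

definition "D k b = cf k (d k b)"

lemma P_left_module: "left_module (P k)"
  using res by (simp add: free_resolution_def free_module_def)

lemma d_hom: "d k \<in> module_hom (P (Suc k)) (P k)"
  using res by (simp add: free_resolution_def)

lemma eps_hom: "\<epsilon> \<in> module_hom (P 0) V"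
  using res by (simp add: free_resolution_def)

lemma lc_closed: "x \<in> FV (B k) UNIV \<Longrightarrow> lc k x \<in> carrier (P k)"
proof -
  interpret left_module "P k" by (rule P_left_module)
  show "x \<in> FV (B k) UNIV \<Longrightarrow> lc k x \<in> carrier (P k)"
    using B by (intro lcomb_closed[of _ "B k"]) auto
qed

lemma lc_add: "x \<in> FV (B k) UNIV \<Longrightarrow> y \<in> FV (B k) UNIV \<Longrightarrow> lc k (x + y) = lc k x \<oplus>\<^bsub>P k\<^esub> lc k y"
proof -
  interpret left_module "P k" by (rule P_left_module)
  show "x \<in> FV (B k) UNIV \<Longrightarrow> y \<in> FV (B k) UNIV \<Longrightarrow> lc k (x + y) = lc k x \<oplus>\<^bsub>P k\<^esub> lc k y"
    using B by (intro lcomb_add[of _ "B k"]) auto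
qed

lemma lc_rscale: "x \<in> FV (B k) UNIV \<Longrightarrow> lc k (rscale (*) r x) = r \<odot>\<^bsub>P k\<^esub> lc k x"
proof -
  interpret left_module "P k" by (rule P_left_module)
  show "x \<in> FV (B k) UNIV \<Longrightarrow> lc k (rscale (*) r x) = r \<odot>\<^bsub>P k\<^esub> lc k x"
    using B by (intro lcomb_rscale[of _ "B k"]) auto
qed

lemma lc_zero: "lc k 0 = \<zero>\<^bsub>P k\<^esub>"
proof -
  interpret left_module "P k" by (rule P_left_module)
  show ?thesis by simp
qed

lemma lc_single: "b \<in> B k \<Longrightarrow> lc k (single b r) = r \<odot>\<^bsub>P k\<^esub> b"
proof -
  interpret left_module "P k" by (rule P_left_module)
  show "b \<in> B k \<Longrightarrow> lc k (single b r) = r \<odot>\<^bsub>P k\<^esub> b"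
    using B by (intro lcomb_single) auto
qed

lemma cf_zero: "cf k \<zero>\<^bsub>P k\<^esub> = 0"
  using cf_lcomb[of 0 k] by (simp add: FV_zero lc_zero)

lemma D_closed: "b \<in> B (Suc k) \<Longrightarrow> D k b \<in> FV (B k) UNIV"
  unfolding D_def using B by (intro cf_closed module_hom_closed[OF d_hom]) auto

lemma D_mem: "x \<in> FV (B (Suc k)) UNIV \<Longrightarrow> vm (*) x (D k) \<in> FV (B k) UNIV"
  by (rule reg.vm_mem[where B = "B (Suc k)"]) (auto intro: D_closed)

lemma d_lc: "x \<in> FV (B (Suc k)) UNIV \<Longrightarrow> d k (lc (Suc k) x) = lc k (vm (*) x (D k))"
proof (induction rule: reg.FV_induct)
  case zero
  interpret P: left_module "P (Suc k)" by (rule P_left_module)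
  interpret Q: left_module "P k" by (rule P_left_module)
  have "d k \<zero>\<^bsub>P (Suc k)\<^esub> = d k (0 \<odot>\<^bsub>P (Suc k)\<^esub> \<zero>\<^bsub>P (Suc k)\<^esub>)"
    by (simp add: P.smult_zero_right)
  also have "\<dots> = \<zero>\<^bsub>P k\<^esub>"
    by (subst module_hom_smult[OF d_hom]) (auto simp: Q.smult_zero_left module_hom_closed[OF d_hom])
  finally show ?case by (simp add: lc_zero)
next
  case (single b r)
  have b: "b \<in> carrier (P (Suc k))" using single B by blast
  show ?case
    using single b D_closed[OF single(1)] lcomb_cf[OF module_hom_closed[OF d_hom b]]
    by (simp add: lc_single module_hom_smult[OF d_hom] reg.vm_single lc_rscale) (simp add: D_def)
next
  case (add x y)
  then show ?case
    by (simp add: lc_add module_hom_add[OF d_hom] lc_closed reg.vm_add[OF add(1,2)] D_mem)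
qed

lemma cf_d: "p \<in> carrier (P (Suc k)) \<Longrightarrow> cf k (d k p) = vm (*) (cf (Suc k) p) (D k)"
  using d_lc[OF cf_closed[of p "Suc k"]] cf_lcomb[OF D_mem[OF cf_closed[of p "Suc k"]]]
  by (simp add: lcomb_cf)

lemma image_d_iff:
  assumes "x \<in> FV (B k) UNIV"
  shows "lc k x \<in> d k ` carrier (P (Suc k)) \<longleftrightarrow> (\<exists>w\<in>FV (B (Suc k)) UNIV. x = vm (*) w (D k))"
proof
  assume "lc k x \<in> d k ` carrier (P (Suc k))"
  then obtain p where p: "p \<in> carrier (P (Suc k))" "lc k x = d k p" by blast
  then have "x = vm (*) (cf (Suc k) p) (D k)"
    using cf_lcomb[OF assms] cf_d[OF p(1)] by simp
  then show "\<exists>w\<in>FV (B (Suc k)) UNIV. x = vm (*) w (D k)"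
    using cf_closed[OF p(1)] by blast
next
  assume "\<exists>w\<in>FV (B (Suc k)) UNIV. x = vm (*) w (D k)"
  then obtain w where w: "w \<in> FV (B (Suc k)) UNIV" "x = vm (*) w (D k)" by blast
  then show "lc k x \<in> d k ` carrier (P (Suc k))"
    using d_lc[OF w(1)] lc_closed[OF w(1)] by (metis imageI)
qed

lemma based: "based_resolution V B D (\<lambda>x. \<epsilon> (lc 0 x))"
proof (intro based_resolution.intro based_resolution_axioms.intro)
  show "left_module V" by unfold_locales
  show "\<epsilon> (lc 0 x) \<in> carrier V" if "x \<in> FV (B 0) UNIV" for x
    using that by (intro module_hom_closed[OF eps_hom] lc_closed)
  show "\<epsilon> (lc 0 (x + y)) = \<epsilon> (lc 0 x) \<oplus>\<^bsub>V\<^esub> \<epsilon> (lc 0 y)"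
    if "x \<in> FV (B 0) UNIV" "y \<in> FV (B 0) UNIV" for x y
    using that by (simp add: lc_add module_hom_add[OF eps_hom] lc_closed)
  show "\<epsilon> (lc 0 (rscale (*) r x)) = r \<odot>\<^bsub>V\<^esub> \<epsilon> (lc 0 x)" if "x \<in> FV (B 0) UNIV" for x r
    using that by (simp add: lc_rscale module_hom_smult[OF eps_hom] lc_closed)
  show "\<exists>x\<in>FV (B 0) UNIV. \<epsilon> (lc 0 x) = v" if v: "v \<in> carrier V" for v
  proof -
    from v res have "v \<in> \<epsilon> ` carrier (P 0)" by (simp add: free_resolution_def)
    then obtain p where "p \<in> carrier (P 0)" "\<epsilon> p = v" by blast
    then show ?thesis
      using cf_closed[of p 0] lcomb_cf[of p 0] by (intro bexI[of _ "cf 0 p"]) simp_all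
  qed
  show "D k b \<in> FV (B k) UNIV" if "b \<in> B (Suc k)" for k b
    using that by (rule D_closed)
  show "rcycle V D (\<lambda>x. \<epsilon> (lc 0 x)) k x \<longleftrightarrow> (\<exists>w\<in>FV (B (Suc k)) UNIV. x = vm (*) w (D k))"
    if x: "x \<in> FV (B k) UNIV" for k x
  proof (cases k)
    case 0
    have "d 0 ` carrier (P (Suc 0)) = a_kernel (P 0) V \<epsilon>"
      using res by (simp add: free_resolution_def)
    then show ?thesis
      using image_d_iff[OF x] lc_closed[OF x] by (simp add: 0 a_kernel_def')
  next
    case (Suc j)
    have "d (Suc j) ` carrier (P (Suc (Suc j))) = a_kernel (P (Suc j)) (P j) (d j)"
      using res by (simp add: free_resolution_def)
    then have "(\<exists>w\<in>FV (B (Suc k)) UNIV. x = vm (*) w (D k)) \<longleftrightarrow> d j (lc k x) = \<zero>\<^bsub>P j\<^esub>"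
      using image_d_iff[OF x] lc_closed[OF x] by (simp add: Suc a_kernel_def')
    also have "\<dots> \<longleftrightarrow> lc j (vm (*) x (D j)) = \<zero>\<^bsub>P j\<^esub>"
      using d_lc[of x j] x by (simp add: Suc)
    also have "\<dots> \<longleftrightarrow> vm (*) x (D j) = 0"
      using cf_lcomb[OF D_mem[of x j]] x cf_zero[of j] lc_zero[of j] by (auto simp: Suc)
    finally show ?thesis by (simp add: Suc)
  qed
qed

text \<open>The identifications with vectors, one in each degree, turn id \<otimes> d into
  multiplication by the matrix \<open>D\<close>; cycles and boundaries are translated
  separately.\<close>

lemma tensor_homology_trivial_iff:
  fixes k :: nat
  assumes N: "embedded_right_module N \<phi>"
  shows "carrier (tensor_homology N P d k) = {\<one>\<^bsub>tensor_homology N P d k\<^esub>} \<longleftrightarrow>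
    exact_at (embedded_right_module.img N \<phi>) (embedded_right_module.iact N \<phi>) B D k"
proof -
  interpret N: embedded_right_module N \<phi> by (rule N)
  interpret TF: tensor_free N \<phi> "P i" "B i" "cf i" for i
    by (intro tensor_free.intro N P_left_module tensor_free_axioms.intro B cf_closed lcomb_cf cf_lcomb)
  interpret TM: tensor_maps N "P (Suc i)" N "P i" id "d i" for i
    by (intro tensor_maps.intro tensor_maps_axioms.intro TF.T.tensor_pair_axioms id_module_hom d_hom N.scalar_action_axioms)
  have hc_fg: "TF.hc k (TM.fg k z) = vm N.iact (TF.hc (Suc k) z) (D k)" if "z \<in> carrier (TF.T.F (Suc k))" for k z
  proof -
    have "keys z \<subseteq> carrier N \<times> carrier (P (Suc k))" using that by simp
    then show ?thesis
    proof (induction z rule: free_Abelian_group_induct[consumes 1, case_names zero diff single])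
      case zero
      then show ?case by (simp add: TF.hc_zero)
    next
      case (diff x y)
      then have xy: "x \<in> carrier (TF.T.F (Suc k))" "y \<in> carrier (TF.T.F (Suc k))" by simp_all
      show ?case
        using diff(3,4) TM.fg_carrier[OF xy(1)] TM.fg_carrier[OF xy(2)]
        by (simp only: frag_extend_diff TF.hc_diff[OF TM.fg_carrier[OF xy(1)] TM.fg_carrier[OF xy(2)]]
           TF.hc_diff[OF xy] N.img.vm_diff[OF TF.hc_mem[OF xy(1)] TF.hc_mem[OF xy(2)]])
    next
      case (single a)
      then obtain n p where a: "a = (n, p)" and np: "n \<in> carrier N" "p \<in> carrier (P (Suc k))" by auto
      then show ?case
        by (simp add: TF.hc_frag module_hom_closed[OF d_hom] TF.coord_def cf_d N.img.vm_rscale TF.phi_mem)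
    qed
  qed
  have boundary: "(TF.T.rel k #>\<^bsub>TF.T.F k\<^esub> z) \<in> tensor_boundaries N P d k \<longleftrightarrow>
     (\<exists>w\<in>FV (B (Suc k)) N.img. TF.hc k z = vm N.iact w (D k))" if z: "z \<in> carrier (TF.T.F k)" for z
  proof -
    have *: "(TF.T.rel k #>\<^bsub>TF.T.F k\<^esub> z) = tensor_map N (P k) id (d k) (TF.T.rel (Suc k) #>\<^bsub>TF.T.F (Suc k)\<^esub> w)
      \<longleftrightarrow> TF.hc k z = vm N.iact (TF.hc (Suc k) w) (D k)" if w: "w \<in> carrier (TF.T.F (Suc k))" for w
    proof -
      have "z - TM.fg k w \<in> carrier (TF.T.F k)"
        using z TM.fg_carrier[OF w] keys_diff[of z "TM.fg k w"]
        by (simp only: carrier_free_Abelian_group_iff) blast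
      from TF.hc_eq_zero_iff[OF this] show ?thesis
        unfolding TM.tensor_map_coset TF.T.coset_eq_iff
        by (simp only: TF.hc_diff[OF z TM.fg_carrier[OF w]] hc_fg[OF w]) simp
    qed
    have "(TF.T.rel k #>\<^bsub>TF.T.F k\<^esub> z) \<in> tensor_boundaries N P d k \<longleftrightarrow>
      (\<exists>w\<in>carrier (TF.T.F (Suc k)). TF.hc k z = vm N.iact (TF.hc (Suc k) w) (D k))"
      unfolding tensor_boundaries_def TF.T.tensor_carrier using * by blast
    also have "\<dots> \<longleftrightarrow> (\<exists>w\<in>FV (B (Suc k)) N.img. TF.hc k z = vm N.iact w (D k))"
      using TF.hc_mem TF.can_carrier TF.hc_can by metis
    finally show ?thesis .
  qed
  have cycle: "(TF.T.rel k #>\<^bsub>TF.T.F k\<^esub> z) \<in> tensor_cycles N P d k \<longleftrightarrow>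
     (\<forall>j. k = Suc j \<longrightarrow> vm N.iact (TF.hc k z) (D j) = 0)" if z: "z \<in> carrier (TF.T.F k)" for z
  proof (cases k)
    case 0
    then show ?thesis using z unfolding 0 tensor_cycles.simps TF.T.tensor_carrier by blast
  next
    case (Suc j)
    have z': "z \<in> carrier (TF.T.F (Suc j))" using z Suc by simp
    have "(TF.T.rel (Suc j) #>\<^bsub>TF.T.F (Suc j)\<^esub> z) \<in> carrier (tensor_group N (P (Suc j)))"
      unfolding TF.T.tensor_carrier using z' by blast
    moreover have "tensor_map N (P j) id (d j) (TF.T.rel (Suc j) #>\<^bsub>TF.T.F (Suc j)\<^esub> z) = TF.T.rel j
      \<longleftrightarrow> vm N.iact (TF.hc (Suc j) z) (D j) = 0"
      using TF.T.coset_eq_iff[of j "TM.fg j z" 0] TF.hc_eq_zero_iff[OF TM.fg_carrier[OF z']]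
      unfolding TM.tensor_map_coset TF.T.coset_zero hc_fg[OF z'] by simp
    ultimately show ?thesis
      unfolding Suc tensor_cycles.simps kernel_def TF.T.tensor_one by blast
  qed
  have sub: "subgroup (tensor_boundaries N P d k) (tensor_group N (P k))"
    unfolding tensor_boundaries_def
    by (rule group_hom.img_is_subgroup)
      (intro group_hom.intro group_hom_axioms.intro TF.T.tensor_group_group TM.tensor_map_hom)
  have cyc_sub: "tensor_cycles N P d k \<subseteq> carrier (tensor_group N (P k))"
    by (cases k) (auto simp: kernel_def)
  have "TF.T.rel k \<in> tensor_cycles N P d k"
    using cycle[of 0] by (simp add: TF.T.coset_zero TF.hc_zero)
  then have "carrier (tensor_homology N P d k) = {\<one>\<^bsub>tensor_homology N P d k\<^esub>} \<longleftrightarrow>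
      tensor_cycles N P d k \<subseteq> tensor_boundaries N P d k"
    unfolding tensor_homology_def
    by (intro factor_group_trivial_iff[OF TF.T.tensor_group_group sub cyc_sub]) blast
  also have "\<dots> \<longleftrightarrow> (\<forall>z\<in>carrier (TF.T.F k). (\<forall>j. k = Suc j \<longrightarrow> vm N.iact (TF.hc k z) (D j) = 0) \<longrightarrow>
     (\<exists>w\<in>FV (B (Suc k)) N.img. TF.hc k z = vm N.iact w (D k)))"
  proof -
    have "tensor_cycles N P d k \<subseteq> tensor_boundaries N P d k \<longleftrightarrow>
      (\<forall>z\<in>carrier (TF.T.F k). (TF.T.rel k #>\<^bsub>TF.T.F k\<^esub> z) \<in> tensor_cycles N P d k \<longrightarrow>
        (TF.T.rel k #>\<^bsub>TF.T.F k\<^esub> z) \<in> tensor_boundaries N P d k)"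
      using cyc_sub unfolding TF.T.tensor_carrier by blast
    then show ?thesis by (simp only: boundary cycle cong: ball_cong)
  qed
  \<comment> \<open>\<open>hc\<close> maps representatives onto all vectors, so quantifying over
    either is the same.\<close>
  also have "\<dots> \<longleftrightarrow> exact_at N.img N.iact B D k"
  proof -
    have "(\<forall>z\<in>carrier (TF.T.F k). Q (TF.hc k z)) \<longleftrightarrow> (\<forall>x\<in>FV (B k) N.img. Q x)" for Q
      using TF.hc_mem[of _ k] TF.can_carrier[of _ k] TF.hc_can[of _ k] by metis
    then show ?thesis
      unfolding exact_at_def .
  qed
  finally show ?thesis .
qed

end

text \<open>By \<open>ex\<close> the choice in \<open>chosen_resolution\<close> really picks a
  resolution; \<open>exact_at_transfer\<close> in both directions then replaces it by the given one,
  whose index type is arbitrary.\<close>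

theorem Tor_trivial_iff:
  fixes V :: "('r::ring_1, 'v) module"
  assumes ex: "\<exists>(P :: nat \<Rightarrow> ('r, ('v \<times> 'r) list) module) d \<epsilon>. free_resolution V P d \<epsilon>"
    and N: "embedded_right_module N \<phi>"
    and based: "based_resolution V B D \<epsilon>"
  shows "carrier (Tor k N V) = {\<one>\<^bsub>Tor k N V\<^esub>} \<longleftrightarrow>
    exact_at (embedded_right_module.img N \<phi>) (embedded_right_module.iact N \<phi>) B D k"
proof -
  interpret N: embedded_right_module N \<phi> by (rule N)
  have V: "left_module V" using based by (simp add: based_resolution_def)
  obtain P :: "nat \<Rightarrow> ('r, ('v \<times> 'r) list) module" and d where ch: "chosen_resolution V = (P, d)"
    by (cases "chosen_resolution V")
  have "\<exists>Pd. (\<lambda>(P :: nat \<Rightarrow> ('r, ('v \<times> 'r) list) module, d). \<exists>\<epsilon>. free_resolution V P d \<epsilon>) Pd"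
    using ex by auto
  from someI_ex[OF this] ch obtain \<epsilon>' where res: "free_resolution V P d \<epsilon>'"
    unfolding chosen_resolution_def by auto
  let ?Q = "\<lambda>k B cf. B \<subseteq> carrier (P k) \<and> (\<forall>p\<in>carrier (P k). cf p \<in> FV B UNIV) \<and>
    (\<forall>p\<in>carrier (P k). lcomb (P k) (\<lambda>b. b) (cf p) = p) \<and> (\<forall>x\<in>FV B UNIV. cf (lcomb (P k) (\<lambda>b. b) x) = x)"
  have "\<exists>Bc. ?Q k (fst Bc) (snd Bc)" for k
  proof -
    have "free_module (P k)" using res by (simp add: free_resolution_def)
    then obtain B cf where "?Q k B cf"
      by (rule free_module_coords) blast
    then show ?thesis by (intro exI[of _ "(B, cf)"]) simp
  qed
  then obtain Bc where Bc: "\<And>k. ?Q k (fst (Bc k)) (snd (Bc k))"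
    using choice[of "\<lambda>k Bc. ?Q k (fst Bc) (snd Bc)"] by blast
  let ?B = "\<lambda>k. fst (Bc k)" and ?cf = "\<lambda>k. snd (Bc k)"
  interpret FR: free_resolution_coords V P d \<epsilon>' ?B ?cf
    by (intro free_resolution_coords.intro V free_resolution_coords_axioms.intro res)
      (use Bc in blast)+
  have "carrier (Tor k N V) = {\<one>\<^bsub>Tor k N V\<^esub>} \<longleftrightarrow> exact_at N.img N.iact ?B FR.D k"
    using FR.tensor_homology_trivial_iff[OF N] by (simp add: Tor_def ch)
  also have "\<dots> \<longleftrightarrow> exact_at N.img N.iact B D k"
    using exact_at_transfer[OF N.right_action_img FR.based based]
      exact_at_transfer[OF N.right_action_img based FR.based] by blast
  finally show ?thesis .
qed

section \<open>Existence of free resolutions\<close>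

text \<open>A list of pairs is coded by a list: the tags \<open>0\<close> and \<open>1\<close> say whether the next entry
  continues the current first component or is the second component that ends the pair.\<close>

fun pair_code :: "('v \<times> 'r::ring_1) list \<Rightarrow> 'r \<Rightarrow> ('v \<times> 'r) list \<Rightarrow> ('v \<times> 'r) list" where
  "pair_code [] r zs = (undefined, 1) # (undefined, r) # zs"
| "pair_code (x # xs) r zs = (undefined, 0) # x # pair_code xs r zs"

fun list_code :: "(('v \<times> 'r::ring_1) list \<times> 'r) list \<Rightarrow> ('v \<times> 'r) list" where
  "list_code [] = []"
| "list_code ((xs, r) # ps) = pair_code xs r (list_code ps)"

lemma pair_code_inj: "pair_code xs r zs = pair_code xs' r' zs' \<Longrightarrow> xs = xs' \<and> r = r' \<and> zs = zs'"
proof (induction xs arbitrary: xs')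
  case Nil
  then show ?case by (cases xs') auto
next
  case (Cons x xs)
  then show ?case by (cases xs') auto
qed

lemma pair_code_not_Nil: "pair_code xs r zs \<noteq> []"
  by (cases xs) auto

lemma list_code_inj: "list_code ps = list_code qs \<Longrightarrow> ps = qs"
proof (induction ps arbitrary: qs)
  case Nil
  then show ?case by (cases qs) (auto simp: pair_code_not_Nil[symmetric])
next
  case (Cons p ps)
  obtain xs r where p: "p = (xs, r)" by (cases p)
  from Cons.prems p obtain ys s qs' where q: "qs = (ys, s) # qs'"
    by (cases qs) (auto simp: pair_code_not_Nil)
  show ?case
    using Cons pair_code_inj[of xs r "list_code ps" ys s "list_code qs'"] by (auto simp: p q)
qed

text \<open>Every finitely supported function is the sum of a list of its coefficients, so summation
  of lists is surjective; a right inverse of it followed by \<open>list_code\<close> is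
  injective.\<close>

lemma finitely_supported_code_exists:
  "\<exists>enc :: (('v \<times> 'r::ring_1) list \<Rightarrow>\<^sub>0 'r) \<Rightarrow> ('v \<times> 'r) list. inj enc"
proof -
  define S :: "(('v \<times> 'r) list \<times> 'r) list \<Rightarrow> ('v \<times> 'r) list \<Rightarrow>\<^sub>0 'r" where
    "S ps = (\<Sum>(b, r)\<leftarrow>ps. single b r)" for ps
  have "\<exists>ps. S ps = p" for p
  proof -
    obtain ks where ks: "distinct ks" "set ks = keys p"
      using finite_distinct_list[OF finite_keys[of p]] by blast
    have "S (map (\<lambda>b. (b, lookup p b)) ks) = (\<Sum>b\<in>set ks. single b (lookup p b))"
      unfolding S_def using ks(1) by (simp add: comp_def sum_list_distinct_conv_sum_set)
    then show ?thesis
      using ks(2) poly_mapping_sum_single[of p] by metis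
  qed
  then have "surj S" by (metis surjI)
  then have "inj (list_code \<circ> inv_into UNIV S)"
    by (intro inj_compose surj_imp_inj_inv injI list_code_inj)
  then show ?thesis by blast
qed

lemma (in abelian_group) finsum_transport:
  fixes g :: "'x::ab_group_add \<Rightarrow> 'a"
  assumes g: "\<And>x. g x \<in> carrier G" "\<And>x y. g (x + y) = g x \<oplus> g y" "g 0 = \<zero>" and A: "finite A"
  shows "(\<Oplus>a\<in>A. g (f a)) = g (\<Sum>a\<in>A. f a)"
  using A by (induction A rule: finite_induct) (auto simp: g)

text \<open>\<open>enc\<close> embeds the free module on the whole type \<open>'b\<close> into
  \<open>'b\<close> itself, so \<open>'b\<close> is at once the basis and the ambient set of every
  module of the resolution, and the type does not grow from one degree to the next.\<close>

locale coded_resolution = V: left_module V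
  for V :: "('r::ring_1, 'v) module" (structure) +
  fixes enc :: "('b \<Rightarrow>\<^sub>0 'r) \<Rightarrow> 'b" and \<eta> :: "'b \<Rightarrow> 'v"
  assumes enc_inj: "inj enc" and \<eta>_range: "range \<eta> = carrier V"
begin

definition "dec = inv_into UNIV enc"

lemma dec_enc [simp]: "dec (enc x) = x"
  by (simp add: dec_def enc_inj)

definition "\<epsilon> = lcomb V \<eta>"

lemma eta_closed [simp]: "\<eta> b \<in> carrier V"
  using \<eta>_range by blast

text \<open>Every vector is named by a basis element. The one naming a cycle is sent to this cycle,
  all others to 0, so that the image consists of cycles and contains them all.\<close>

fun D :: "nat \<Rightarrow> 'b \<Rightarrow> 'b \<Rightarrow>\<^sub>0 'r" where
  "D 0 b = (if \<epsilon> (dec b) = \<zero> then dec b else 0)"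
| "D (Suc k) b = (if vm (*) (dec b) (D k) = 0 then dec b else 0)"

lemma eps_closed: "\<epsilon> x \<in> carrier V"
  unfolding \<epsilon>_def by (rule V.lcomb_closed[where B = UNIV]) auto

lemma eps_add: "\<epsilon> (x + y) = \<epsilon> x \<oplus> \<epsilon> y"
  unfolding \<epsilon>_def by (rule V.lcomb_add[where B = UNIV]) auto

lemma eps_rscale: "\<epsilon> (rscale (*) r x) = r \<odot> \<epsilon> x"
  unfolding \<epsilon>_def by (rule V.lcomb_rscale[where B = UNIV]) auto

lemma eps_surj: "v \<in> carrier V \<Longrightarrow> \<exists>x. \<epsilon> x = v"
proof -
  assume v: "v \<in> carrier V"
  then have "v \<in> range \<eta>" by (simp only: \<eta>_range)
  then obtain b where "\<eta> b = v" by blast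
  then have "\<epsilon> (single b 1) = v"
    using v by (simp add: \<epsilon>_def V.lcomb_single V.smult_one)
  then show "\<exists>x. \<epsilon> x = v" by blast
qed

lemma D_cycle: "rcycle V D \<epsilon> k (D k b)"
  by (cases k) (auto simp: \<epsilon>_def)

lemma vm_D_cycle: "rcycle V D \<epsilon> k (vm (*) x (D k))"
proof (cases k)
  case 0
  have "x \<in> FV UNIV UNIV" by simp
  then have "\<epsilon> (vm (*) x (D 0)) = \<zero>"
  proof (induction rule: reg.FV_induct)
    case zero
    then show ?case by (simp add: \<epsilon>_def)
  next
    case (single b r)
    then show ?case using D_cycle[of 0 b] by (simp add: reg.vm_single eps_rscale V.smult_zero_right)
  next
    case (add x y)
    then show ?case by (simp add: reg.vm_add[where B = UNIV and B' = UNIV] eps_add)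
  qed
  then show ?thesis by (simp add: 0)
next
  case (Suc j)
  have "vm (*) (vm (*) x (D (Suc j))) (D j) = vm (*) x (\<lambda>b. vm (*) (D (Suc j) b) (D j))"
    by (rule reg.vm_assoc[where B = UNIV]) simp
  also have "\<dots> = vm (*) x (\<lambda>b. 0)"
    using D_cycle[of "Suc j"] by (simp only: rcycle.simps)
  also have "\<dots> = 0"
    by (rule reg.vm_mat_zero[where B = UNIV]) simp
  finally show ?thesis by (simp add: Suc)
qed

lemma exact: "rcycle V D \<epsilon> k x \<longleftrightarrow> (\<exists>w. x = vm (*) w (D k))"
proof
  assume "rcycle V D \<epsilon> k x"
  then have "D k (enc x) = x" by (cases k) auto
  then have "x = vm (*) (single (enc x) 1) (D k)"
    by (simp add: vm_single_one)
  then show "\<exists>w. x = vm (*) w (D k)" by blast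
qed (auto simp: vm_D_cycle)

lemma based: "based_resolution V (\<lambda>k. UNIV) D \<epsilon>"
  by (intro based_resolution.intro based_resolution_axioms.intro V.left_module_axioms)
    (auto simp: eps_closed eps_add eps_rscale eps_surj exact)

definition free :: "('r, 'b) module" where
  "free = \<lparr>carrier = range enc, monoid.mult = undefined, monoid.one = undefined,
     ring.zero = enc 0, ring.add = (\<lambda>a b. enc (dec a + dec b)),
     smult = (\<lambda>r a. enc (rscale (*) r (dec a)))\<rparr>"

lemma free_left_module: "left_module free"
proof (intro left_module.intro left_module_axioms.intro scalar_action.intro scalar_action_axioms.intro)
  show "abelian_group free"
  proof (rule abelian_groupI)
    fix x assume "x \<in> carrier free"
    then obtain p where "x = enc p" by (auto simp: free_def)
    then show "\<exists>y\<in>carrier free. y \<oplus>\<^bsub>free\<^esub> x = \<zero>\<^bsub>free\<^esub>"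
      by (intro bexI[of _ "enc (- p)"]) (auto simp: free_def)
  qed (auto simp: free_def algebra_simps)
next
  fix a b r s
  assume "a \<in> carrier free"
  then obtain x where a: "a = enc x" by (auto simp: free_def)
  show "r \<odot>\<^bsub>free\<^esub> a \<in> carrier free" by (simp add: free_def)
  show "(r + s) \<odot>\<^bsub>free\<^esub> a = r \<odot>\<^bsub>free\<^esub> a \<oplus>\<^bsub>free\<^esub> s \<odot>\<^bsub>free\<^esub> a"
    by (simp add: free_def reg.rscale_add_left)
  show "1 \<odot>\<^bsub>free\<^esub> a = a" by (simp add: free_def a rscale_one)
  show "(r * s) \<odot>\<^bsub>free\<^esub> a = r \<odot>\<^bsub>free\<^esub> (s \<odot>\<^bsub>free\<^esub> a)"
    by (simp add: free_def reg.rscale_rscale)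
  assume "b \<in> carrier free"
  show "r \<odot>\<^bsub>free\<^esub> (a \<oplus>\<^bsub>free\<^esub> b) = r \<odot>\<^bsub>free\<^esub> a \<oplus>\<^bsub>free\<^esub> r \<odot>\<^bsub>free\<^esub> b"
    by (simp add: free_def reg.rscale_add_right)
qed

definition "e b = enc (single b 1)"

lemma e_inj: "e b = e b' \<longleftrightarrow> b = b'"
  using enc_inj by (auto simp: e_def inj_eq dest!: arg_cong[of _ _ keys])

text \<open>A coefficient function supported on the basis \<open>e\<close> can be read off entrywise
  from the decoded combination, which gives both existence and uniqueness in
  \<open>free_module\<close>.\<close>

lemma free_combination:
  assumes "finite {a. c a \<noteq> 0}" "{a. c a \<noteq> 0} \<subseteq> range e"
  shows "dec (\<Oplus>\<^bsub>free\<^esub>a\<in>{a. c a \<noteq> 0}. c a \<odot>\<^bsub>free\<^esub> a) = (\<Sum>a\<in>{a. c a \<noteq> 0}. rscale (*) (c a) (dec a))"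
    "lookup (\<Sum>a\<in>{a. c a \<noteq> 0}. rscale (*) (c a) (dec a)) b = c (e b)"
    "(\<Oplus>\<^bsub>free\<^esub>a\<in>{a. c a \<noteq> 0}. c a \<odot>\<^bsub>free\<^esub> a) \<in> carrier free"
proof -
  interpret F: left_module free by (rule free_left_module)
  have "(\<Oplus>\<^bsub>free\<^esub>a\<in>{a. c a \<noteq> 0}. c a \<odot>\<^bsub>free\<^esub> a) =
      (\<Oplus>\<^bsub>free\<^esub>a\<in>{a. c a \<noteq> 0}. enc (rscale (*) (c a) (dec a)))"
    by (simp add: free_def)
  also have "\<dots> = enc (\<Sum>a\<in>{a. c a \<noteq> 0}. rscale (*) (c a) (dec a))"
    by (rule F.finsum_transport) (auto simp: free_def assms(1))
  finally have eq: "(\<Oplus>\<^bsub>free\<^esub>a\<in>{a. c a \<noteq> 0}. c a \<odot>\<^bsub>free\<^esub> a) = \<dots>" .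
  then show "dec (\<Oplus>\<^bsub>free\<^esub>a\<in>{a. c a \<noteq> 0}. c a \<odot>\<^bsub>free\<^esub> a) = (\<Sum>a\<in>{a. c a \<noteq> 0}. rscale (*) (c a) (dec a))"
    by simp
  show "(\<Oplus>\<^bsub>free\<^esub>a\<in>{a. c a \<noteq> 0}. c a \<odot>\<^bsub>free\<^esub> a) \<in> carrier free"
    unfolding eq by (simp add: free_def)
  have "lookup (\<Sum>a\<in>{a. c a \<noteq> 0}. rscale (*) (c a) (dec a)) b =
      (\<Sum>a\<in>{a. c a \<noteq> 0}. c a * lookup (dec a) b)"
    by (simp add: lookup_sum reg.lookup_rscale)
  also have "\<dots> = (\<Sum>a\<in>{a. c a \<noteq> 0}. if a = e b then c (e b) else 0)"
  proof (rule sum.cong[OF refl])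
    fix a assume "a \<in> {a. c a \<noteq> 0}"
    then obtain b' where a: "a = e b'" using assms(2) by blast
    then have "lookup (dec a) b = (1 when b' = b)"
      by (simp add: e_def lookup_single)
    then show "c a * lookup (dec a) b = (if a = e b then c (e b) else 0)"
      by (auto simp: a e_inj when_def)
  qed
  also have "\<dots> = c (e b)"
    using assms(1) by (simp add: sum.delta)
  finally show "lookup (\<Sum>a\<in>{a. c a \<noteq> 0}. rscale (*) (c a) (dec a)) b = c (e b)" .
qed

lemma free_free: "free_module free"
  unfolding free_module_def
proof (intro conjI exI[of _ "range e"] ballI free_left_module)
  show "range e \<subseteq> carrier free" by (auto simp: free_def e_def)
  fix m assume "m \<in> carrier free"
  then obtain x where m: "m = enc x" by (auto simp: free_def)
  define c where "c a = (if a \<in> range e then lookup x (inv_into UNIV e a) else 0)" for a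
  have ce: "c (e b) = lookup x b" for b
    by (simp add: c_def inv_f_f[of e b] inj_def e_inj)
  have "{a. c a \<noteq> 0} \<subseteq> e ` keys x"
  proof
    fix a assume "a \<in> {a. c a \<noteq> 0}"
    then obtain b where "a = e b" "c (e b) \<noteq> 0" by (auto simp: c_def split: if_splits)
    then show "a \<in> e ` keys x" by (auto simp: ce in_keys_iff)
  qed
  then have c: "finite {a. c a \<noteq> 0}" "{a. c a \<noteq> 0} \<subseteq> range e"
    by (auto intro: finite_subset)
  show "\<exists>!c :: 'b \<Rightarrow> 'r. finite {a. c a \<noteq> 0} \<and> {a. c a \<noteq> 0} \<subseteq> range e \<and>
     m = (\<Oplus>\<^bsub>free\<^esub>a\<in>{a. c a \<noteq> 0}. c a \<odot>\<^bsub>free\<^esub> a)"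
  proof (rule ex1I[of _ c], intro conjI c)
    have "dec (\<Oplus>\<^bsub>free\<^esub>a\<in>{a. c a \<noteq> 0}. c a \<odot>\<^bsub>free\<^esub> a) = x"
      by (rule poly_mapping_eqI) (simp only: free_combination[OF c] ce)
    then show "m = (\<Oplus>\<^bsub>free\<^esub>a\<in>{a. c a \<noteq> 0}. c a \<odot>\<^bsub>free\<^esub> a)"
      using free_combination(3)[OF c] by (auto simp: m free_def)
  next
    fix c' :: "'b \<Rightarrow> 'r"
    assume c': "finite {a. c' a \<noteq> 0} \<and> {a. c' a \<noteq> 0} \<subseteq> range e \<and>
      m = (\<Oplus>\<^bsub>free\<^esub>a\<in>{a. c' a \<noteq> 0}. c' a \<odot>\<^bsub>free\<^esub> a)"
    then have f: "finite {a. c' a \<noteq> 0}" "{a. c' a \<noteq> 0} \<subseteq> range e" by auto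
    have "dec m = (\<Sum>a\<in>{a. c' a \<noteq> 0}. rscale (*) (c' a) (dec a))"
      using free_combination(1)[OF f] c' by simp
    then have eb: "c' (e b) = c (e b)" for b
      using free_combination(2)[OF f, of b] by (simp add: m ce)
    show "c' = c"
    proof
      fix a show "c' a = c a"
      proof (cases "a \<in> range e")
        case False
        then have "c' a = 0" "c a = 0" using f(2) c(2) by blast+
        then show ?thesis by simp
      qed (use eb in auto)
    qed
  qed
qed

lemma resolution: "free_resolution V (\<lambda>k. free) (\<lambda>k a. enc (vm (*) (dec a) (D k))) (\<lambda>a. \<epsilon> (dec a))"
  unfolding free_resolution_def
proof (intro conjI allI free_free)
  have vmr: "vm (*) (rscale (*) r x) (D k) = rscale (*) r (vm (*) x (D k))" for r x k
    by (simp add: reg.vm_rscale)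
  show "(\<lambda>a. \<epsilon> (dec a)) \<in> module_hom free V"
    by (auto simp: module_hom_def hom_def free_def eps_closed eps_add eps_rscale)
  show "(\<lambda>a. enc (vm (*) (dec a) (D k))) \<in> module_hom free free" for k
    by (auto simp: module_hom_def hom_def free_def reg.vm_add[where B = UNIV and B' = UNIV] vmr)
  show "(\<lambda>a. \<epsilon> (dec a)) ` carrier free = carrier V"
    using eps_closed eps_surj by (force simp: free_def)
  show "(\<lambda>a. enc (vm (*) (dec a) (D 0))) ` carrier free = a_kernel free V (\<lambda>a. \<epsilon> (dec a))"
    using exact[of 0] by (auto simp: free_def a_kernel_def' image_image)
  show "(\<lambda>a. enc (vm (*) (dec a) (D (Suc k)))) ` carrier free =
      a_kernel free free (\<lambda>a. enc (vm (*) (dec a) (D k)))" for k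
    using exact[of "Suc k"] enc_inj by (auto simp: free_def a_kernel_def' inj_eq image_image)
qed

end

lemma coded_resolution_exists:
  fixes V :: "('r::ring_1, 'v) module"
  assumes "left_module V"
  shows "\<exists>(enc :: (('v \<times> 'r) list \<Rightarrow>\<^sub>0 'r) \<Rightarrow> ('v \<times> 'r) list) \<eta>. coded_resolution V enc \<eta>"
proof -
  interpret left_module V by (rule assms)
  obtain enc :: "(('v \<times> 'r) list \<Rightarrow>\<^sub>0 'r) \<Rightarrow> ('v \<times> 'r) list" where "inj enc"
    using finitely_supported_code_exists by blast
  \<comment> \<open>A list names the first component of its head if that lies in the carrier, and
    zero otherwise; the unspecified head of the empty list is harmless under this rule.\<close>
  moreover define \<eta> :: "('v \<times> 'r) list \<Rightarrow> 'v" where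
    "\<eta> xs = (if fst (hd xs) \<in> carrier V then fst (hd xs) else \<zero>\<^bsub>V\<^esub>)" for xs
  have "range \<eta> = carrier V"
  proof
    show "carrier V \<subseteq> range \<eta>"
    proof
      fix v assume "v \<in> carrier V"
      then have "\<eta> [(v, 0)] = v" by (simp add: \<eta>_def)
      then show "v \<in> range \<eta>" by (metis rangeI)
    qed
  qed (auto simp: \<eta>_def)
  ultimately show ?thesis
    by (intro exI[of _ enc] exI[of _ \<eta>] coded_resolution.intro assms coded_resolution_axioms.intro)
qed

lemma free_resolution_exists:
  fixes V :: "('r::ring_1, 'v) module"
  assumes "left_module V"
  shows "\<exists>(P :: nat \<Rightarrow> ('r, ('v \<times> 'r) list) module) d \<epsilon>. free_resolution V P d \<epsilon>"
  using coded_resolution_exists[OF assms] coded_resolution.resolution by blast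

lemma based_resolution_exists:
  fixes V :: "('r::ring_1, 'v) module"
  assumes "left_module V"
  shows "\<exists>D \<epsilon>. based_resolution V (\<lambda>k. UNIV :: ('v \<times> 'r) list set) D \<epsilon>"
  using coded_resolution_exists[OF assms] coded_resolution.based by blast

section \<open>The universal enveloping algebra\<close>

definition gen :: "'g::complex_lie_algebra \<Rightarrow> 'g uea" where
  "gen x = abs_uea (uea_gen x)"

definition sc :: "complex \<Rightarrow> 'g::complex_lie_algebra uea" where
  "sc c = abs_uea (uea_scalar c)"

lemma abs_uea_eq_iff: "abs_uea p = abs_uea q \<longleftrightarrow> p - q \<in> uea_ideal"
  by (rule uea.abs_eq_iff)

lemma abs_rep_uea [simp]: "abs_uea (rep_uea u) = u"
  by (rule Quotient3_abs_rep[OF Quotient3_uea])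

lemma abs_uea_minus: "abs_uea p - abs_uea q = abs_uea (p - q)"
  by (rule minus_uea.abs_eq)

lemma relator_uea: "r \<in> uea_relators \<Longrightarrow> r \<in> uea_ideal"
  using uea_ideal.mult[of r 1 1] by simp

lemma gen_add: "gen (x + y) = gen x + gen y"
  unfolding gen_def plus_uea.abs_eq abs_uea_eq_iff by (intro relator_uea uea_relators.add)

lemma gen_scale: "gen (c *\<^sub>C x) = sc c * gen x"
  unfolding gen_def sc_def times_uea.abs_eq abs_uea_eq_iff by (intro relator_uea uea_relators.scale)

lemma gen_bracket: "gen x * gen y - gen y * gen x = gen (bracket x y)"
  unfolding gen_def times_uea.abs_eq abs_uea_minus abs_uea_eq_iff
  by (intro relator_uea uea_relators.bracket)

lemma sc_add: "sc (a + b) = sc a + sc b"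
  unfolding sc_def plus_uea.abs_eq by (simp add: single_add)

lemma sc_mult: "sc (a * b) = sc a * sc b"
  unfolding sc_def times_uea.abs_eq by (simp add: mult_single)

lemma sc_one: "sc 1 = 1"
  unfolding sc_def one_uea.abs_eq by simp

lemma sc_zero: "sc 0 = 0"
  unfolding sc_def zero_uea.abs_eq by simp

lemma scalar_central: "uea_scalar c * p = p * uea_scalar c"
proof -
  have "p \<in> FV UNIV UNIV" by simp
  then show ?thesis
    by (induction rule: reg.FV_induct) (auto simp: mult_single algebra_simps)
qed

lemma sc_central: "sc c * u = u * sc c"
proof -
  have "sc c * abs_uea (rep_uea u) = abs_uea (rep_uea u) * sc c"
    unfolding sc_def times_uea.abs_eq scalar_central ..
  then show ?thesis by simp
qed

lemma word_Cons: "single (Word (x # xs)) (1::complex) = uea_gen x * single (Word xs) 1"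
  by (simp add: mult_single plus_word_def)

text \<open>Words are products of letters, so scalars and the Lie algebra generate U. Identities
  between ring maps on U can thus be checked on generators.\<close>

lemma uea_induct [case_names sc gen add mult]:
  fixes u :: "'g::complex_lie_algebra uea"
  assumes sc: "\<And>c. P (sc c)" and gen: "\<And>x. P (gen x)"
    and add: "\<And>u v. P u \<Longrightarrow> P v \<Longrightarrow> P (u + v)" and mult: "\<And>u v. P u \<Longrightarrow> P v \<Longrightarrow> P (u * v)"
  shows "P u"
proof -
  have word: "P (abs_uea (single (Word xs) 1))" for xs :: "'g list"
  proof (induction xs)
    case Nil
    then show ?case using sc[of 1] by (simp add: sc_def zero_word_def)
  next
    case (Cons x xs)
    have "abs_uea (single (Word (x # xs)) 1) =
        gen x * abs_uea (single (Word xs) 1)"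
      unfolding gen_def times_uea.abs_eq by (subst word_Cons) (rule refl)
    then show ?case using mult[OF gen[of x] Cons] by (simp only:)
  qed
  have "rep_uea u \<in> FV UNIV UNIV" by simp
  then have "P (abs_uea (rep_uea u))"
  proof (induction rule: reg.FV_induct)
    case zero
    then show ?case using sc[of 0] by (simp add: sc_def)
  next
    case (single w c)
    have "single w c = uea_scalar c * single (Word (letters w)) 1"
      by (simp add: mult_single)
    then show ?case using mult[OF sc[of c] word[of "letters w"]] by (simp add: sc_def times_uea.abs_eq)
  next
    case (add p q)
    then show ?case using assms(3) by (simp flip: plus_uea.abs_eq)
  qed
  then show ?thesis by simp
qed

section \<open>The universal property of the enveloping algebra\<close>

locale scalar_embedding =
  fixes s :: "complex \<Rightarrow> 'a::ring_1"
  assumes s_add: "s (a + b) = s a + s b" and s_mult: "s (a * b) = s a * s b" and s_one: "s 1 = 1"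
    and s_central: "s a * u = u * s a"
begin

text \<open>Evaluation of noncommutative polynomials with central coefficients, on the free algebra,
  where any \<open>f\<close> extends.\<close>

definition ext :: "('g \<Rightarrow> 'a) \<Rightarrow> 'g free_algebra \<Rightarrow> 'a" where
  "ext f p = lext (\<lambda>w c. s c * prod_list (map f (letters w))) p"

lemma s_zero: "s 0 = 0"
  using s_add[of 0 0] by simp

lemma ext_zero [simp]: "ext f 0 = 0"
  by (simp add: ext_def)

lemma ext_add: "ext f (p + q) = ext f p + ext f q"
  unfolding ext_def by (rule lext_add) (auto simp: s_zero s_add algebra_simps)

lemma ext_single: "ext f (single w c) = s c * prod_list (map f (letters w))"
  unfolding ext_def by (rule lext_single) (simp add: s_zero)

lemma ext_uminus: "ext f (- p) = - ext f p"
  using ext_add[of f p "- p"] by (simp add: eq_neg_iff_add_eq_0 add.commute)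

lemma ext_minus: "ext f (p - q) = ext f p - ext f q"
  using ext_add[of f p "- q"] by (simp add: ext_uminus)

lemma ext_mult: "ext f (p * q) = ext f p * ext f q"
proof -
  have "p \<in> FV UNIV UNIV" by simp
  then show ?thesis
  proof (induction rule: reg.FV_induct)
    case (single w a)
    have "q \<in> FV UNIV UNIV" by simp
    then show ?case
    proof (induction rule: reg.FV_induct)
      case (single v b)
      have "s a * s b * (X * Y) = s a * X * (s b * Y)" for X Y
      proof -
        have "s a * s b * (X * Y) = s a * (s b * X) * Y" by (simp only: mult.assoc)
        also have "\<dots> = s a * X * (s b * Y)" by (simp only: s_central[of b X] mult.assoc)
        finally show ?thesis .
      qed
      then show ?case by (simp add: mult_single ext_single plus_word_def s_mult)
    qed (auto simp: distrib_left ext_add)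
  qed (auto simp: distrib_right ext_add)
qed

lemma ext_gen: "ext f (uea_gen x) = f x"
  by (simp add: ext_single s_one)

lemma ext_scalar: "ext f (uea_scalar c) = s c"
  by (simp add: ext_single zero_word_def)

text \<open>Taking an arbitrary two-sided ideal \<open>J\<close> instead of \<open>0\<close> covers maps that respect the relators
  only modulo \<open>J\<close>.\<close>

lemma ext_ideal:
  assumes J: "0 \<in> J" "\<And>x y. x \<in> J \<Longrightarrow> y \<in> J \<Longrightarrow> x + y \<in> J" "\<And>a x b. x \<in> J \<Longrightarrow> a * x * b \<in> J"
    and f: "\<And>x y. f (x + y) - (f x + f y) \<in> J" "\<And>c x. f (c *\<^sub>C x) - s c * f x \<in> J"
      "\<And>x y. f x * f y - f y * f x - f (bracket x y) \<in> J"
    and p: "p \<in> uea_ideal"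
  shows "ext f p \<in> J"
  using p
proof (induction rule: uea_ideal.induct)
  case (mult r a b)
  have "ext f r \<in> J"
    using mult f by cases (auto simp: ext_minus ext_add ext_mult ext_gen ext_scalar)
  then show ?case by (simp add: ext_mult J)
qed (auto simp: ext_add J)

definition lift_uea :: "('g::complex_lie_algebra \<Rightarrow> 'a) \<Rightarrow> 'g uea \<Rightarrow> 'a" where
  "lift_uea f u = ext f (rep_uea u)"

context
  fixes f :: "'g::complex_lie_algebra \<Rightarrow> 'a"
  assumes f_add: "f (x + y) = f x + f y" and f_scale: "f (c *\<^sub>C x) = s c * f x"
    and f_bracket: "f x * f y - f y * f x = f (bracket x y)"
begin

text \<open>The zero ideal in \<open>ext_ideal\<close>: once \<open>f\<close> respects the relators,
  the choice of a representative has no influence.\<close>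

lemma lift_abs: "lift_uea f (abs_uea p) = ext f p"
proof -
  have "rep_uea (abs_uea p) - p \<in> uea_ideal"
    using abs_uea_eq_iff[of "rep_uea (abs_uea p)" p] by simp
  then have "ext f (rep_uea (abs_uea p) - p) \<in> {0}"
    by (intro ext_ideal) (auto simp: f_add f_scale f_bracket)
  then show ?thesis by (simp add: lift_uea_def ext_minus)
qed

lemma lift_gen: "lift_uea f (gen x) = f x"
  by (simp add: gen_def lift_abs ext_gen)

lemma lift_sc: "lift_uea f (sc c) = s c"
  by (simp add: sc_def lift_abs ext_scalar)

lemma lift_add: "lift_uea f (u + v) = lift_uea f u + lift_uea f v"
  using lift_abs[of "rep_uea u + rep_uea v"] by (simp add: ext_add lift_uea_def flip: plus_uea.abs_eq)

lemma lift_mult: "lift_uea f (u * v) = lift_uea f u * lift_uea f v"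
  using lift_abs[of "rep_uea u * rep_uea v"] by (simp add: ext_mult lift_uea_def flip: times_uea.abs_eq)

end

end

interpretation sc: scalar_embedding sc
  by standard (rule sc_add sc_mult sc_one sc_central)+

section \<open>The action of the enveloping algebra on a Lie module\<close>

context lie_module
begin

abbreviation "wact w m \<equiv> foldr (lact M) (letters w) m"

lemma wact_closed: "m \<in> carrier M \<Longrightarrow> foldr (lact M) xs m \<in> carrier M"
  by (induction xs) (auto simp: lact_closed)

lemma wact_add: "m \<in> carrier M \<Longrightarrow> n \<in> carrier M \<Longrightarrow>
    foldr (lact M) xs (m \<oplus> n) = foldr (lact M) xs m \<oplus> foldr (lact M) xs n"
  by (induction xs) (auto simp: lact_add_right wact_closed)

lemma wact_smult: "m \<in> carrier M \<Longrightarrow> foldr (lact M) xs (c \<odot> m) = c \<odot> foldr (lact M) xs m"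
  by (induction xs) (auto simp: lact_smult_right wact_closed)

definition "fa p m = lcomb M (\<lambda>w. wact w m) p"

lemma fa_closed: "m \<in> carrier M \<Longrightarrow> fa p m \<in> carrier M"
  unfolding fa_def by (rule lcomb_closed[where B = UNIV]) (auto simp: wact_closed)

lemma fa_add_left: "m \<in> carrier M \<Longrightarrow> fa (p + q) m = fa p m \<oplus> fa q m"
  unfolding fa_def by (rule lcomb_add[where B = UNIV]) (auto simp: wact_closed)

lemma fa_single: "m \<in> carrier M \<Longrightarrow> fa (single w c) m = c \<odot> wact w m"
  unfolding fa_def by (rule lcomb_single) (auto simp: wact_closed)

lemma fa_zero_left: "fa 0 m = \<zero>"
  by (simp add: fa_def)

lemma fa_add_right:
  assumes m: "m \<in> carrier M" and n: "n \<in> carrier M"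
  shows "fa p (m \<oplus> n) = fa p m \<oplus> fa p n"
proof -
  have "p \<in> FV UNIV UNIV" by simp
  then show ?thesis
  proof (induction rule: reg.FV_induct)
    case (single w a)
    then show ?case using m n by (simp add: fa_single wact_add smult_add_right wact_closed)
  next
    case (add x y)
    then show ?case using m n by (simp add: fa_add_left fa_closed a_ac)
  qed (simp add: fa_zero_left)
qed

lemma fa_smult_right:
  assumes m: "m \<in> carrier M"
  shows "fa p (c \<odot> m) = c \<odot> fa p m"
proof -
  have "p \<in> FV UNIV UNIV" by simp
  then show ?thesis
  proof (induction rule: reg.FV_induct)
    case (single w a)
    then show ?case using m
      by (simp add: fa_single wact_smult wact_closed smult_closed mult.commute flip: smult_assoc)
  next
    case (add x y)
    then show ?case using m by (simp add: fa_add_left fa_closed smult_closed smult_add_right)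
  qed (simp add: fa_zero_left smult_zero_right)
qed

lemma fa_zero_right: "fa p \<zero> = \<zero>"
  using fa_smult_right[of \<zero> p 0] by (simp add: smult_zero_left smult_zero_right fa_closed)

lemma fa_mult:
  assumes m: "m \<in> carrier M"
  shows "fa (p * q) m = fa p (fa q m)"
proof -
  have "p \<in> FV UNIV UNIV" by simp
  then show ?thesis
  proof (induction rule: reg.FV_induct)
    case (single w a)
    have "q \<in> FV UNIV UNIV" by simp
    then show ?case
    proof (induction rule: reg.FV_induct)
      case zero
      show ?case by (simp add: fa_zero_left fa_zero_right)
    next
      case (single v b)
      then show ?case using m
        by (simp add: mult_single fa_single smult_closed wact_closed plus_word_def wact_smult smult_assoc)
    next
      case (add x y)
      then show ?case using m by (simp add: distrib_left fa_add_left fa_closed fa_add_right)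
    qed
  next
    case (add x y)
    then show ?case using m by (simp add: distrib_right fa_add_left fa_closed)
  qed (simp add: fa_zero_left)
qed

lemma fa_minus: "m \<in> carrier M \<Longrightarrow> fa (p - q) m = fa p m \<ominus> fa q m"
proof -
  assume m: "m \<in> carrier M"
  have "fa p m = fa (p - q) m \<oplus> fa q m"
    using fa_add_left[OF m, of "p - q" q] by simp
  then show ?thesis
    using fa_closed[OF m] by (simp add: a_minus_def a_assoc r_neg)
qed

text \<open>On each relator this is one of the axioms of a Lie module: additivity, homogeneity or
  the bracket identity.\<close>

lemma fa_ideal:
  assumes p: "p \<in> uea_ideal" and m: "m \<in> carrier M"
  shows "fa p m = \<zero>"
  using p m
proof (induction arbitrary: m rule: uea_ideal.induct)
  case (mult r a b)
  have "fa r n = \<zero>" if n: "n \<in> carrier M" for n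
    using mult(1)
    by cases (simp_all add: n fa_minus fa_add_left fa_mult fa_single smult_one smult_closed lact_closed
      zero_word_def lact_add_left lact_smult_left lact_bracket r_neg a_minus_def)
  then show ?case using mult by (simp add: fa_mult fa_closed fa_zero_right)
qed (auto simp: fa_zero_left fa_add_left)

definition "uact u m = fa (rep_uea u) m"

lemma uact_abs:
  assumes m: "m \<in> carrier M"
  shows "uact (abs_uea p) m = fa p m"
proof -
  have "rep_uea (abs_uea p) - p \<in> uea_ideal"
    using abs_uea_eq_iff[of "rep_uea (abs_uea p)" p] by simp
  from fa_ideal[OF this m] show ?thesis
    using fa_add_left[OF m, of "rep_uea (abs_uea p) - p" p] fa_closed[OF m] by (simp add: uact_def)
qed

lemma uact_closed: "m \<in> carrier M \<Longrightarrow> uact u m \<in> carrier M"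
  by (simp add: uact_def fa_closed)

lemma uact_gen: "m \<in> carrier M \<Longrightarrow> uact (gen x) m = lact M x m"
  by (simp add: gen_def uact_abs fa_single smult_one lact_closed)

lemma uact_sc: "m \<in> carrier M \<Longrightarrow> uact (sc c) m = c \<odot> m"
  by (simp add: sc_def uact_abs fa_single zero_word_def)

lemma uact_add_left: "m \<in> carrier M \<Longrightarrow> uact (u + v) m = uact u m \<oplus> uact v m"
  using uact_abs[of m "rep_uea u + rep_uea v"]
  by (simp add: fa_add_left uact_def flip: plus_uea.abs_eq)

lemma uact_mult: "m \<in> carrier M \<Longrightarrow> uact (u * v) m = uact u (uact v m)"
  using uact_abs[of m "rep_uea u * rep_uea v"]
  by (simp add: fa_mult uact_def flip: times_uea.abs_eq)

lemma uact_add_right: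
  "m \<in> carrier M \<Longrightarrow> n \<in> carrier M \<Longrightarrow> uact u (m \<oplus> n) = uact u m \<oplus> uact u n"
  by (simp add: uact_def fa_add_right)

lemma uact_smult: "m \<in> carrier M \<Longrightarrow> uact u (c \<odot> m) = c \<odot> uact u m"
  by (simp add: uact_def fa_smult_right)

lemma uact_one: "m \<in> carrier M \<Longrightarrow> uact 1 m = m"
  using uact_sc[of m 1] by (simp add: sc_one smult_one)

lemma uact_zero_left: "m \<in> carrier M \<Longrightarrow> uact 0 m = \<zero>"
  using uact_sc[of m 0] by (simp add: sc_zero smult_zero_left)

lemma smult_uea_left_module: "smult (uea_left_module M) u m = uact u m"
  by (simp add: uea_left_module_def free_algebra_act_def uact_def fa_def lcomb_def)

lemma uea_left_module: "left_module (uea_left_module M)"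
proof (intro left_module.intro left_module_axioms.intro scalar_action.intro scalar_action_axioms.intro)
  show "abelian_group (uea_left_module M)"
    by (rule abelian_groupI)
      (auto simp: uea_left_module_def a_ac intro!: bexI[of _ "\<ominus> _"] l_neg)
qed (unfold smult_uea_left_module, auto simp: uea_left_module_def uact_closed uact_add_left
    uact_add_right uact_one uact_mult)

end

section \<open>The Poincare--Birkhoff--Witt theorem\<close>

lemma vmU_add: "vm (*) (x + y) D = vm (*) x D + vm (*) (y :: _ \<Rightarrow>\<^sub>0 'r::ring_1) D"
  by (rule reg.vm_add[where B = UNIV and B' = UNIV]) simp_all

lemma vmU_diff: "vm (*) (x - y) D = vm (*) x D - vm (*) (y :: _ \<Rightarrow>\<^sub>0 'r::ring_1) D"
  by (rule reg.vm_diff[where B = UNIV and B' = UNIV]) simp_all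

lemma vmU_uminus: "vm (*) (- x) D = - vm (*) (x :: _ \<Rightarrow>\<^sub>0 'r::ring_1) D"
  by (rule reg.vm_uminus[where B = UNIV]) simp_all

lemma vmU_assoc: "vm (*) (vm (*) (x :: _ \<Rightarrow>\<^sub>0 'r::ring_1) D) E = vm (*) x (\<lambda>b. vm (*) (D b) E)"
  by (rule reg.vm_assoc[where B = UNIV]) simp_all

lemma vmU_mat_add: "vm (*) (x :: _ \<Rightarrow>\<^sub>0 'r::ring_1) (\<lambda>b. D b + E b) = vm (*) x D + vm (*) x E"
  by (rule reg.vm_mat_add[where B = UNIV]) simp_all

lemma vmU_rscale: "vm (*) (rscale (*) m (p :: _ \<Rightarrow>\<^sub>0 'r::ring_1)) E = rscale (*) m (vm (*) p E)"
  by (rule reg.vm_rscale) simp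

lemma vm_mat_rscale:
  fixes x :: "'b \<Rightarrow>\<^sub>0 'r::comm_ring_1"
  shows "vm (*) x (\<lambda>b. rscale (*) r (D b)) = rscale (*) r (vm (*) x D)"
proof (rule poly_mapping_eqI)
  have x: "x \<in> FV UNIV UNIV" by simp
  show "lookup (vm (*) x (\<lambda>b. rscale (*) r (D b))) k =
      lookup (rscale (*) r (vm (*) x D)) k" for k
    by (simp add: reg.lookup_vm[OF x] reg.lookup_rscale sum_distrib_left algebra_simps)
qed

text \<open>The Lie algebra acts on its symmetric algebra, whose basis is the set of multisets of
  indices: \<open>A n i M\<close> is the product of the \<open>i\<close>-th basis element with the monomial \<open>M\<close>, provided that
  the size of \<open>M\<close> is at most \<open>n\<close>.\<close>

locale structure_constants =
  fixes \<gamma> :: "nat \<Rightarrow> nat \<Rightarrow> nat \<Rightarrow>\<^sub>0 complex" and I :: "nat set"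
  assumes anti: "\<gamma> j i = - \<gamma> i j"
    and jac: "vm (*) (\<gamma> j k) (\<gamma> i) + vm (*) (\<gamma> k i) (\<gamma> j) + vm (*) (\<gamma> i j) (\<gamma> k) = 0"
    and keys_gamma: "keys (\<gamma> i j) \<subseteq> I"
begin

text \<open>For M = jN with j least and j < i, the formula is x_i x_j N = x_j x_i N + [x_i, x_j] N.
  The leading monomial iN of x_i N is sent by x_j to the monomial iM, as j is least; only the
  remainder, of degree at most that of N, is fed back into \<open>A n j\<close>. This nested call is
  the reason for recursion on a bound n.\<close>

fun A :: "nat \<Rightarrow> nat \<Rightarrow> nat multiset \<Rightarrow> nat multiset \<Rightarrow>\<^sub>0 complex" where
  "A 0 i M = single (add_mset i M) 1"
| "A (Suc n) i M = (if \<forall>j\<in>#M. i \<le> j then single (add_mset i M) 1 else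
     let j = Min_mset M; N = M - {#j#} in
       single (add_mset i M) 1 +
       vm (*) (A n i N - single (add_mset i N) 1) (A n j) + vm (*) (\<gamma> i j) (\<lambda>k. A n k N))"

declare A.simps [simp del]

text \<open>What may occur in x_i M besides the leading monomial: the degree does not exceed that of
  M, and new indices come only from the structure constants, hence from \<open>I\<close>.\<close>

definition lower :: "nat \<Rightarrow> nat multiset \<Rightarrow> nat multiset set" where
  "lower i M = {K. size K \<le> size M \<and> set_mset K \<subseteq> insert i (set_mset M) \<union> I}"

text \<open>Stability in the bound and the shape of the remainder are proved together: the nested
  call takes a remainder as its argument, and its value is stable only because that remainder has
  low degree.\<close>

lemma A_leading:
  "(\<forall>m\<ge>size M. A m i M = A (size M) i M) \<and>
   A (size M) i M - single (add_mset i M) 1 \<in> FV (lower i M) UNIV"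
proof (induction "size M" arbitrary: M i rule: less_induct)
  case less
  show ?case
  proof (cases "\<forall>j\<in>#M. i \<le> j")
    case True
    then have "A m i M = single (add_mset i M) 1" for m
      by (cases m) (auto simp: A.simps)
    then show ?thesis by (simp add: FV_zero)
  next
    case False
    then obtain n where n: "size M = Suc n" by (cases "size M") auto
    define j where "j = Min_mset M"
    define N where "N = M - {#j#}"
    have j: "j \<in># M" using False unfolding j_def by (intro Min_in) auto
    then have M: "M = add_mset j N" by (simp add: N_def)
    with n have N: "size N = n" by simp
    note IH = less[unfolded n less_Suc_eq_le]
    have stable: "A m k K = A n k K" if "size K \<le> n" "n \<le> m" for m k K
      using IH[OF that(1), of k] that by (metis order_trans)
    have IHN: "A n i N - single (add_mset i N) 1 \<in> FV (lower i N) UNIV"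
      using conjunct2[OF IH[of N i]] N by simp
    have low: "K \<in> lower i N \<Longrightarrow> size K \<le> n" for K
      by (simp add: lower_def N)
    have unf: "A (Suc m) i M = single (add_mset i M) 1 +
       vm (*) (A n i N - single (add_mset i N) 1) (A n j) + vm (*) (\<gamma> i j) (\<lambda>k. A n k N)"
      if "n \<le> m" for m
    proof -
      have "A (Suc m) i M = single (add_mset i M) 1 +
       vm (*) (A m i N - single (add_mset i N) 1) (A m j) + vm (*) (\<gamma> i j) (\<lambda>k. A m k N)"
        using False unfolding A.simps Let_def j_def[symmetric] N_def[symmetric] by (simp only: if_False)
      moreover have "vm (*) (A n i N - single (add_mset i N) 1) (A m j) =
          vm (*) (A n i N - single (add_mset i N) 1) (A n j)"
        using low that by (intro reg.vm_cong[OF IHN] stable) auto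
      moreover have "A m k N = A n k N" for k
        using stable[OF _ that] N by simp
      ultimately show ?thesis by (simp only:)
    qed
    have AnK: "A n k K \<in> FV (insert (add_mset k K) (lower k K)) UNIV" if K: "size K \<le> n" for k K
    proof -
      have "A n k K - single (add_mset k K) 1 \<in> FV (lower k K) UNIV"
        using IH[OF K, of k] K by metis
      then have "(A n k K - single (add_mset k K) 1) + single (add_mset k K) 1
         \<in> FV (insert (add_mset k K) (lower k K)) UNIV"
        by (intro reg.FV_add FV_single) (auto intro: FV_mono)
      then show ?thesis by simp
    qed
    have "A n j K \<in> FV (lower i M) UNIV" if "K \<in> lower i N" for K
    proof (rule FV_mono[OF AnK[OF low[OF that]]])
      show "insert (add_mset j K) (lower j K) \<subseteq> lower i M"
        using that j by (auto simp: lower_def M)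
    qed
    then have 1: "vm (*) (A n i N - single (add_mset i N) 1) (A n j) \<in> FV (lower i M) UNIV"
      by (intro reg.vm_mem[OF IHN])
    have "A n k N \<in> FV (lower i M) UNIV" if "k \<in> I" for k
    proof (rule FV_mono[OF AnK])
      show "insert (add_mset k N) (lower k N) \<subseteq> lower i M"
        using that j by (auto simp: lower_def M)
    qed (simp add: N)
    then have 2: "vm (*) (\<gamma> i j) (\<lambda>k. A n k N) \<in> FV (lower i M) UNIV"
      using keys_gamma by (intro reg.vm_mem[where B = I]) (auto simp: FV_R_iff)
    have "A m i M = A (size M) i M" if m: "size M \<le> m" for m
    proof -
      obtain m' where "m = Suc m'" "n \<le> m'" using m n by (cases m) auto
      then show ?thesis using unf[of m'] unf[of n] by (simp only: n)
    qed
    moreover have "A (size M) i M - single (add_mset i M) 1 \<in> FV (lower i M) UNIV"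
      unfolding n unf[OF order_refl] using reg.FV_add[OF 1 2] by (simp add: algebra_simps)
    ultimately show ?thesis by blast
  qed
qed

section \<open>The operators on the symmetric algebra and their commutation relations\<close>

definition "a i M = A (size M) i M"
definition "X i z = vm (*) z (a i)"
definition "XV v z = vm (*) v (\<lambda>l. X l z)"

abbreviation "z M \<equiv> single M (1::complex)"

lemma X_z: "X i (z M) = a i M"
  by (simp add: X_def vm_single_one)

lemma X_add: "X i (x + y) = X i x + X i y"
  by (simp add: X_def vmU_add)

lemma X_diff: "X i (x - y) = X i x - X i y"
  by (simp add: X_def vmU_diff)

lemma X_rscale: "X i (rscale (*) r x) = rscale (*) r (X i x)"
  by (simp add: X_def vmU_rscale)

lemma XV_add: "XV (v + w) x = XV v x + XV w x"
  by (simp add: XV_def vmU_add)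

lemma XV_uminus: "XV (- v) x = - XV v x"
  by (simp add: XV_def vmU_uminus)

lemma XV_diff: "XV (v - w) x = XV v x - XV w x"
  by (simp add: XV_def vmU_diff)

lemma XV_zero [simp]: "XV 0 x = 0"
  by (simp add: XV_def)

lemma XV_add_right: "XV v (x + y) = XV v x + XV v y"
  by (simp add: XV_def X_add vmU_mat_add)

lemma XV_rscale: "XV v (rscale (*) r x) = rscale (*) r (XV v x)"
  by (simp add: XV_def X_rscale vm_mat_rscale)

lemma XV_rscale_left: "XV (rscale (*) r v) x = rscale (*) r (XV v x)"
  by (simp add: XV_def vmU_rscale)

lemma XV_single: "XV (single i 1) x = X i x"
  by (simp add: XV_def vm_single_one)

lemma a_leading: "a i M - z (add_mset i M) \<in> FV (lower i M) UNIV"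
  using conjunct2[OF A_leading[of M i]] by (simp add: a_def)

lemma a_least: "\<forall>j\<in>#M. i \<le> j \<Longrightarrow> a i M = z (add_mset i M)"
  unfolding a_def by (cases "size M") (auto simp: A.simps)

text \<open>The recursion of \<open>A\<close> freed from its bound. For j least it already is the
  commutation relation of x_i and x_j on the monomial N.\<close>

lemma a_swap:
  assumes ji: "j < i" and jN: "\<forall>k\<in>#N. j \<le> k"
  shows "a i (add_mset j N) = X j (a i N) + XV (\<gamma> i j) (z N)"
proof -
  define n where "n = size N"
  have not: "\<not> (\<forall>k\<in>#add_mset j N. i \<le> k)" using ji by auto
  have min: "Min_mset (add_mset j N) = j"
    using jN by (intro Min_eqI) auto
  have "a i (add_mset j N) = z (add_mset i (add_mset j N)) +
      vm (*) (A n i N - z (add_mset i N)) (A n j) + vm (*) (\<gamma> i j) (\<lambda>k. A n k N)"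
    unfolding a_def size_add_mset A.simps Let_def min n_def[symmetric] using not
    by (simp only: if_False add_mset_remove_trivial)
  moreover have "vm (*) (A n i N - z (add_mset i N)) (A n j) = vm (*) (a i N - z (add_mset i N)) (a j)"
  proof -
    have "A n j K = a j K" if "K \<in> lower i N" for K
      using that conjunct1[OF A_leading[of K j]] unfolding lower_def n_def a_def by blast
    then show ?thesis
      unfolding a_def[of i N] n_def[symmetric]
      using a_leading[of i N] unfolding a_def[of i N] n_def[symmetric] by (intro reg.vm_cong)
  qed
  moreover have "vm (*) (\<gamma> i j) (\<lambda>k. A n k N) = XV (\<gamma> i j) (z N)"
    by (simp add: XV_def X_z a_def n_def)
  moreover have "vm (*) (a i N - z (add_mset i N)) (a j) = X j (a i N) - z (add_mset j (add_mset i N))"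
    using jN ji by (simp add: vmU_diff vm_single_one X_def a_least)
  ultimately show ?thesis
    by (simp add: add_mset_commute)
qed

definition "comm i j y \<longleftrightarrow> X i (X j y) = X j (X i y) + XV (\<gamma> i j) y"

lemma gamma_self: "\<gamma> i i = 0"
proof (rule poly_mapping_eqI)
  fix k
  have "lookup (\<gamma> i i) k = - lookup (\<gamma> i i) k"
    using anti[of i i] by (metis lookup_uminus)
  then show "lookup (\<gamma> i i) k = lookup 0 k"
    by simp
qed

lemma comm_sym: "comm i j y \<Longrightarrow> comm j i y"
  unfolding comm_def anti[of j i] by (simp add: XV_uminus)

lemma comm_self: "comm i i y"
  by (simp add: comm_def gamma_self)

lemma comm_extend:
  assumes "\<And>K. K \<in> S \<Longrightarrow> comm i j (z K)" "y \<in> FV S UNIV"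
  shows "comm i j y"
  using assms(2)
proof (induction rule: reg.FV_induct)
  case zero
  show ?case by (simp add: comm_def X_def XV_def reg.vm_mat_zero[where B = UNIV])
next
  case (single K r)
  have "single K r = rscale (*) r (z K)"
    by (simp add: reg.rscale_single)
  moreover have "comm i j (rscale (*) r (z K))"
    using assms(1)[OF single(1)] by (simp add: comm_def X_rscale XV_rscale reg.rscale_add_right)
  ultimately show ?case by simp
next
  case (add x y)
  then show ?case by (simp add: comm_def X_add XV_add_right)
qed

text \<open>The relations with all basis vectors, assumed at y, extended linearly to v; the last
  vector holds the coordinates of the bracket of the i-th basis vector with v.\<close>

lemma X_XV:
  assumes "\<And>l. comm i l y"
  shows "X i (XV v y) = XV v (X i y) + XV (vm (*) v (\<gamma> i)) y"
proof -
  have "X i (XV v y) = vm (*) v (\<lambda>l. X i (X l y))"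
    by (simp add: X_def XV_def vmU_assoc)
  also have "\<dots> = vm (*) v (\<lambda>l. X l (X i y) + XV (\<gamma> i l) y)"
    using assms by (simp add: comm_def)
  also have "\<dots> = XV v (X i y) + XV (vm (*) v (\<gamma> i)) y"
    by (simp add: vmU_mat_add XV_def vmU_assoc)
  finally show ?thesis .
qed

lemma comm_least:
  assumes "j < i" "\<forall>k\<in>#M. j \<le> k"
  shows "comm i j (z M)"
  using a_swap[OF assms] assms by (simp add: comm_def X_z a_least)

text \<open>For j < i, either j is at most every index in M and the definition of the action gives
  the relation, or M = kL with k least and k < j < i; then both operators are moved past X k and the
  relation on L is used.\<close>

theorem comm_z: "comm i j (z M)"
proof (induction "size M" arbitrary: M i j rule: less_induct)
  case less
  \<comment> \<open>X i X j is carried past X k, using that the monomial kL is X k applied to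
    L.\<close>
  have step: "X i (X j (z (add_mset k L))) = X k (X i (X j (z L))) + XV (\<gamma> i k) (X j (z L)) +
      XV (\<gamma> j k) (X i (z L)) + XV (vm (*) (\<gamma> j k) (\<gamma> i)) (z L)"
    if M: "M = add_mset k L" and kL: "\<forall>l\<in>#L. k \<le> l" and ki: "k < i" and kj: "k < j" for i j k L
  proof -
    have IH: "comm p q (z K)" if "size K \<le> size L" for p q K
      using less[of K] that M by simp
    have kL': "X k (z L) = z (add_mset k L)"
      using kL by (simp add: X_z a_least)
    have "X j (z (add_mset k L)) = X k (X j (z L)) + XV (\<gamma> j k) (z L)"
      using IH[of L j k] kL' by (simp add: comm_def)
    then have 1: "X i (X j (z (add_mset k L))) = X i (X k (X j (z L))) + X i (XV (\<gamma> j k) (z L))"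
      by (simp add: X_add)
    \<comment> \<open>The monomial jL has the same size as M, so induction does not reach it; but k
      is least in it, and \<open>comm_least\<close> applies. Only the remainder of X j on L is left
      to induction.\<close>
    have "comm i k (z (add_mset j L))"
      using kL kj ki by (intro comm_least) auto
    moreover have "comm i k (X j (z L) - z (add_mset j L))"
      by (rule comm_extend[where S = "lower j L"]) (use a_leading IH in \<open>auto simp: lower_def X_z\<close>)
    ultimately have "comm i k (z (add_mset j L) + (X j (z L) - z (add_mset j L)))"
      by (simp only: comm_def X_add XV_add_right) (simp add: algebra_simps)
    then have 2: "X i (X k (X j (z L))) = X k (X i (X j (z L))) + XV (\<gamma> i k) (X j (z L))"
      by (simp add: comm_def)
    have 3: "X i (XV (\<gamma> j k) (z L)) = XV (\<gamma> j k) (X i (z L)) + XV (vm (*) (\<gamma> j k) (\<gamma> i)) (z L)"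
      by (rule X_XV) (rule IH, simp)
    show ?thesis unfolding 1 2 3 by (simp add: algebra_simps)
  qed
  have main: "comm i j (z M)" if ji: "j < i" for i j
  proof (cases "\<forall>k\<in>#M. j \<le> k")
    case True
    then show ?thesis using comm_least ji by blast
  next
    case False
    define k where "k = Min_mset M"
    define L where "L = M - {#k#}"
    have k: "k \<in># M" unfolding k_def using False by (intro Min_in) auto
    then have M: "M = add_mset k L" by (simp add: L_def)
    have kM: "k \<le> l" if "l \<in># M" for l
      using that unfolding k_def by simp
    then have kL: "\<forall>l\<in>#L. k \<le> l" using M by auto
    have kj: "k < j" using False kM by (meson le_less_trans not_le)
    with ji have ki: "k < i" by simp
    have IH: "comm p q (z L)" for p q
      using less[of L] M by simp
    have ij: "X i (X j (z L)) = X j (X i (z L)) + XV (\<gamma> i j) (z L)"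
      using IH[of i j] by (simp add: comm_def)
    have kz: "X k (z L) = z (add_mset k L)"
      using kL by (simp add: X_z a_least)
    have "X k (XV (\<gamma> i j) (z L)) = XV (\<gamma> i j) (X k (z L)) + XV (vm (*) (\<gamma> i j) (\<gamma> k)) (z L)"
      by (rule X_XV) (rule IH)
    then have k: "X k (X i (X j (z L))) = X k (X j (X i (z L))) + XV (\<gamma> i j) (z M) + XV (vm (*) (\<gamma> i j) (\<gamma> k)) (z L)"
      by (simp add: ij X_add kz M algebra_simps)
    \<comment> \<open>The terms quadratic in the structure constants cancel by the Jacobi identity;
      this is the one point of the construction where it enters.\<close>
    have "vm (*) (\<gamma> j k) (\<gamma> i) + vm (*) (\<gamma> i j) (\<gamma> k) - vm (*) (\<gamma> i k) (\<gamma> j) = 0"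
      using jac[of j k i] anti[of k i] by (simp add: vmU_uminus algebra_simps)
    then have "XV (vm (*) (\<gamma> j k) (\<gamma> i) + vm (*) (\<gamma> i j) (\<gamma> k) - vm (*) (\<gamma> i k) (\<gamma> j)) (z L) = 0"
      by (simp only: XV_zero)
    then have jz: "XV (vm (*) (\<gamma> j k) (\<gamma> i)) (z L) + XV (vm (*) (\<gamma> i j) (\<gamma> k)) (z L) = XV (vm (*) (\<gamma> i k) (\<gamma> j)) (z L)"
      by (simp add: XV_add XV_diff)
    have "X i (X j (z M)) = X k (X i (X j (z L))) + XV (\<gamma> i k) (X j (z L)) +
      XV (\<gamma> j k) (X i (z L)) + XV (vm (*) (\<gamma> j k) (\<gamma> i)) (z L)"
      using step[OF M kL ki kj] M by simp
    also have "\<dots> = (X k (X j (X i (z L))) + XV (\<gamma> j k) (X i (z L)) + XV (\<gamma> i k) (X j (z L)) +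
      (XV (vm (*) (\<gamma> j k) (\<gamma> i)) (z L) + XV (vm (*) (\<gamma> i j) (\<gamma> k)) (z L))) + XV (\<gamma> i j) (z M)"
      unfolding k by (simp add: algebra_simps)
    also have "\<dots> = X j (X i (z M)) + XV (\<gamma> i j) (z M)"
      unfolding jz using step[OF M kL kj ki] M by simp
    finally show ?thesis by (simp add: comm_def)
  qed
  show ?case
    using main[of i j] main[of j i] comm_sym comm_self by (cases i j rule: linorder_cases) auto
qed

lemma comm_all: "comm i j y"
  by (rule comm_extend[where S = UNIV]) (auto intro: comm_z)

lemma XV_bracket: "XV v (XV w y) - XV w (XV v y) = XV (vm (*) v (\<lambda>i. vm (*) w (\<gamma> i))) y"
proof -
  have "v \<in> FV UNIV UNIV" by simp
  then show ?thesis
  proof (induction rule: reg.FV_induct)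
    case zero
    show ?case by (simp add: XV_def X_def reg.vm_mat_zero[where B = UNIV])
  next
    case (single i r)
    have "XV (single i r) x = rscale (*) r (X i x)" for x
      using XV_rscale_left[of r "single i 1" x] by (simp add: reg.rscale_single XV_single)
    then show ?case
      by (simp add: X_XV[OF comm_all] reg.vm_single XV_rscale XV_rscale_left reg.rscale_add_right)
  next
    case (add v v')
    then show ?case by (simp add: XV_add XV_add_right vmU_add algebra_simps)
  qed
qed

text \<open>Index 0 is below all others, so X 0 is multiplication by a variable, which shifts
  coefficients without mixing them.\<close>

lemma X_least_inj:
  assumes "X 0 y = 0"
  shows "y = 0"
proof (rule poly_mapping_eqI)
  fix M
  have y: "y \<in> FV UNIV UNIV" by simp
  have "0 = lookup (X 0 y) (add_mset 0 M)" by (simp add: assms)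
  also have "\<dots> = (\<Sum>K\<in>keys y. if K = M then lookup y K else 0)"
    unfolding X_def reg.lookup_vm[OF y]
    by (intro sum.cong refl) (auto simp: a_least lookup_single when_def)
  also have "\<dots> = lookup y M"
    by (simp add: sum.delta in_keys_iff)
  finally show "lookup y M = lookup 0 M" by simp
qed

end

section \<open>From structure constants to a Lie algebra with a basis\<close>

lemma vector_space_scaleC: "vector_space (scaleC :: complex \<Rightarrow> 'g::complex_lie_algebra \<Rightarrow> 'g)"
  by standard (auto simp: scaleC_add_right scaleC_add_left scaleC_scaleC scaleC_one)

lemma scaleC_zero_left [simp]: "0 *\<^sub>C (x :: 'g::complex_lie_algebra) = 0"
  using scaleC_add_left[of 0 0 x] by simp

lemma scaleC_zero_right [simp]: "c *\<^sub>C (0 :: 'g::complex_lie_algebra) = 0"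
  using scaleC_add_right[of c 0 0] by simp

lemma bracket_zero_left [simp]: "bracket 0 (x :: 'g::complex_lie_algebra) = 0"
  using bracket_add_left[of 0 0 x] by simp

lemma bracket_zero_right [simp]: "bracket (x :: 'g::complex_lie_algebra) 0 = 0"
  using bracket_add_right[of x 0 0] by simp

lemma bracket_anti: "bracket y (x :: 'g::complex_lie_algebra) = - bracket x y"
proof -
  have "bracket x y + bracket y x = 0"
    using bracket_self[of "x + y"] unfolding bracket_add_left bracket_add_right
    by (simp add: bracket_self add.commute)
  then show ?thesis
    by (simp only: add_eq_0_iff)
qed

lemma gen_zero: "gen 0 = 0"
  using gen_add[of 0 0] by simp

text \<open>The basis is numbered by natural numbers because the construction above orders the
  letters of monomials by their indices; \<open>e\<close> is unconstrained outside
  \<open>I\<close>.\<close>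

locale lie_basis =
  fixes e :: "nat \<Rightarrow> 'g::complex_lie_algebra" and co :: "'g \<Rightarrow> nat \<Rightarrow>\<^sub>0 complex" and I :: "nat set"
  assumes co_add: "co (x + y) = co x + co y"
    and co_scale: "co (c *\<^sub>C x) = rscale (*) c (co x)"
    and keys_co: "keys (co x) \<subseteq> I"
    and co_e: "i \<in> I \<Longrightarrow> co (e i) = single i 1"
    and expand: "x = lext (\<lambda>i a. a *\<^sub>C e i) (co x)"
begin

definition "lv = lext (\<lambda>i a. a *\<^sub>C e i)"
definition "\<gamma> i j = co (bracket (e i) (e j))"

lemma lv_co: "lv (co x) = x"
  by (simp add: lv_def expand[symmetric])

lemma lv_add: "lv (v + w) = lv v + lv w"
  unfolding lv_def by (rule lext_add) (auto simp: scaleC_add_left)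

lemma lv_single: "lv (single i a) = a *\<^sub>C e i"
  unfolding lv_def by (rule lext_single) simp

lemma lv_zero [simp]: "lv 0 = 0"
  by (simp add: lv_def)

lemma co_zero [simp]: "co 0 = 0"
  using co_add[of 0 0] by simp

lemma co_uminus: "co (- x) = - co x"
  using co_add[of x "- x"] by (simp add: eq_neg_iff_add_eq_0 add.commute)

lemma vm_gamma: "vm (*) v (\<gamma> i) = co (bracket (e i) (lv v))"
proof -
  have "v \<in> FV UNIV UNIV" by simp
  then show ?thesis
    by (induction rule: reg.FV_induct)
      (auto simp: lv_single reg.vm_single bracket_scaleC_right co_scale \<gamma>_def vmU_add lv_add
        bracket_add_right co_add)
qed

lemma vm_vm_gamma: "vm (*) v (\<lambda>i. vm (*) w (\<gamma> i)) = co (bracket (lv v) (lv w))"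
proof -
  have "v \<in> FV UNIV UNIV" by simp
  then show ?thesis
    by (induction rule: reg.FV_induct)
      (auto simp: lv_single reg.vm_single bracket_scaleC_left co_scale vm_gamma vmU_add lv_add
        bracket_add_left co_add)
qed

end

sublocale lie_basis \<subseteq> structure_constants \<gamma> I
proof
  show "\<gamma> j i = - \<gamma> i j" for i j
    unfolding \<gamma>_def bracket_anti[of "e j" "e i"] by (rule co_uminus)
  show "keys (\<gamma> i j) \<subseteq> I" for i j
    unfolding \<gamma>_def by (rule keys_co)
  show "vm (*) (\<gamma> j k) (\<gamma> i) + vm (*) (\<gamma> k i) (\<gamma> j) + vm (*) (\<gamma> i j) (\<gamma> k) = 0" for i j k
    using jacobi[of "e i" "e j" "e k"]
    unfolding vm_gamma unfolding \<gamma>_def lv_co co_add[symmetric] by simp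
qed

context lie_basis
begin

definition sym_module :: "('g, nat multiset \<Rightarrow>\<^sub>0 complex) lie_mod" where
  "sym_module = \<lparr>carrier = UNIV, monoid.mult = undefined, monoid.one = undefined, ring.zero = 0,
     ring.add = (+), smult = rscale (*), lact = (\<lambda>x. XV (co x))\<rparr>"

lemma sym_abelian_group: "abelian_group sym_module"
proof (rule abelian_groupI)
  fix x :: "nat multiset \<Rightarrow>\<^sub>0 complex"
  show "\<exists>y\<in>carrier sym_module. y \<oplus>\<^bsub>sym_module\<^esub> x = \<zero>\<^bsub>sym_module\<^esub>"
    by (rule bexI[of _ "- x"]) (auto simp: sym_module_def)
qed (auto simp: sym_module_def algebra_simps)

lemma sym_lie_module: "lie_module sym_module"
proof -
  interpret abelian_group sym_module by (rule sym_abelian_group)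
  have inv: "\<ominus>\<^bsub>sym_module\<^esub> x = - x" for x
    using minus_equality[of "- x" x] by (simp add: sym_module_def)
  show ?thesis
  proof
    fix x y c d and m n :: "nat multiset \<Rightarrow>\<^sub>0 complex"
    show "c \<odot>\<^bsub>sym_module\<^esub> m \<in> carrier sym_module" "lact sym_module x m \<in> carrier sym_module"
      by (simp_all add: sym_module_def)
    show "(c + d) \<odot>\<^bsub>sym_module\<^esub> m = c \<odot>\<^bsub>sym_module\<^esub> m \<oplus>\<^bsub>sym_module\<^esub> d \<odot>\<^bsub>sym_module\<^esub> m"
      "c \<odot>\<^bsub>sym_module\<^esub> (m \<oplus>\<^bsub>sym_module\<^esub> n) = c \<odot>\<^bsub>sym_module\<^esub> m \<oplus>\<^bsub>sym_module\<^esub> c \<odot>\<^bsub>sym_module\<^esub> n"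
      "1 \<odot>\<^bsub>sym_module\<^esub> m = m" "(c * d) \<odot>\<^bsub>sym_module\<^esub> m = c \<odot>\<^bsub>sym_module\<^esub> (d \<odot>\<^bsub>sym_module\<^esub> m)"
      by (simp_all add: sym_module_def reg.rscale_add_left reg.rscale_add_right rscale_one reg.rscale_rscale)
    show "lact sym_module x (m \<oplus>\<^bsub>sym_module\<^esub> n) = lact sym_module x m \<oplus>\<^bsub>sym_module\<^esub> lact sym_module x n"
      "lact sym_module x (c \<odot>\<^bsub>sym_module\<^esub> m) = c \<odot>\<^bsub>sym_module\<^esub> lact sym_module x m"
      "lact sym_module (x + y) m = lact sym_module x m \<oplus>\<^bsub>sym_module\<^esub> lact sym_module y m"
      "lact sym_module (c *\<^sub>C x) m = c \<odot>\<^bsub>sym_module\<^esub> lact sym_module x m"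
      by (simp_all add: sym_module_def XV_add_right XV_rscale co_add XV_add co_scale XV_rscale_left)
    have "co (bracket x y) = vm (*) (co x) (\<lambda>i. vm (*) (co y) (\<gamma> i))"
      by (simp add: vm_vm_gamma lv_co)
    then show "lact sym_module (bracket x y) m =
      lact sym_module x (lact sym_module y m) \<ominus>\<^bsub>sym_module\<^esub> lact sym_module y (lact sym_module x m)"
      unfolding a_minus_def inv using XV_bracket[of "co x" "co y" m] by (simp add: sym_module_def)
  qed
qed

interpretation W: lie_module sym_module
  by (rule sym_lie_module)

text \<open>Multiplies the letters of a monomial in increasing order inside U. It will intertwine
  the action on polynomials with left multiplication and so recover u from u applied to 1.\<close>

definition \<theta> :: "(nat multiset \<Rightarrow>\<^sub>0 complex) \<Rightarrow> 'g uea" where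
  "\<theta> = lext (\<lambda>M a. sc a * prod_list (map (\<lambda>i. gen (e i)) (sorted_list_of_multiset M)))"

lemma theta_zero [simp]: "\<theta> 0 = 0"
  by (simp add: \<theta>_def)

lemma theta_add: "\<theta> (x + y) = \<theta> x + \<theta> y"
  unfolding \<theta>_def by (rule lext_add) (auto simp: sc_zero sc_add algebra_simps)

lemma theta_diff: "\<theta> (x - y) = \<theta> x - \<theta> y"
  using theta_add[of "x - y" y] by simp

lemma theta_single:
  "\<theta> (single M r) = sc r * prod_list (map (\<lambda>i. gen (e i)) (sorted_list_of_multiset M))"
  unfolding \<theta>_def by (rule lext_single) (simp add: sc_zero)

lemma theta_rscale: "\<theta> (rscale (*) r x) = sc r * \<theta> x"
proof -
  have "x \<in> FV UNIV UNIV" by simp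
  then show ?thesis
    by (induction rule: reg.FV_induct)
      (auto simp: reg.rscale_zero_right reg.rscale_single theta_single sc_mult mult.assoc
        reg.rscale_add_right theta_add distrib_left)
qed

lemma theta_z_least:
  assumes "\<forall>j\<in>#M. i \<le> j"
  shows "\<theta> (z (add_mset i M)) = gen (e i) * \<theta> (z M)"
proof -
  have "insort i (sorted_list_of_multiset M) = i # sorted_list_of_multiset M"
    using assms by (intro insort_is_Cons) auto
  then show ?thesis by (simp add: theta_single sc_one)
qed

text \<open>Outside \<open>I\<close> the vectors \<open>e i\<close> are not basis vectors, so the
  comparison with U is confined to monomials with indices in \<open>I\<close>.\<close>

definition "MI = {M. set_mset M \<subseteq> I}"

lemma theta_X_extend:
  assumes "\<And>M. M \<in> S \<Longrightarrow> \<theta> (X i (z M)) = gen (e i) * \<theta> (z M)" "y \<in> FV S UNIV"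
  shows "\<theta> (X i y) = gen (e i) * \<theta> y"
  using assms(2)
proof (induction rule: reg.FV_induct)
  case zero
  show ?case by (simp add: X_def)
next
  case (single K r)
  have K: "single K r = rscale (*) r (z K)"
    by (simp add: reg.rscale_single)
  have "sc r * (gen (e i) * \<theta> (z K)) = gen (e i) * (sc r * \<theta> (z K))"
    by (simp only: mult.assoc[symmetric] sc_central[of r "gen (e i)"])
  then show ?case
    unfolding K X_rscale theta_rscale using assms(1)[OF single(1)] by simp
next
  case (add x y)
  then show ?case by (simp add: X_add theta_add distrib_left)
qed

lemma theta_XV_extend:
  assumes "\<And>i. i \<in> I \<Longrightarrow> \<theta> (X i y) = gen (e i) * \<theta> y" "v \<in> FV I UNIV"
  shows "\<theta> (XV v y) = gen (lv v) * \<theta> y"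
  using assms(2)
proof (induction rule: reg.FV_induct)
  case zero
  show ?case by (simp add: gen_zero)
next
  case (single i r)
  have i: "single i r = rscale (*) r (single i 1)"
    by (simp add: reg.rscale_single)
  show ?case
    using assms(1)[OF single(1)]
    by (subst i) (simp add: XV_rscale_left theta_rscale XV_single lv_single gen_scale mult.assoc)
next
  case (add v w)
  then show ?case by (simp add: XV_add theta_add lv_add gen_add distrib_right)
qed

text \<open>Generators of U satisfy the same exchange rule that defines the action, so straightening
  a product in U and evaluating the recursion run in parallel.\<close>

lemma theta_X_z: "M \<in> MI \<Longrightarrow> i \<in> I \<Longrightarrow> \<theta> (X i (z M)) = gen (e i) * \<theta> (z M)"
proof (induction "size M" arbitrary: M i rule: less_induct)
  case less
  show ?case
  proof (cases "\<forall>j\<in>#M. i \<le> j")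
    case True
    then show ?thesis by (simp add: X_z a_least theta_z_least)
  next
    case False
    define j where "j = Min_mset M"
    define N where "N = M - {#j#}"
    have j: "j \<in># M" using False unfolding j_def by (intro Min_in) auto
    then have M: "M = add_mset j N" by (simp add: N_def)
    have jM: "j \<le> l" if "l \<in># M" for l
      using that unfolding j_def by simp
    then have jN: "\<forall>l\<in>#N. j \<le> l" using M by auto
    have ji: "j < i" using False jM by (meson le_less_trans not_le)
    have NI: "N \<in> MI" and jI: "j \<in> I" using less(2) M by (auto simp: MI_def)
    have IH: "\<theta> (X k (z K)) = gen (e k) * \<theta> (z K)" if "size K \<le> size N" "K \<in> MI" "k \<in> I" for k K
      using less(1)[of K k] that M by simp
    \<comment> \<open>x_j (x_i N) is split into the contribution of the leading monomial, on which j
      is least, and that of a remainder covered by induction.\<close>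
    have low: "\<theta> (X j (a i N - z (add_mset i N))) = gen (e j) * \<theta> (a i N - z (add_mset i N))"
    proof (rule theta_X_extend[OF _ a_leading])
      fix K assume "K \<in> lower i N"
      then show "\<theta> (X j (z K)) = gen (e j) * \<theta> (z K)"
        using NI less(3) jI by (intro IH) (auto simp: lower_def MI_def)
    qed
    have "\<theta> (X j (z (add_mset i N))) = gen (e j) * \<theta> (z (add_mset i N))"
      using jN ji by (simp add: X_z a_least theta_z_least)
    with low have "\<theta> (X j (a i N)) = gen (e j) * \<theta> (a i N)"
      by (simp add: X_diff theta_diff right_diff_distrib)
    also have "\<theta> (a i N) = gen (e i) * \<theta> (z N)"
      using IH[of N i] NI less(3) by (simp add: X_z)
    finally have 1: "\<theta> (X j (a i N)) = gen (e j) * (gen (e i) * \<theta> (z N))" .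
    have "\<theta> (XV (\<gamma> i j) (z N)) = gen (lv (\<gamma> i j)) * \<theta> (z N)"
      using IH NI keys_gamma by (intro theta_XV_extend) (auto simp: FV_R_iff)
    also have "gen (lv (\<gamma> i j)) = gen (e i) * gen (e j) - gen (e j) * gen (e i)"
      by (simp add: \<gamma>_def lv_co gen_bracket)
    finally have 2: "\<theta> (XV (\<gamma> i j) (z N)) = (gen (e i) * gen (e j) - gen (e j) * gen (e i)) * \<theta> (z N)" .
    have "\<theta> (X i (z M)) = gen (e i) * (gen (e j) * \<theta> (z N))"
      unfolding M X_z a_swap[OF ji jN] theta_add 1 2 by (simp add: algebra_simps)
    then show ?thesis
      unfolding M theta_z_least[OF jN] .
  qed
qed

lemma theta_XV: "y \<in> FV MI UNIV \<Longrightarrow> \<theta> (XV (co x) y) = gen x * \<theta> y"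
  using theta_XV_extend[of y "co x"] theta_X_extend[of MI _ y] theta_X_z keys_co[of x]
  by (simp add: lv_co FV_R_iff)

lemma XV_MI: "y \<in> FV MI UNIV \<Longrightarrow> XV (co x) y \<in> FV MI UNIV"
proof -
  assume y: "y \<in> FV MI UNIV"
  have "a i M \<in> FV MI UNIV" if "i \<in> I" "M \<in> MI" for i M
  proof -
    have "(a i M - z (add_mset i M)) + z (add_mset i M) \<in> FV MI UNIV"
      using that by (intro reg.FV_add FV_mono[OF a_leading] FV_single) (auto simp: lower_def MI_def)
    then show ?thesis by simp
  qed
  then have "X i y \<in> FV MI UNIV" if "i \<in> I" for i
    unfolding X_def using that y by (intro reg.vm_mem[where B = MI]) auto
  then show ?thesis
    unfolding XV_def using keys_co by (intro reg.vm_mem[where B = I]) (auto simp: FV_R_iff)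
qed

text \<open>At y = 1 this gives back u. Invariance of the span of \<open>MI\<close> is carried along
  because the case of a product applies the claim twice.\<close>

lemma theta_uact: "\<forall>y\<in>FV MI UNIV. W.uact u y \<in> FV MI UNIV \<and> \<theta> (W.uact u y) = u * \<theta> y"
proof (induction u rule: uea_induct)
  case (sc c)
  have "W.uact (sc c) y = rscale (*) c y" for y
    using W.uact_sc[of y c] by (simp add: sym_module_def)
  then show ?case by (simp add: theta_rscale reg.rscale_mem)
next
  case (gen x)
  have "W.uact (gen x) y = XV (co x) y" for y
    using W.uact_gen[of y x] by (simp add: sym_module_def)
  then show ?case by (simp add: theta_XV XV_MI)
next
  case (add u v)
  have "W.uact (u + v) y = W.uact u y + W.uact v y" for y
    using W.uact_add_left[of y u v] by (simp add: sym_module_def)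
  with add show ?case by (simp add: theta_add distrib_right reg.FV_add)
next
  case (mult u v)
  have "W.uact (u * v) y = W.uact u (W.uact v y)" for y
    using W.uact_mult[of y u v] by (simp add: sym_module_def)
  with mult show ?case by (simp add: mult.assoc)
qed

text \<open>X 0 annihilates u applied to 1, and it is injective; so u applied to 1 is 0, and
  \<theta> of it is u.\<close>

lemma least_regular:
  assumes 0: "0 \<in> I" and u: "gen (e 0) * u = 0"
  shows "u = 0"
proof -
  have one: "z {#} \<in> FV MI UNIV" by (rule FV_single) (auto simp: MI_def)
  have "X 0 (W.uact u (z {#})) = W.uact (gen (e 0) * u) (z {#})"
    using W.uact_mult[of "z {#}" "gen (e 0)" u] W.uact_gen[of "W.uact u (z {#})" "e 0"]
    by (simp add: sym_module_def co_e[OF 0] XV_single[of 0, simplified])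
  also have "\<dots> = 0"
    using W.uact_zero_left[of "z {#}"] by (simp add: u sym_module_def)
  finally have "W.uact u (z {#}) = 0" by (rule X_least_inj)
  then show ?thesis
    using theta_uact[of u] one theta_single[of "{#}" 1] by (auto simp: sc_one)
qed

end

theorem uea_left_regular:
  fixes c :: "'g::complex_lie_algebra"
  assumes fin: "finite S" "\<And>x :: 'g. x \<in> module.span scaleC S"
    and c: "c \<noteq> 0" and u: "gen c * u = 0"
  shows "u = 0"
proof -
  interpret vs: vector_space "scaleC :: complex \<Rightarrow> 'g \<Rightarrow> 'g" by (rule vector_space_scaleC)
  have ind: "vs.independent {c}" using c by simp
  define B where "B = vs.extend_basis {c}"
  have B: "vs.independent B" "vs.span B = UNIV" "c \<in> B"
    using vs.extend_basis_superset[OF ind] vs.independent_extend_basis[OF ind] vs.span_extend_basis[OF ind]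
    by (auto simp: B_def)
  have finB: "finite B"
    using vs.independent_span_bound[OF fin(1) B(1)] fin(2) by auto
  obtain xs where xs: "distinct xs" "set xs = B - {c}"
    using finite_distinct_list[of "B - {c}"] finB by auto
  \<comment> \<open>Putting c at the head of the list gives it the index 0, the least one.\<close>
  define ys where "ys = c # xs"
  have ys: "distinct ys" "set ys = B" using xs B(3) by (auto simp: ys_def)
  define e where "e i = ys ! i" for i
  define I where "I = {..<length ys}"
  have eI: "bij_betw e I B"
    unfolding e_def I_def using bij_betw_nth[OF ys(1)] ys(2) by auto
  have e0: "e 0 = c" "0 \<in> I" by (auto simp: e_def I_def ys_def)
  define co where "co x = Abs_poly_mapping (\<lambda>i. if i \<in> I then vs.representation B x (e i) else 0)" for x
  have "finite I" by (simp add: I_def)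
  have lookup_co: "lookup (co x) i = (if i \<in> I then vs.representation B x (e i) else 0)" for x i
    unfolding co_def by (subst lookup_Abs_poly_mapping) (auto intro: finite_subset[OF _ \<open>finite I\<close>])
  have keys_co_I: "keys (co x) \<subseteq> I" for x
    by (rule subsetI, rule ccontr) (simp add: in_keys_iff lookup_co)
  interpret lie_basis e co I
  proof
    show "co (x + y) = co x + co y" for x y
      by (rule poly_mapping_eqI) (simp add: lookup_co lookup_add vs.representation_add[OF B(1)] B(2))
    show "co (k *\<^sub>C x) = rscale (*) k (co x)" for k x
      by (rule poly_mapping_eqI) (simp add: lookup_co reg.lookup_rscale vs.representation_scale[OF B(1)] B(2))
    show "keys (co x) \<subseteq> I" for x
      by (rule keys_co_I)
    show "co (e i) = single i 1" if i: "i \<in> I" for i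
    proof (rule poly_mapping_eqI)
      fix j
      have "e i \<in> B" using eI i by (auto simp: bij_betw_def)
      moreover have "e j = e i \<longleftrightarrow> j = i" if "j \<in> I"
        using eI i that by (auto simp: bij_betw_def inj_on_def)
      ultimately show "lookup (co (e i)) j = lookup (single i 1) j"
        using i by (auto simp: lookup_co lookup_single when_def vs.representation_basis[OF B(1)])
    qed
    show "x = lext (\<lambda>i a. a *\<^sub>C e i) (co x)" for x
    proof -
      have "lext (\<lambda>i a. a *\<^sub>C e i) (co x) = (\<Sum>i\<in>I. lookup (co x) i *\<^sub>C e i)"
        by (rule lext_superset) (use \<open>finite I\<close> keys_co_I in simp_all)
      also have "\<dots> = (\<Sum>i\<in>I. vs.representation B x (e i) *\<^sub>C e i)"
        by (simp add: lookup_co)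
      also have "\<dots> = (\<Sum>b\<in>B. vs.representation B x b *\<^sub>C b)"
        by (rule sum.reindex_bij_betw[OF eI])
      also have "\<dots> = x"
        using vs.sum_representation_eq[OF B(1), of x B] finB B(2) by simp
      finally show ?thesis ..
    qed
  qed
  show ?thesis
    by (rule least_regular) (use e0 u in auto)
qed

section \<open>Resolutions over a quotient by a normal regular element\<close>

text \<open>Two copies of a free module are indexed by \<open>'b + 'b\<close>, so that the
  resolution built from them again consists of vectors over a single index type.\<close>

definition pairp :: "('b \<Rightarrow>\<^sub>0 'm::zero) \<Rightarrow> ('b \<Rightarrow>\<^sub>0 'm) \<Rightarrow> ('b + 'b \<Rightarrow>\<^sub>0 'm)" where
  "pairp x y = Abs_poly_mapping (case_sum (lookup x) (lookup y))"

definition fstp :: "('b + 'b \<Rightarrow>\<^sub>0 'm::zero) \<Rightarrow> ('b \<Rightarrow>\<^sub>0 'm)" where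
  "fstp z = Abs_poly_mapping (\<lambda>b. lookup z (Inl b))"

definition sndp :: "('b + 'b \<Rightarrow>\<^sub>0 'm::zero) \<Rightarrow> ('b \<Rightarrow>\<^sub>0 'm)" where
  "sndp z = Abs_poly_mapping (\<lambda>b. lookup z (Inr b))"

lemma lookup_pairp:
  "lookup (pairp x y) k = case_sum (lookup x) (lookup y) k"
proof -
  have "{k. case_sum (lookup x) (lookup y) k \<noteq> 0} \<subseteq>
      Inl ` keys x \<union> Inr ` keys y"
  proof
    fix k assume "k \<in> {k. case_sum (lookup x) (lookup y) k \<noteq> 0}"
    then show "k \<in> Inl ` keys x \<union> Inr ` keys y"
      by (cases k) (auto simp: in_keys_iff)
  qed
  then have "finite {k. case_sum (lookup x) (lookup y) k \<noteq> 0}"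
    by (rule finite_subset) simp
  then show ?thesis by (simp add: pairp_def)
qed

lemma lookup_fstp: "lookup (fstp z) b = lookup z (Inl b)"
proof -
  have "finite (Inl -` keys z)"
    by (rule finite_vimageI) auto
  then have "finite {b. lookup z (Inl b) \<noteq> 0}"
    by (simp add: vimage_def in_keys_iff)
  then show ?thesis by (simp add: fstp_def)
qed

lemma lookup_sndp: "lookup (sndp z) b = lookup z (Inr b)"
proof -
  have "finite (Inr -` keys z)"
    by (rule finite_vimageI) auto
  then have "finite {b. lookup z (Inr b) \<noteq> 0}"
    by (simp add: vimage_def in_keys_iff)
  then show ?thesis by (simp add: sndp_def)
qed

lemma pairp_fstp_sndp: "pairp (fstp z) (sndp z) = z"
  by (rule poly_mapping_eqI) (simp add: lookup_pairp lookup_fstp lookup_sndp split: sum.split)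

lemma fstp_pairp [simp]: "fstp (pairp x y) = x"
  by (rule poly_mapping_eqI) (simp add: lookup_pairp lookup_fstp)

lemma sndp_pairp [simp]: "sndp (pairp x y) = y"
  by (rule poly_mapping_eqI) (simp add: lookup_pairp lookup_sndp)

lemma pairp_eq_iff: "pairp x y = pairp x' y' \<longleftrightarrow> x = x' \<and> y = y'"
  by (metis fstp_pairp sndp_pairp)

lemma pairp_zero: "pairp 0 0 = 0"
  by (rule poly_mapping_eqI) (simp add: lookup_pairp split: sum.split)

lemma fstp_zero [simp]: "fstp 0 = 0"
  by (rule poly_mapping_eqI) (simp add: lookup_fstp)

lemma pairp_add: "pairp (x + x') (y + y') = pairp x y + pairp x' (y' :: _ \<Rightarrow>\<^sub>0 'm::monoid_add)"
  by (rule poly_mapping_eqI) (simp add: lookup_pairp lookup_add split: sum.split)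

lemma pairp_diff: "pairp (x - x') (y - y') = pairp x y - pairp x' (y' :: _ \<Rightarrow>\<^sub>0 'm::ab_group_add)"
  by (rule poly_mapping_eqI) (simp add: lookup_pairp lookup_minus split: sum.split)

lemma pairp_mem: "pairp x y \<in> FV UNIV M \<longleftrightarrow> x \<in> FV UNIV M \<and> y \<in> FV UNIV M"
  unfolding FV_def by (auto simp: lookup_pairp split: sum.split)

lemma sndp_zero: "z \<in> FV (range Inl) M \<Longrightarrow> sndp z = 0"
  by (rule poly_mapping_eqI) (auto simp: FV_def lookup_sndp in_keys_iff subset_iff)

lemma pairp_Inl_mem: "pairp x 0 \<in> FV (range Inl) M \<longleftrightarrow> x \<in> FV UNIV M" if "0 \<in> M"
proof -
  have "keys (pairp x 0) \<subseteq> range Inl"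
    by (auto simp: in_keys_iff lookup_pairp split: sum.splits)
  moreover have "pairp x 0 \<in> FV UNIV M \<longleftrightarrow> x \<in> FV UNIV M"
    using pairp_mem[of x 0 M] that by (auto simp: FV_zero)
  ultimately show ?thesis by (simp add: FV_def)
qed

context right_action
begin

lemma vm_pairp_single:
  assumes "m \<in> M"
  shows "pairp (single b m) 0 = single (Inl b) m"
    "pairp 0 (single b m) = single (Inr b) m"
  by (rule poly_mapping_eqI, auto simp: lookup_pairp lookup_single when_def split: sum.split)+

lemma vm_pairp:
  assumes x: "x \<in> FV UNIV M" and y: "y \<in> FV UNIV M"
  shows "vm act (pairp x y) H = vm act x (\<lambda>b. H (Inl b)) + vm act y (\<lambda>b. H (Inr b))"
proof -
  have 1: "vm act (pairp x 0) H = vm act x (\<lambda>b. H (Inl b))"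
    using x
  proof (induction rule: FV_induct)
    case (add x x')
    have "pairp x 0 \<in> FV UNIV M" "pairp x' 0 \<in> FV UNIV M"
      using add by (simp_all add: pairp_mem FV_zero zero_mem)
    then have "vm act (pairp x 0 + pairp x' 0) H = vm act (pairp x 0) H + vm act (pairp x' 0) H"
      by (rule vm_add)
    then show ?case
      using add pairp_add[of x x' 0 0] by (simp add: vm_add[OF add(1,2)])
  qed (auto simp: pairp_zero vm_pairp_single vm_single)
  have 2: "vm act (pairp 0 y) H = vm act y (\<lambda>b. H (Inr b))"
    using y
  proof (induction rule: FV_induct)
    case (add x x')
    have "pairp 0 x \<in> FV UNIV M" "pairp 0 x' \<in> FV UNIV M"
      using add by (simp_all add: pairp_mem FV_zero zero_mem)
    then have "vm act (pairp 0 x + pairp 0 x') H = vm act (pairp 0 x) H + vm act (pairp 0 x') H"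
      by (rule vm_add)
    then show ?case
      using add pairp_add[of 0 0 x x'] by (simp add: vm_add[OF add(1,2)])
  qed (auto simp: pairp_zero vm_pairp_single vm_single)
  have "pairp x 0 \<in> FV UNIV M" "pairp 0 y \<in> FV UNIV M"
    using x y by (simp_all add: pairp_mem FV_zero zero_mem)
  then have "vm act (pairp x 0 + pairp 0 y) H = vm act (pairp x 0) H + vm act (pairp 0 y) H"
    by (rule vm_add)
  then show ?thesis
    using pairp_add[of x 0 0 y] 1 2 by simp
qed

lemma vm_to_pairp:
  assumes x: "x \<in> FV UNIV M"
  shows "vm act x (\<lambda>b. pairp (P b) (Q b)) = pairp (vm act x P) (vm act x Q)"
  by (rule poly_mapping_eqI) (simp add: lookup_vm[OF x] lookup_pairp split: sum.split)

end

text \<open>\<open>'q\<close> is the quotient of \<open>'r\<close> by the left ideal generated by c;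
  \<open>normal\<close> makes this ideal two-sided, and \<open>regular\<close> makes division by c
  unique.\<close>

locale regular_quotient =
  fixes c :: "'r::ring_1" and \<sigma> :: "'r \<Rightarrow> 'r" and \<rho> :: "'r \<Rightarrow> 'q::ring_1"
  assumes rho_add: "\<rho> (u + v) = \<rho> u + \<rho> v" and rho_mult: "\<rho> (u * v) = \<rho> u * \<rho> v"
    and rho_surj: "surj \<rho>"
    and rho_kernel: "\<rho> u = 0 \<longleftrightarrow> (\<exists>v. u = v * c)"
    and regular: "u * c = 0 \<Longrightarrow> u = 0"
    and normal: "c * u = \<sigma> u * c"
begin

lemma rho_zero: "\<rho> 0 = 0"
  using rho_kernel[of 0] by (metis mult_zero_left)

lemma rho_c: "\<rho> c = 0"
  using rho_kernel[of c] by (metis mult_1)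

lemma sigma_zero: "\<sigma> 0 = 0"
  using normal[of 0] regular[of "\<sigma> 0"] by simp

definition "rm p = Poly_Mapping.map \<rho> p"
definition "sm p = Poly_Mapping.map \<sigma> p"
text \<open>Entrywise division by c from the right, meaningful on vectors that vanish in the
  quotient.\<close>

definition "cdiv p = Poly_Mapping.map (\<lambda>u. SOME v. u = v * c) p"
definition "lift p = Poly_Mapping.map (inv_into UNIV \<rho>) p"
definition "C b = single b c"

lemma lookup_rm: "lookup (rm p) b = \<rho> (lookup p b)"
  by (simp add: rm_def Poly_Mapping.map.rep_eq when_def rho_zero)

lemma lookup_sm: "lookup (sm p) b = \<sigma> (lookup p b)"
  by (simp add: sm_def Poly_Mapping.map.rep_eq when_def sigma_zero)

lemma rm_lift: "rm (lift p) = p"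
  by (rule poly_mapping_eqI)
    (simp add: lookup_rm lift_def Poly_Mapping.map.rep_eq when_def rho_zero surj_f_inv_f[OF rho_surj])

lemma rm_add: "rm (p + q) = rm p + rm q"
  by (rule poly_mapping_eqI) (simp add: lookup_rm lookup_add rho_add)

lemma rm_zero: "rm 0 = 0"
  by (rule poly_mapping_eqI) (simp add: lookup_rm rho_zero)

lemma rm_diff: "rm (p - q) = rm p - rm q"
  using rm_add[of "p - q" q] by simp

lemma rm_rscale: "rm (rscale (*) r p) = rscale (*) (\<rho> r) (rm p)"
  by (rule poly_mapping_eqI) (simp add: lookup_rm reg.lookup_rscale rho_mult)

lemma rm_single: "rm (single b r) = single b (\<rho> r)"
  by (rule poly_mapping_eqI) (simp add: lookup_rm lookup_single when_def rho_zero)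

lemma rm_vm: "rm (vm (*) x A) = vm (*) (rm x) (\<lambda>b. rm (A b))"
proof -
  have "x \<in> FV UNIV UNIV" by simp
  then show ?thesis
    by (induction rule: reg.FV_induct)
      (auto simp: rm_zero rm_single reg.vm_single rm_rscale vmU_add rm_add)
qed

lemma lookup_vm_C: "lookup (vm (*) x C) b = lookup x b * c"
proof -
  have "x \<in> FV UNIV UNIV" by simp
  then show ?thesis
    by (induction rule: reg.FV_induct)
      (auto simp: C_def reg.vm_single reg.rscale_single lookup_single when_def vmU_add lookup_add distrib_right)
qed

lemma vm_C_inj: "vm (*) x C = 0 \<Longrightarrow> x = 0"
  by (rule poly_mapping_eqI) (metis lookup_vm_C lookup_zero regular)

lemma vm_C_cancel: "vm (*) x C = vm (*) y C \<Longrightarrow> x = y"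
  using vm_C_inj[of "x - y"] by (simp add: vmU_diff)

lemma vm_C_cdiv:
  assumes "rm p = 0"
  shows "vm (*) (cdiv p) C = p"
proof (rule poly_mapping_eqI)
  fix b
  let ?u = "lookup p b"
  have "\<rho> ?u = 0" using assms lookup_rm[of p b] by simp
  then have "\<exists>v. ?u = v * c" using rho_kernel by simp
  from someI_ex[OF this] show "lookup (vm (*) (cdiv p) C) b = ?u"
    by (simp add: lookup_vm_C cdiv_def Poly_Mapping.map.rep_eq when_def)
qed

lemma rm_vm_C: "rm (vm (*) x C) = 0"
  by (rule poly_mapping_eqI) (simp add: lookup_rm lookup_vm_C rho_mult rho_c)

lemma rm_zero_obtain: "rm p = 0 \<Longrightarrow> \<exists>v. p = vm (*) v C"
  using vm_C_cdiv by metis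

lemma C_normal: "vm (*) (C b) L = vm (*) (sm (L b)) C"
  by (rule poly_mapping_eqI)
    (simp add: lookup_vm_C lookup_sm C_def reg.vm_single reg.lookup_rscale normal)

end

text \<open>With \<open>L\<close> a lift of the matrices \<open>D\<close> of a resolution over the quotient, \<open>L\<^sup>2\<close> is
  divisible by \<open>c\<close>; the quotient \<open>T\<close> is the homotopy that corrects the cone of multiplication
  by \<open>c\<close> to a complex \<open>G\<close>, which resolves the same module over \<open>'r\<close>.\<close>

locale regular_quotient_resolution = regular_quotient c \<sigma> \<rho> + F: based_resolution V "\<lambda>k. UNIV" D \<epsilon>
  + W: left_module W
  for c :: "'r::ring_1" and \<sigma> and \<rho> :: "'r \<Rightarrow> 'q::ring_1" and V :: "('q, 'v) module"
    and D :: "nat \<Rightarrow> 'b \<Rightarrow> 'b \<Rightarrow>\<^sub>0 'q" and \<epsilon> and W :: "('r, 'v) module" +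
  assumes W_carrier: "carrier W = carrier V" and W_zero: "\<zero>\<^bsub>W\<^esub> = \<zero>\<^bsub>V\<^esub>"
    and W_add: "v \<oplus>\<^bsub>W\<^esub> v' = v \<oplus>\<^bsub>V\<^esub> v'"
    and W_smult: "v \<in> carrier V \<Longrightarrow> r \<odot>\<^bsub>W\<^esub> v = \<rho> r \<odot>\<^bsub>V\<^esub> v"
begin

definition "L k b = lift (D k b)"
definition "S k b = sm (L k b)"
definition "T k b = cdiv (vm (*) (L (Suc k) b) (L k))"

lemma rm_L: "rm (L k b) = D k b"
  by (simp add: L_def rm_lift)

lemma rm_vm_L: "rm (vm (*) x (L k)) = vm (*) (rm x) (D k)"
  by (simp add: rm_vm rm_L)

lemma LL: "vm (*) (L (Suc k) b) (L k) = vm (*) (T k b) C"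
proof -
  have "vm (*) (D (Suc k) b) (D k) = 0"
    using F.D_cycle[of b "Suc k"] by simp
  then show ?thesis
    unfolding T_def by (intro vm_C_cdiv[symmetric]) (simp add: rm_vm_L rm_L)
qed

lemma CL: "vm (*) (C b) (L k) = vm (*) (S k b) C"
  unfolding S_def by (rule C_normal)

lemma LLx: "vm (*) (vm (*) x (L (Suc k))) (L k) = vm (*) (vm (*) x (T k)) C"
  by (simp add: vmU_assoc LL)

lemma CLx: "vm (*) (vm (*) x C) (L k) = vm (*) (vm (*) x (S k)) C"
  by (simp add: vmU_assoc CL)

text \<open>Multiplied by c on the right, both sides become the product of three consecutive
  lifts.\<close>

lemma TS: "vm (*) (T (Suc k) b) (S k) = vm (*) (L (Suc (Suc k)) b) (T k)"
  by (rule vm_C_cancel) (simp only: CLx[symmetric] LL[symmetric] LLx[symmetric])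

text \<open>Multiplied by c on the right, both sides become c L L.\<close>

lemma SS: "vm (*) (S (Suc k) b) (S k) = vm (*) (C b) (T k)"
  by (rule vm_C_cancel) (simp only: CLx[symmetric] LLx[symmetric] CL[symmetric])

text \<open>G in degree k is F in degree k plus F in degree k - 1, so in degree 0 only the left copy
  remains.\<close>

definition B :: "nat \<Rightarrow> ('b + 'b) set" where
  "B k = (if k = 0 then range Inl else UNIV)"

text \<open>\<open>G k\<close> leads from degree k + 1 to degree k, whose second summand is F in
  degree k - 1 and is absent for k = 0. Degrees in the second copy are one lower, hence the index j
  = k - 1 of \<open>T\<close> and \<open>S\<close>.\<close>

definition G :: "nat \<Rightarrow> 'b + 'b \<Rightarrow> ('b + 'b) \<Rightarrow>\<^sub>0 'r" where
  "G k = (\<lambda>b. case b of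
     Inl b \<Rightarrow> pairp (L k b) (case k of 0 \<Rightarrow> 0 | Suc j \<Rightarrow> - T j b)
   | Inr b \<Rightarrow> pairp (C b) (case k of 0 \<Rightarrow> 0 | Suc j \<Rightarrow> - S j b))"

lemma B_Suc [simp]: "B (Suc k) = UNIV" and B_0 [simp]: "B 0 = range Inl"
  by (simp_all add: B_def)

lemma vm_G_0:
  assumes N: "right_action M act" and x: "x \<in> FV UNIV M" and y: "y \<in> FV UNIV M"
  shows "vm act (pairp x y) (G 0) = pairp (vm act x (L 0) + vm act y C) 0"
proof -
  interpret N: right_action M act by (rule N)
  show ?thesis
    by (simp add: N.vm_pairp[OF x y] G_def N.vm_to_pairp[OF x] N.vm_to_pairp[OF y]
        N.vm_mat_zero[OF x] N.vm_mat_zero[OF y] pairp_add[symmetric])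
qed

lemma vm_G_Suc:
  assumes N: "right_action M act" and x: "x \<in> FV UNIV M" and y: "y \<in> FV UNIV M"
  shows "vm act (pairp x y) (G (Suc k)) =
    pairp (vm act x (L (Suc k)) + vm act y C) (- vm act x (T k) - vm act y (S k))"
proof -
  interpret N: right_action M act by (rule N)
  show ?thesis
    by (simp add: N.vm_pairp[OF x y] G_def N.vm_to_pairp[OF x] N.vm_to_pairp[OF y]
        N.vm_mat_uminus[OF x] N.vm_mat_uminus[OF y] pairp_add[symmetric])
qed

lemma vm_G_fst:
  assumes N: "right_action M act" and x: "x \<in> FV UNIV M" and y: "y \<in> FV UNIV M"
  shows "fstp (vm act (pairp x y) (G k)) = vm act x (L k) + vm act y C"
  by (cases k) (simp_all add: vm_G_0[OF assms] vm_G_Suc[OF assms])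

lemmas rvm_G_0 = vm_G_0[OF right_action_regular, simplified]
lemmas rvm_G_Suc = vm_G_Suc[OF right_action_regular, simplified]

text \<open>The first component cancels by L L = T C and C L = S C, the second by T S = L T and S S
  = C T.\<close>

lemma GG: "vm (*) (vm (*) (pairp x y) (G (Suc k))) (G k) = 0"
proof (cases k)
  case 0
  show ?thesis
    by (simp add: 0 rvm_G_0 rvm_G_Suc vmU_add vmU_diff vmU_uminus LLx CLx pairp_zero)
next
  case (Suc j)
  have "vm (*) (vm (*) x (T (Suc j))) (S j) = vm (*) (vm (*) x (L (Suc (Suc j)))) (T j)"
    "vm (*) (vm (*) y (S (Suc j))) (S j) = vm (*) (vm (*) y C) (T j)"
    by (simp_all add: vmU_assoc TS SS)
  then show ?thesis
    by (simp add: Suc rvm_G_Suc vmU_add vmU_diff vmU_uminus LLx CLx pairp_zero)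
qed

lemma GG': "vm (*) (vm (*) w (G (Suc k))) (G k) = 0"
  using GG[of "fstp w" "sndp w"] by (simp add: pairp_fstp_sndp)

definition "\<epsilon>G z = \<epsilon> (rm (fstp z))"

text \<open>Exactness: modulo c the first component of a cycle is a cycle over the quotient, so a
  boundary of G can be subtracted to make it vanish; what remains in the second component is
  annihilated by c, hence zero.\<close>

lemma based_G: "based_resolution W B G \<epsilon>G"
proof (intro based_resolution.intro based_resolution_axioms.intro W.left_module_axioms)
  have fstp_add: "fstp (x + y) = fstp x + fstp y" for x y :: "('b + 'b) \<Rightarrow>\<^sub>0 'r"
    by (rule poly_mapping_eqI) (simp add: lookup_fstp lookup_add)
  have fstp_rscale: "fstp (rscale (*) r x) = rscale (*) r (fstp x)" for r and x :: "('b + 'b) \<Rightarrow>\<^sub>0 'r"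
    by (rule poly_mapping_eqI) (simp add: lookup_fstp reg.lookup_rscale)
  show "\<epsilon>G x \<in> carrier W" for x
    by (simp add: \<epsilon>G_def W_carrier F.eps_closed)
  show "\<epsilon>G (x + y) = \<epsilon>G x \<oplus>\<^bsub>W\<^esub> \<epsilon>G y" for x y
    by (simp add: \<epsilon>G_def W_add fstp_add rm_add F.eps_add)
  show "\<epsilon>G (rscale (*) r x) = r \<odot>\<^bsub>W\<^esub> \<epsilon>G x" for r x
    by (simp add: \<epsilon>G_def fstp_rscale rm_rscale F.eps_rscale W_smult F.eps_closed)
  show "\<exists>x\<in>FV (B 0) UNIV. \<epsilon>G x = v" if v: "v \<in> carrier W" for v
  proof -
    obtain x where "\<epsilon> x = v" using F.eps_surj v W_carrier by auto
    then show ?thesis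
      by (intro bexI[of _ "pairp (lift x) 0"]) (simp_all add: \<epsilon>G_def rm_lift pairp_Inl_mem)
  qed
  show "G k b \<in> FV (B k) UNIV" if "b \<in> B (Suc k)" for k b
    by (cases k) (auto simp: G_def pairp_Inl_mem split: sum.split)
  have cyc: "rcycle W G \<epsilon>G k (vm (*) w (G k))" for k w
  proof (cases k)
    case 0
    have "rcycle V D \<epsilon> 0 (vm (*) (rm (fstp w)) (D 0))"
      by (rule F.vm_D_cycle) simp
    moreover have "fstp (vm (*) w (G 0)) = vm (*) (fstp w) (L 0) + vm (*) (sndp w) C"
      using rvm_G_0[of "fstp w" "sndp w"] by (simp add: pairp_fstp_sndp)
    ultimately show ?thesis
      by (simp add: 0 \<epsilon>G_def rm_add rm_vm_L rm_vm_C W_zero)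
  qed (simp add: GG')
  show "rcycle W G \<epsilon>G k z \<longleftrightarrow> (\<exists>w\<in>FV (B (Suc k)) UNIV. z = vm (*) w (G k))"
    if z: "z \<in> FV (B k) UNIV" for k z
  proof
    assume cz: "rcycle W G \<epsilon>G k z"
    define x where "x = fstp z"
    define y where "y = sndp z"
    have zxy: "z = pairp x y" by (simp add: x_def y_def pairp_fstp_sndp)
    have "rcycle V D \<epsilon> k (rm x)"
    proof (cases k)
      case 0
      then show ?thesis using cz by (simp add: \<epsilon>G_def x_def W_zero)
    next
      case (Suc j)
      then have "vm (*) x (L j) + vm (*) y C = 0"
        using vm_G_fst[OF right_action_regular, of x y j] cz by (simp add: zxy)
      then have "rm (vm (*) x (L j) + vm (*) y C) = 0"
        by (simp add: rm_zero)
      then show ?thesis by (simp add: Suc rm_add rm_vm_L rm_vm_C)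
    qed
    then obtain w where w: "rm x = vm (*) w (D k)"
      using F.rcycle_obtain[of "rm x" k] by auto
    have "rm (x - vm (*) (lift w) (L k)) = 0"
      by (simp add: rm_diff rm_vm_L rm_lift w)
    then obtain v where "x - vm (*) (lift w) (L k) = vm (*) v C"
      using rm_zero_obtain by blast
    then have x: "x = vm (*) (lift w) (L k) + vm (*) v C"
      by (simp add: algebra_simps)
    \<comment> \<open>w fills the first component over the quotient and v absorbs the multiple of c
      left over, so the boundary of this pair has the right first component by construction.\<close>
    have "z = vm (*) (pairp (lift w) v) (G k)"
    proof (cases k)
      case 0
      then have "y = 0" using z sndp_zero unfolding y_def by auto
      then show ?thesis by (simp add: zxy x 0 rvm_G_0)
    next
      case (Suc j)
      define z' where "z' = z - vm (*) (pairp (lift w) v) (G k)"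
      have "fstp z' = 0"
        unfolding z'_def by (rule poly_mapping_eqI)
          (simp add: lookup_fstp lookup_minus zxy x Suc rvm_G_Suc lookup_pairp)
      then have z': "z' = pairp 0 (sndp z')"
        using pairp_fstp_sndp[of z'] by simp
      have "vm (*) z' (G j) = 0"
        using cz by (simp add: z'_def vmU_diff Suc GG)
      then have "fstp (vm (*) (pairp 0 (sndp z')) (G j)) = 0"
        using z' by simp
      then have "vm (*) (sndp z') C = 0"
        using vm_G_fst[OF right_action_regular, of 0 "sndp z'" j] by simp
      then have "z' = 0" using vm_C_inj z' pairp_zero by metis
      then show ?thesis by (simp add: z'_def)
    qed
    then show "\<exists>w\<in>FV (B (Suc k)) UNIV. z = vm (*) w (G k)"
      by auto
  qed (use cyc in auto)
qed

section \<open>Tensoring the resolution G with a module\<close>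

context
  fixes M :: "'m::ab_group_add set" and act :: "'m \<Rightarrow> 'r \<Rightarrow> 'm"
  assumes N: "right_action M act"
begin

interpretation N: right_action M act by (rule N)

lemma zero_FV: "0 \<in> FV X M"
  by (simp add: FV_zero N.zero_mem)

lemma vm_FV: "x \<in> FV UNIV M \<Longrightarrow> vm act x P \<in> FV UNIV M"
  by (rule N.vm_mem_UNIV)

lemma pair_cases:
  assumes "z \<in> FV (B k) M"
  obtains x y where "z = pairp x y" "x \<in> FV UNIV M" "y \<in> FV UNIV M" "k = 0 \<longrightarrow> y = 0"
proof -
  have "z \<in> FV UNIV M" using assms by (rule FV_mono) simp
  then have "pairp (fstp z) (sndp z) \<in> FV UNIV M" by (simp add: pairp_fstp_sndp)
  then have "fstp z \<in> FV UNIV M" "sndp z \<in> FV UNIV M" unfolding pairp_mem by auto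
  moreover have "k = 0 \<longrightarrow> sndp z = 0"
    using assms sndp_zero[of z M] by auto
  ultimately show ?thesis
    using that[of "fstp z" "sndp z"] by (simp add: pairp_fstp_sndp)
qed

lemma vm_C: "x \<in> FV UNIV M \<Longrightarrow> lookup (vm act x C) b = act (lookup x b) c"
proof (induction rule: N.FV_induct)
  case zero
  then show ?case by (simp add: N.act_zero_left)
next
  case (single a m)
  then show ?case
    by (simp add: C_def N.vm_single N.rscale_single lookup_single when_def N.act_zero_left)
next
  case (add x y)
  then show ?case
    by (simp add: N.vm_add[OF add(1,2)] lookup_add N.act_add_left FV_lookup)
qed

lemma nCL: "x \<in> FV UNIV M \<Longrightarrow> vm act (vm act x C) (L k) = vm act (vm act x (S k)) C"
  by (simp add: N.vm_assoc CL)

lemma nTS: "x \<in> FV UNIV M \<Longrightarrow>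
    vm act (vm act x (T (Suc k))) (S k) = vm act (vm act x (L (Suc (Suc k)))) (T k)"
  by (simp add: N.vm_assoc TS)

lemma nGG: "z \<in> FV UNIV M \<Longrightarrow> vm act (vm act z (G (Suc k))) (G k) = 0"
proof -
  assume z: "z \<in> FV UNIV M"
  have "vm (*) (G (Suc k) b) (G k) = 0" for b
    using GG'[of "single b 1" k] by (simp add: vm_single_one)
  then show ?thesis
    by (simp add: N.vm_assoc[OF z] N.vm_mat_zero[OF z])
qed

text \<open>Division by c contracts the complex: a cycle (x, y) is the boundary of (0, x /
  c).\<close>

lemma exact_of_invertible:
  assumes bij: "bij_betw (\<lambda>m. act m c) M M"
  shows "exact_at M act B G k"
  unfolding exact_at_def
proof (intro ballI impI)
  fix z assume zM: "z \<in> FV (B k) M" and cyc: "\<forall>j. k = Suc j \<longrightarrow> vm act z (G j) = 0"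
  from zM obtain x y where z: "z = pairp x y" and x: "x \<in> FV UNIV M" and y: "y \<in> FV UNIV M"
    and y0: "k = 0 \<longrightarrow> y = 0"
    by (rule pair_cases)
  have inj: "v = w" if "vm act v C = vm act w C" "v \<in> FV UNIV M" "w \<in> FV UNIV M" for v w
  proof (rule poly_mapping_eqI)
    fix b show "lookup v b = lookup w b"
      using that vm_C[of v b] vm_C[of w b] bij
      by (auto simp: bij_betw_def inj_on_def FV_lookup)
  qed
  define i where "i m = inv_into M (\<lambda>m. act m c) m" for m
  have i: "i m \<in> M" "act (i m) c = m" if "m \<in> M" for m
    using that bij inv_into_into[of m "\<lambda>m. act m c" M] f_inv_into_f[of m "\<lambda>m. act m c" M]
    by (auto simp: i_def bij_betw_def)
  define v where "v = Poly_Mapping.map i x"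
  have lv: "lookup v b = (if lookup x b = 0 then 0 else i (lookup x b))" for b
    by (simp add: v_def Poly_Mapping.map.rep_eq when_def)
  have v: "v \<in> FV UNIV M"
    using FV_lookup[OF x] i(1) by (simp add: FV_def lv N.zero_mem)
  have vC: "vm act v C = x"
    by (rule poly_mapping_eqI) (use FV_lookup[OF x] i(2) in \<open>simp add: vm_C[OF v] lv N.act_zero_left\<close>)
  have "z = vm act (pairp 0 v) (G k)"
  proof (cases k)
    case 0
    then show ?thesis using y0 by (simp add: z vm_G_0[OF N zero_FV v] vC)
  next
    case (Suc j)
    \<comment> \<open>The first component of the cycle condition determines y from x, because c acts
      injectively.\<close>
    have "fstp (vm act z (G j)) = 0" using cyc Suc by simp
    then have "vm act x (L j) + vm act y C = 0"
      by (simp add: z vm_G_fst[OF N x y])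
    moreover have "vm act (vm act v (S j)) C = vm act x (L j)"
      using nCL[OF v, of j] by (simp add: vC)
    ultimately have "vm act y C = vm act (- vm act v (S j)) C"
      using N.vm_uminus[OF vm_FV[OF v, of "S j"], of C] by (simp add: add_eq_0_iff)
    then have "y = - vm act v (S j)"
      by (rule inj[OF _ y N.FV_uminus[OF vm_FV[OF v]]])
    then show ?thesis by (simp add: z Suc vm_G_Suc[OF N zero_FV v] vC)
  qed
  then show "\<exists>w\<in>FV (B (Suc k)) M. z = vm act w (G k)"
    using v zero_FV by (intro bexI[of _ "pairp 0 v"]) (auto simp: pairp_mem)
qed

section \<open>Modules on which c acts as zero, with their two actions of the quotient\<close>

context
  fixes act1 act2 :: "'m \<Rightarrow> 'q \<Rightarrow> 'm"
  assumes N1: "right_action M act1" and N2: "right_action M act2"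
    and act1: "m \<in> M \<Longrightarrow> act m u = act1 m (\<rho> u)"
    and act2: "m \<in> M \<Longrightarrow> act m (\<sigma> u) = act2 m (\<rho> u)"
begin

interpretation N1: right_action M act1 by (rule N1)
interpretation N2: right_action M act2 by (rule N2)

lemma vm_L: "x \<in> FV UNIV M \<Longrightarrow> vm act x (L k) = vm act1 x (D k)"
  by (rule poly_mapping_eqI)
    (simp add: N.lookup_vm N1.lookup_vm act1 FV_lookup lookup_rm[symmetric] rm_L)

lemma vm_S: "x \<in> FV UNIV M \<Longrightarrow> vm act x (S k) = vm act2 x (D k)"
  by (rule poly_mapping_eqI)
    (simp add: N.lookup_vm N2.lookup_vm S_def lookup_sm act2 FV_lookup lookup_rm[symmetric] rm_L)

lemma vm_C_zero: "x \<in> FV UNIV M \<Longrightarrow> vm act x C = 0"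
  by (rule poly_mapping_eqI) (simp add: vm_C act1 FV_lookup rho_c N1.act_zero_right)

text \<open>The exact sequence of complexes by hand: as c acts by 0, the first component is filled
  using \<open>act1\<close>, and the remaining element (0, y') is filled in the shifted copy using
  \<open>act2\<close>.\<close>

lemma exact_of_exact_quotient:
  assumes ex1: "\<And>k. exact_at M act1 (\<lambda>k. UNIV) D k" and ex2: "\<And>k. exact_at M act2 (\<lambda>k. UNIV) D k"
  shows "exact_at M act B G k"
  unfolding exact_at_def
proof (intro ballI impI)
  fix z assume zM: "z \<in> FV (B k) M" and cyc: "\<forall>j. k = Suc j \<longrightarrow> vm act z (G j) = 0"
  from zM obtain x y where z: "z = pairp x y" and x: "x \<in> FV UNIV M" and y: "y \<in> FV UNIV M"
    and y0: "k = 0 \<longrightarrow> y = 0"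
    by (rule pair_cases)
  have "vm act1 x (D j) = 0" if "k = Suc j" for j
  proof -
    have "fstp (vm act z (G j)) = 0" using cyc that by simp
    then show ?thesis
      by (simp add: z vm_G_fst[OF N x y] vm_C_zero[OF y] vm_L[OF x])
  qed
  then obtain w where w: "w \<in> FV UNIV M" "x = vm act1 w (D k)"
    using ex1[of k] x unfolding exact_at_def by blast
  show "\<exists>w\<in>FV (B (Suc k)) M. z = vm act w (G k)"
  proof (cases k)
    case 0
    then have "z = vm act (pairp w 0) (G k)"
      using y0 w by (simp add: z vm_G_0[OF N w(1) zero_FV] vm_L)
    then show ?thesis
      using w zero_FV by (intro bexI[of _ "pairp w 0"]) (auto simp: pairp_mem)
  next
    case (Suc j)
    \<comment> \<open>The second component after subtracting the boundary of (w, 0).\<close>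
    define y' where "y' = y + vm act w (T j)"
    have y': "y' \<in> FV UNIV M" using y w by (auto simp: y'_def intro!: N.FV_add vm_FV)
    have z': "z - vm act (pairp w 0) (G k) = pairp 0 y'"
      unfolding z Suc vm_G_Suc[OF N w(1) zero_FV] pairp_diff[symmetric]
      using w by (simp add: y'_def Suc vm_L)
    have pw: "pairp w 0 \<in> FV UNIV M" "pairp x y \<in> FV UNIV M"
      using w x y by (simp_all add: pairp_mem zero_FV)
    have "vm act (pairp 0 y') (G j) = 0"
      unfolding z'[symmetric] using cyc nGG[OF pw(1), of j]
      by (simp add: z Suc N.vm_diff[OF pw(2) vm_FV[OF pw(1)]])
    then have "vm act2 y' (D i) = 0" if "j = Suc i" for i
      using that vm_G_Suc[OF N zero_FV y', of i] y'
      by (simp add: vm_S pairp_zero[symmetric] pairp_eq_iff)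
    then obtain v where v: "v \<in> FV UNIV M" "y' = vm act2 v (D j)"
      using ex2[of j] y' unfolding exact_at_def by blast
    \<comment> \<open>The minus sign offsets the sign of \<open>S\<close> in
      \<open>G\<close>.\<close>
    have "pairp 0 y' = vm act (pairp 0 (- v)) (G k)"
      using v N.FV_uminus[OF v(1)] unfolding Suc vm_G_Suc[OF N zero_FV N.FV_uminus[OF v(1)]]
      by (simp add: vm_C_zero vm_S N2.vm_uminus[OF v(1)])
    then have "z = vm act (pairp w 0) (G k) + vm act (pairp 0 (- v)) (G k)"
      using z' by (simp add: algebra_simps)
    moreover have pv: "pairp 0 (- v) \<in> FV UNIV M"
      using v by (simp add: pairp_mem zero_FV N.FV_uminus)
    ultimately have "z = vm act (pairp w 0 + pairp 0 (- v)) (G k)"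
      by (simp add: N.vm_add[OF pw(1) pv])
    then show ?thesis
      using N.FV_add[OF pw(1) pv] by auto
  qed
qed

text \<open>A cycle x in degree k is completed to a cycle (x, y) over G. The obstruction is the
  class of xT in degree k - 2, which vanishes by induction; filling (x, y) in G then fills
  x.\<close>

lemma exact_quotient_of_exact:
  assumes same: "\<And>m u. m \<in> M \<Longrightarrow> act2 m u = act1 m u"
    and ex: "\<And>k. exact_at M act B G k"
  shows "exact_at M act1 (\<lambda>k. UNIV) D k"
proof (induction k rule: less_induct)
  case (less k)
  have S_eq_L: "vm act x (S k) = vm act1 x (D k)" if "x \<in> FV UNIV M" for x k
    using that by (intro poly_mapping_eqI) (simp add: vm_S N1.lookup_vm N2.lookup_vm same FV_lookup)
  show ?case
    unfolding exact_at_def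
  proof (intro ballI impI)
    fix x assume x: "x \<in> FV UNIV M" and cyc: "\<forall>j. k = Suc j \<longrightarrow> vm act1 x (D j) = 0"
    \<comment> \<open>In degrees 0 and 1 there is no obstruction and y = 0 works.\<close>
    have "\<exists>y. y \<in> FV UNIV M \<and> pairp x y \<in> FV (B k) M \<and> (\<forall>j. k = Suc j \<longrightarrow> vm act (pairp x y) (G j) = 0)"
    proof (cases k)
      case 0
      then show ?thesis using x zero_FV by (intro exI[of _ 0]) (auto simp: pairp_Inl_mem N.zero_mem)
    next
      case (Suc j)
      show ?thesis
      proof (cases j)
        case 0
        then show ?thesis using Suc x zero_FV cyc
          by (intro exI[of _ 0]) (auto simp: pairp_mem vm_G_0[OF N x zero_FV] vm_L pairp_zero)
      next
        case j: (Suc i)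
        have u: "vm act x (T i) \<in> FV UNIV M" by (rule vm_FV[OF x])
        \<comment> \<open>xT is a cycle because T S = L T and, the two actions being equal, S acts
          like D.\<close>
        have "vm act1 (vm act x (T i)) (D h) = 0" if "i = Suc h" for h
        proof -
          have "vm act (vm act x (T (Suc h))) (S h) = vm act (vm act x (L (Suc (Suc h)))) (T h)"
            by (rule nTS[OF x])
          also have "vm act x (L (Suc (Suc h))) = 0"
            using cyc Suc j that by (simp add: vm_L[OF x])
          finally show ?thesis using S_eq_L[OF u] that by simp
        qed
        moreover have "exact_at M act1 (\<lambda>k. UNIV) D i"
          using Suc j by (intro less) simp
        ultimately obtain y where y: "y \<in> FV UNIV M" "vm act x (T i) = vm act1 y (D i)"
          using u unfolding exact_at_def by blast
        note my = N.FV_uminus[OF y(1)]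
        have "vm act (pairp x (- y)) (G j) = 0"
          using cyc Suc y unfolding j vm_G_Suc[OF N x my]
          by (simp add: j vm_L[OF x] vm_C_zero[OF my] S_eq_L[OF my] N1.vm_uminus[OF y(1)] pairp_zero)
        then show ?thesis
          using Suc x my by (intro exI[of _ "- y"]) (simp add: pairp_mem)
      qed
    qed
    then obtain y where y: "y \<in> FV UNIV M" "pairp x y \<in> FV (B k) M"
      "\<forall>j. k = Suc j \<longrightarrow> vm act (pairp x y) (G j) = 0" by blast
    then obtain w where w: "w \<in> FV (B (Suc k)) M" "pairp x y = vm act w (G k)"
      using ex[of k] unfolding exact_at_def by blast
    from w(1) obtain u v where uv: "w = pairp u v" "u \<in> FV UNIV M" "v \<in> FV UNIV M"
      by (rule pair_cases)
    have "fstp (pairp x y) = vm act u (L k) + vm act v C"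
      unfolding w(2) uv(1) by (rule vm_G_fst[OF N uv(2,3)])
    then have "x = vm act1 u (D k)"
      by (simp add: vm_C_zero[OF uv(3)] vm_L[OF uv(2)])
    then show "\<exists>w\<in>FV UNIV M. x = vm act1 w (D k)"
      using uv(2) by blast
  qed
qed

end

end

end

section \<open>Modules over Lie algebras and their duals\<close>

abbreviation dual_module :: "('g::complex_lie_algebra, 's) lie_mod \<Rightarrow> ('g uea, 's \<Rightarrow> complex) module" where
  "dual_module S \<equiv> uea_right_module (lie_dual S)"

text \<open>Elements of \<open>lie_dual\<close> are \<open>undefined\<close> off the carrier, which
  pointwise addition does not preserve; extended by 0 they form an additive subgroup of the function
  type.\<close>

definition dual_embed :: "('g, 's) lie_mod \<Rightarrow> ('s \<Rightarrow> complex) \<Rightarrow> 's \<Rightarrow> complex" where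
  "dual_embed S f = (\<lambda>s. if s \<in> carrier S then f s else 0)"

context lie_module
begin

lemma dual_carrier_iff: "f \<in> carrier (lie_dual M) \<longleftrightarrow> f \<in> extensional (carrier M) \<and>
    (\<forall>s\<in>carrier M. \<forall>t\<in>carrier M. f (s \<oplus> t) = f s + f t) \<and> (\<forall>c. \<forall>s\<in>carrier M. f (c \<odot> s) = c * f s)"
  by (simp add: lie_dual_def)

lemma dual_add: "f \<in> carrier (lie_dual M) \<Longrightarrow> s \<in> carrier M \<Longrightarrow> t \<in> carrier M \<Longrightarrow> f (s \<oplus> t) = f s + f t"
  by (simp add: dual_carrier_iff)

lemma dual_smult: "f \<in> carrier (lie_dual M) \<Longrightarrow> s \<in> carrier M \<Longrightarrow> f (c \<odot> s) = c * f s"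
  by (simp add: dual_carrier_iff)

lemma dual_zero: "f \<in> carrier (lie_dual M) \<Longrightarrow> f \<zero> = 0"
  using dual_add[of f \<zero> \<zero>] by simp

lemma dual_abelian_group: "abelian_group (lie_dual M)"
proof (rule abelian_groupI)
  fix f assume f: "f \<in> carrier (lie_dual M)"
  show "\<exists>g\<in>carrier (lie_dual M). g \<oplus>\<^bsub>lie_dual M\<^esub> f = \<zero>\<^bsub>lie_dual M\<^esub>"
    by (rule bexI[of _ "\<lambda>s\<in>carrier M. - f s"])
      (use f in \<open>auto simp: dual_carrier_iff smult_closed, auto simp: lie_dual_def\<close>)
  show "\<zero>\<^bsub>lie_dual M\<^esub> \<oplus>\<^bsub>lie_dual M\<^esub> f = f"
    using f by (auto simp: lie_dual_def extensional_def)
next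
  fix f g assume "f \<in> carrier (lie_dual M)" "g \<in> carrier (lie_dual M)"
  then show "f \<oplus>\<^bsub>lie_dual M\<^esub> g \<in> carrier (lie_dual M)"
    by (auto simp: lie_dual_def smult_closed algebra_simps)
qed (auto simp: lie_dual_def smult_closed fun_eq_iff algebra_simps)

text \<open>The action on functionals is by precomposition: the letter applied first ends up
  outermost on the argument, so \<open>fold\<close> turns into \<open>foldr\<close> over the same
  list.\<close>

lemma dual_wact:
  assumes "f \<in> carrier (lie_dual M)"
  shows "fold (lact (lie_dual M)) xs f = (\<lambda>s\<in>carrier M. f (foldr (lact M) xs s))"
  using assms
proof (induction xs arbitrary: f)
  case Nil
  then show ?case by (auto simp: dual_carrier_iff extensional_def)
next
  case (Cons x xs)
  define g where "g = (\<lambda>s\<in>carrier M. f (lact M x s))"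
  have "lact (lie_dual M) x f = g"
    by (simp add: lie_dual_def g_def)
  then have "fold (lact (lie_dual M)) (x # xs) f = fold (lact (lie_dual M)) xs g"
    by simp
  also have "g \<in> carrier (lie_dual M)"
    using Cons(2)
    by (simp add: g_def dual_carrier_iff smult_closed lact_closed lact_add_right lact_smult_right)
  then have "fold (lact (lie_dual M)) xs g = (\<lambda>s\<in>carrier M. g (foldr (lact M) xs s))"
    by (rule Cons(1))
  also have "\<dots> = (\<lambda>s\<in>carrier M. f (foldr (lact M) (x # xs) s))"
    by (rule restrict_ext) (simp add: g_def wact_closed)
  finally show ?case .
qed

lemma dual_comp_closed:
  assumes "f \<in> carrier (lie_dual M)"
    and "\<And>s. s \<in> carrier M \<Longrightarrow> A s \<in> carrier M"
    and "\<And>s t. s \<in> carrier M \<Longrightarrow> t \<in> carrier M \<Longrightarrow> A (s \<oplus> t) = A s \<oplus> A t"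
    and "\<And>c s. s \<in> carrier M \<Longrightarrow> A (c \<odot> s) = c \<odot> A s"
  shows "(\<lambda>s\<in>carrier M. f (A s)) \<in> carrier (lie_dual M)"
  using assms by (simp add: dual_carrier_iff smult_closed)

text \<open>The right action of U on the dual is the transpose of its action on the module, so the
  laws of a right module are inherited from there.\<close>

lemma dual_uact:
  assumes f: "f \<in> carrier (lie_dual M)"
  shows "smult (dual_module M) u f = (\<lambda>s\<in>carrier M. f (uact u s))"
proof -
  interpret D: abelian_group "lie_dual M" by (rule dual_abelian_group)
  let ?p = "rep_uea u"
  let ?g = "\<lambda>w. lookup ?p w \<odot>\<^bsub>lie_dual M\<^esub> fold (lact (lie_dual M)) (letters w) f"
  have g: "?g w = (\<lambda>s\<in>carrier M. f (lookup ?p w \<odot> wact w s))" for w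
  proof -
    have "?g w = (\<lambda>s\<in>carrier M. lookup ?p w * f (wact w s))"
      unfolding dual_wact[OF f] by (auto simp: lie_dual_def fun_eq_iff)
    also have "\<dots> = (\<lambda>s\<in>carrier M. f (lookup ?p w \<odot> wact w s))"
      by (rule restrict_ext) (simp add: dual_smult[OF f] wact_closed)
    finally show ?thesis .
  qed
  have g_closed: "?g w \<in> carrier (lie_dual M)" for w
    unfolding g by (rule dual_comp_closed[OF f])
      (simp_all add: wact_closed smult_closed wact_add wact_smult smult_add_right,
        simp add: mult.commute wact_closed flip: smult_assoc)
  have ev: "(\<Oplus>\<^bsub>lie_dual M\<^esub>w\<in>A. ?g w) = (\<lambda>s\<in>carrier M. f (\<Oplus>w\<in>A. lookup ?p w \<odot> wact w s))"
    if "finite A" for A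
    using that
  proof (induction A rule: finite_induct)
    case empty
    show ?case
      unfolding D.finsum_empty finsum_empty dual_zero[OF f] by (simp add: lie_dual_def)
  next
    case (insert w A)
    have "(\<Oplus>\<^bsub>lie_dual M\<^esub>w\<in>insert w A. ?g w) = ?g w \<oplus>\<^bsub>lie_dual M\<^esub> (\<Oplus>\<^bsub>lie_dual M\<^esub>w\<in>A. ?g w)"
      using insert g_closed by (intro D.finsum_insert) auto
    also have "\<dots> = (\<lambda>s\<in>carrier M. f (lookup ?p w \<odot> wact w s) +
        f (\<Oplus>w\<in>A. lookup ?p w \<odot> wact w s))"
      unfolding insert(3) unfolding g by (auto simp: lie_dual_def fun_eq_iff)
    also have "\<dots> = (\<lambda>s\<in>carrier M. f (\<Oplus>w\<in>insert w A. lookup ?p w \<odot> wact w s))"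
    proof (rule restrict_ext)
      fix s assume s: "s \<in> carrier M"
      have "(\<Oplus>w\<in>insert w A. lookup ?p w \<odot> wact w s) =
        lookup ?p w \<odot> wact w s \<oplus> (\<Oplus>w\<in>A. lookup ?p w \<odot> wact w s)"
        using insert s by (intro finsum_insert) (auto simp: smult_closed wact_closed)
      then show "f (lookup ?p w \<odot> wact w s) + f (\<Oplus>w\<in>A. lookup ?p w \<odot> wact w s) =
        f (\<Oplus>w\<in>insert w A. lookup ?p w \<odot> wact w s)"
        using s by (simp add: dual_add[OF f] smult_closed wact_closed)
    qed
    finally show ?case .
  qed
  have "smult (dual_module M) u f = (\<Oplus>\<^bsub>lie_dual M\<^esub>w\<in>keys ?p. ?g w)"
    by (simp add: uea_right_module_def free_algebra_act_def)
  also have "\<dots> = (\<lambda>s\<in>carrier M. f (uact u s))"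
    by (simp add: ev uact_def fa_def lcomb_def)
  finally show ?thesis .
qed

lemma dual_right_module: "right_module (dual_module M)"
proof (intro right_module.intro right_module_axioms.intro scalar_action.intro scalar_action_axioms.intro)
  interpret D: abelian_group "lie_dual M" by (rule dual_abelian_group)
  have car: "carrier (dual_module M) = carrier (lie_dual M)"
    and add: "ring.add (dual_module M) = ring.add (lie_dual M)"
    by (simp_all add: uea_right_module_def)
  show "abelian_group (dual_module M)"
  proof (rule abelian_groupI)
    fix f assume "f \<in> carrier (dual_module M)"
    then show "\<exists>g\<in>carrier (dual_module M).
        g \<oplus>\<^bsub>dual_module M\<^esub> f = \<zero>\<^bsub>dual_module M\<^esub>"
      by (intro bexI[of _ "\<ominus>\<^bsub>lie_dual M\<^esub> f"]) (auto simp: uea_right_module_def D.l_neg)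
  qed (auto simp: uea_right_module_def D.a_ac)
  fix u v f g
  assume f: "f \<in> carrier (dual_module M)"
  then have f': "f \<in> carrier (lie_dual M)" by (simp add: car)
  have cl: "(\<lambda>s\<in>carrier M. f (uact u s)) \<in> carrier (lie_dual M)" for u
    by (rule dual_comp_closed[OF f']) (auto simp: uact_closed uact_add_right uact_smult)
  show "u \<odot>\<^bsub>dual_module M\<^esub> f \<in> carrier (dual_module M)"
    by (simp add: dual_uact[OF f'] car cl)
  show "(u + v) \<odot>\<^bsub>dual_module M\<^esub> f = u \<odot>\<^bsub>dual_module M\<^esub> f
      \<oplus>\<^bsub>dual_module M\<^esub> v \<odot>\<^bsub>dual_module M\<^esub> f"
    unfolding dual_uact[OF f'] add
    by (auto simp: lie_dual_def fun_eq_iff uact_add_left dual_add[OF f'] uact_closed)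
  show "1 \<odot>\<^bsub>dual_module M\<^esub> f = f"
    using f' unfolding dual_uact[OF f'] by (auto simp: uact_one dual_carrier_iff extensional_def)
  show "(u * v) \<odot>\<^bsub>dual_module M\<^esub> f =
      v \<odot>\<^bsub>dual_module M\<^esub> (u \<odot>\<^bsub>dual_module M\<^esub> f)"
    unfolding dual_uact[OF f'] dual_uact[OF cl] by (auto simp: uact_mult uact_closed)
  assume g: "g \<in> carrier (dual_module M)"
  then have g': "g \<in> carrier (lie_dual M)" by (simp add: car)
  show "u \<odot>\<^bsub>dual_module M\<^esub> (f \<oplus>\<^bsub>dual_module M\<^esub> g) =
      u \<odot>\<^bsub>dual_module M\<^esub> f \<oplus>\<^bsub>dual_module M\<^esub> u \<odot>\<^bsub>dual_module M\<^esub> g"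
    unfolding add dual_uact[OF f'] dual_uact[OF g'] dual_uact[OF D.a_closed[OF f' g']]
    by (auto simp: lie_dual_def fun_eq_iff uact_closed)
qed

lemma dual_embedded: "embedded_right_module (dual_module M) (dual_embed M)"
proof (intro embedded_right_module.intro embedded_right_module_axioms.intro dual_right_module)
  show "dual_embed M (f \<oplus>\<^bsub>dual_module M\<^esub> g) = dual_embed M f + dual_embed M g" for f g
    by (auto simp: dual_embed_def uea_right_module_def lie_dual_def fun_eq_iff)
  show "inj_on (dual_embed M) (carrier (dual_module M))"
    by (rule inj_onI)
      (auto simp: dual_embed_def uea_right_module_def lie_dual_def fun_eq_iff extensional_def, metis)
qed

abbreviation "dimg \<equiv> embedded_right_module.img (dual_module M) (dual_embed M)"
abbreviation "dact \<equiv> embedded_right_module.iact (dual_module M) (dual_embed M)"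

text \<open>The description mentions only the vector space, not the action; hence pullbacks and
  twists of a module have the same embedded dual.\<close>

lemma dimg_iff: "m \<in> dimg \<longleftrightarrow> (\<forall>s. s \<notin> carrier M \<longrightarrow> m s = 0) \<and>
    (\<forall>s\<in>carrier M. \<forall>t\<in>carrier M. m (s \<oplus> t) = m s + m t) \<and> (\<forall>c. \<forall>s\<in>carrier M. m (c \<odot> s) = c * m s)"
proof -
  interpret E: embedded_right_module "dual_module M" "dual_embed M" by (rule dual_embedded)
  have car: "carrier (dual_module M) = carrier (lie_dual M)"
    by (simp add: uea_right_module_def)
  show ?thesis
  proof
    assume "m \<in> dimg"
    then obtain f where "f \<in> carrier (lie_dual M)" "m = dual_embed M f"
      by (auto simp: E.img_def car)
    then show "(\<forall>s. s \<notin> carrier M \<longrightarrow> m s = 0) \<and>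
      (\<forall>s\<in>carrier M. \<forall>t\<in>carrier M. m (s \<oplus> t) = m s + m t) \<and> (\<forall>c. \<forall>s\<in>carrier M. m (c \<odot> s) = c * m s)"
      by (simp add: dual_embed_def dual_add dual_smult smult_closed)
  next
    assume m: "(\<forall>s. s \<notin> carrier M \<longrightarrow> m s = 0) \<and>
      (\<forall>s\<in>carrier M. \<forall>t\<in>carrier M. m (s \<oplus> t) = m s + m t) \<and> (\<forall>c. \<forall>s\<in>carrier M. m (c \<odot> s) = c * m s)"
    then have "restrict m (carrier M) \<in> carrier (lie_dual M)"
      by (simp add: dual_carrier_iff smult_closed)
    moreover have "m = dual_embed M (restrict m (carrier M))"
      using m by (auto simp: dual_embed_def fun_eq_iff)
    ultimately show "m \<in> dimg"
      unfolding E.img_def car by blast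
  qed
qed

lemma dact_eq:
  assumes "m \<in> dimg"
  shows "dact m u = (\<lambda>s. if s \<in> carrier M then m (uact u s) else 0)"
proof -
  interpret E: embedded_right_module "dual_module M" "dual_embed M" by (rule dual_embedded)
  have car: "carrier (dual_module M) = carrier (lie_dual M)"
    by (simp add: uea_right_module_def)
  from assms obtain f where f: "f \<in> carrier (lie_dual M)" "m = dual_embed M f"
    by (auto simp: E.img_def car)
  then have "dact m u = dual_embed M (\<lambda>s\<in>carrier M. f (uact u s))"
    using E.iact_phi[of f u] by (simp add: car dual_uact)
  then show ?thesis
    by (auto simp: f(2) dual_embed_def fun_eq_iff uact_closed)
qed

end

lemma Tor_dual_trivial_iff:
  fixes S :: "('g::complex_lie_algebra, 's) lie_mod" and W :: "('g uea, 'v) module"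
  assumes S: "lie_module S" and based: "based_resolution W B D \<epsilon>"
  shows "carrier (Tor k (dual_module S) W) = {\<one>\<^bsub>Tor k (dual_module S) W\<^esub>}
    \<longleftrightarrow> exact_at (lie_module.dimg S) (lie_module.dact S) B D k"
proof -
  have "left_module W" using based by (simp add: based_resolution_def)
  then show ?thesis
    by (intro Tor_trivial_iff[OF free_resolution_exists lie_module.dual_embedded[OF S] based])
qed

text \<open>The same space with a different action, possibly of another Lie algebra; pullback, twist
  and descent are all of this form.\<close>

definition relact :: "('k \<Rightarrow> 'm \<Rightarrow> 'm) \<Rightarrow> ('g, 'm) lie_mod \<Rightarrow> ('k, 'm) lie_mod" where
  "relact L M = \<lparr>carrier = carrier M, monoid.mult = monoid.mult M, monoid.one = monoid.one M,
      ring.zero = ring.zero M, ring.add = ring.add M, smult = smult M, lact = L\<rparr>"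

lemma relact_simps [simp]:
  "carrier (relact L M) = carrier M" "ring.zero (relact L M) = ring.zero M"
  "ring.add (relact L M) = ring.add M" "smult (relact L M) = smult M" "lact (relact L M) = L"
  by (simp_all add: relact_def)

lemma lie_pullback_relact: "lie_pullback f M = relact (\<lambda>x. lact M (f x)) M"
  by (simp add: lie_pullback_def relact_def)

lemma relact_a_minus: "a_minus (relact L M) = a_minus M"
  by (simp add: a_minus_def a_inv_def m_inv_def fun_eq_iff)

lemma relact_finsum: "finsum (relact L M) = finsum M"
  by (simp add: finsum_def finprod_def fun_eq_iff)

lemma relact_left_module:
  assumes "left_module M"
  shows "left_module (relact L M)"
proof -
  interpret left_module M by (rule assms)
  show ?thesis
  proof (intro left_module.intro left_module_axioms.intro scalar_action.intro scalar_action_axioms.intro)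
    show "abelian_group (relact L M)"
    proof (rule abelian_groupI)
      fix x assume "x \<in> carrier (relact L M)"
      then show "\<exists>y\<in>carrier (relact L M). y \<oplus>\<^bsub>relact L M\<^esub> x = \<zero>\<^bsub>relact L M\<^esub>"
        by (intro bexI[of _ "\<ominus>\<^bsub>M\<^esub> x"]) (auto simp: l_neg)
    qed (auto simp: a_ac)
  qed (auto simp: smult_closed smult_add_left smult_add_right smult_one smult_assoc)
qed

lemma relact_lie_module:
  fixes M :: "('g::complex_lie_algebra, 'm) lie_mod" and L :: "'k::complex_lie_algebra \<Rightarrow> 'm \<Rightarrow> 'm"
  assumes "left_module M"
    and "\<And>x m. m \<in> carrier M \<Longrightarrow> L x m \<in> carrier M"
    and "\<And>x m n. m \<in> carrier M \<Longrightarrow> n \<in> carrier M \<Longrightarrow> L x (m \<oplus>\<^bsub>M\<^esub> n) = L x m \<oplus>\<^bsub>M\<^esub> L x n"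
    and "\<And>x c m. m \<in> carrier M \<Longrightarrow> L x (c \<odot>\<^bsub>M\<^esub> m) = c \<odot>\<^bsub>M\<^esub> L x m"
    and "\<And>x y m. m \<in> carrier M \<Longrightarrow> L (x + y) m = L x m \<oplus>\<^bsub>M\<^esub> L y m"
    and "\<And>x c m. m \<in> carrier M \<Longrightarrow> L (c *\<^sub>C x) m = c \<odot>\<^bsub>M\<^esub> L x m"
    and "\<And>x y m. m \<in> carrier M \<Longrightarrow> L (bracket x y) m = L x (L y m) \<ominus>\<^bsub>M\<^esub> L y (L x m)"
  shows "lie_module (relact L M)"
  using assms by (intro lie_module.intro lie_module_axioms.intro relact_left_module)
    (simp_all add: relact_a_minus)

lemma relact_simple:
  assumes "simple_fd M" "lie_module (relact L M)"
    and "\<And>N. lie_submodule N (relact L M) \<Longrightarrow> lie_submodule N M"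
  shows "simple_fd (relact L M)"
  using assms unfolding simple_fd_def by (simp add: relact_finsum)

text \<open>\<open>Tor\<close> is built on the dual itself, so an equality of duals transports its
  vanishing literally; the actions may still differ outside the carrier.\<close>

lemma lie_dual_cong:
  assumes "carrier M' = carrier M" "ring.add M' = ring.add M" "smult M' = smult M"
    "\<And>x s. s \<in> carrier M \<Longrightarrow> lact M' x s = lact M x s"
  shows "lie_dual M' = lie_dual M"
proof -
  have "(\<lambda>s\<in>carrier M. f (lact M' x s)) = (\<lambda>s\<in>carrier M. f (lact M x s))" for f :: "'a \<Rightarrow> complex" and x
    using assms(4) by (intro restrict_ext) simp
  then show ?thesis by (simp add: lie_dual_def assms(1-3))
qed

section \<open>Isomorphism classes of Lie modules\<close>

lemma lie_module_iso_trans: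
  assumes "lie_module_iso M N" "lie_module_iso N K"
  shows "lie_module_iso M K"
proof -
  from assms(1) obtain f where f: "f \<in> module_hom M N" "bij_betw f (carrier M) (carrier N)"
    "\<And>x m. m \<in> carrier M \<Longrightarrow> f (lact M x m) = lact N x (f m)" by (auto simp: lie_module_iso_def)
  from assms(2) obtain g where g: "g \<in> module_hom N K" "bij_betw g (carrier N) (carrier K)"
    "\<And>x m. m \<in> carrier N \<Longrightarrow> g (lact N x m) = lact K x (g m)" by (auto simp: lie_module_iso_def)
  show ?thesis
    unfolding lie_module_iso_def
  proof (intro bexI[of _ "g \<circ> f"] conjI allI ballI)
    show "bij_betw (g \<circ> f) (carrier M) (carrier K)" by (rule bij_betw_trans[OF f(2) g(2)])
    show "(g \<circ> f) (lact M x m) = lact K x ((g \<circ> f) m)" if "m \<in> carrier M" for x m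
      using that by (simp add: f(3) g(3) module_hom_closed[OF f(1)])
    have "f m \<in> carrier N" if "m \<in> carrier M" for m
      using that by (rule module_hom_closed[OF f(1)])
    then show "g \<circ> f \<in> module_hom M K"
      unfolding module_hom_def[of M K] hom_def
      by (simp add: Pi_iff module_hom_closed[OF g(1)] module_hom_add[OF f(1)] module_hom_add[OF g(1)]
        module_hom_smult[OF f(1)] module_hom_smult[OF g(1)])
  qed
qed

lemma lie_module_iso_sym:
  assumes M: "lie_module M" and "lie_module_iso M N"
  shows "lie_module_iso N M"
proof -
  interpret M: lie_module M by (rule M)
  from assms(2) obtain f where f: "f \<in> module_hom M N" "bij_betw f (carrier M) (carrier N)"
    "\<And>x m. m \<in> carrier M \<Longrightarrow> f (lact M x m) = lact N x (f m)" by (auto simp: lie_module_iso_def)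
  define g where "g = inv_into (carrier M) f"
  have gf: "g (f m) = m" if "m \<in> carrier M" for m
    using f(2) that by (simp add: g_def bij_betw_def)
  have ex: "\<exists>m\<in>carrier M. n = f m" if "n \<in> carrier N" for n
    using f(2) that by (auto simp: bij_betw_def)
  show ?thesis
    unfolding lie_module_iso_def
  proof (intro bexI[of _ g] conjI allI ballI)
    show "bij_betw g (carrier N) (carrier M)"
      unfolding g_def by (rule bij_betw_inv_into[OF f(2)])
    show "g (lact N x n) = lact M x (g n)" if "n \<in> carrier N" for x n
      using ex[OF that] by (auto simp: gf M.lact_closed simp flip: f(3))
    have "g (n \<oplus>\<^bsub>N\<^esub> n') = g n \<oplus>\<^bsub>M\<^esub> g n'" if "n \<in> carrier N" "n' \<in> carrier N" for n n'
      using ex[OF that(1)] ex[OF that(2)] by (auto simp: gf simp flip: module_hom_add[OF f(1)])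
    moreover have "g (r \<odot>\<^bsub>N\<^esub> n) = r \<odot>\<^bsub>M\<^esub> g n" if "n \<in> carrier N" for n r
      using ex[OF that] by (auto simp: gf M.smult_closed simp flip: module_hom_smult[OF f(1)])
    moreover have "g n \<in> carrier M" if "n \<in> carrier N" for n
      using ex[OF that] by (auto simp: gf)
    ultimately show "g \<in> module_hom N M"
      by (auto simp: module_hom_def hom_def)
  qed
qed

lemma lie_module_iso_cong:
  assumes "lie_module M" "carrier M' = carrier M" "ring.add M' = ring.add M" "smult M' = smult M"
    "\<And>x s. s \<in> carrier M \<Longrightarrow> lact M' x s = lact M x s"
  shows "lie_module_iso M M'"
  unfolding lie_module_iso_def
  using assms by (intro bexI[of _ "\<lambda>x. x"]) (auto simp: module_hom_def hom_def bij_betw_def)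

lemma lie_module_iso_refl: "lie_module_iso M M"
  unfolding lie_module_iso_def
  by (intro bexI[of _ "\<lambda>x. x"]) (auto simp: module_hom_def hom_def bij_betw_def)

lemma iso_class_eq:
  assumes "lie_module M" "lie_module_iso M M'"
  shows "iso_class M = iso_class M'"
  unfolding iso_class_def
  using lie_module_iso_trans[OF lie_module_iso_sym[OF assms]] lie_module_iso_trans[OF assms(2)]
  by blast

lemma iso_class_eqD:
  fixes M' :: "('g::complex_lie_algebra, nat \<Rightarrow> complex) lie_mod"
  assumes "iso_class M = iso_class M'" "lie_module M'"
  shows "lie_module_iso M M'"
  using assms lie_module_iso_refl unfolding iso_class_def by blast

lemma simple_fd_lie_module: "simple_fd M \<Longrightarrow> lie_module M"
  by (simp add: simple_fd_def)

text \<open>Tensoring with a character, kept on the original space: \<open>lie_tensor\<close> lives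
  on cosets, whereas the spectrum is formed from modules on
  \<open>nat \<Rightarrow> complex\<close>.\<close>

definition twist :: "('h \<Rightarrow> complex) \<Rightarrow> ('h, 'm) lie_mod \<Rightarrow> ('h, 'm) lie_mod" where
  "twist \<psi> M = relact (\<lambda>h m. lact M h m \<oplus>\<^bsub>M\<^esub> \<psi> h \<odot>\<^bsub>M\<^esub> m) M"

lemma twist_lie_module:
  fixes M :: "('h::complex_lie_algebra, 'm) lie_mod" (structure)
  assumes "lie_module M" "lie_character \<psi>"
  shows "lie_module (twist \<psi> M)"
proof -
  interpret lie_module M by (rule assms(1))
  have \<psi>: "\<psi> (x + y) = \<psi> x + \<psi> y" "\<psi> (c *\<^sub>C x) = c * \<psi> x" "\<psi> (bracket x y) = 0" for x y c
    using assms(2) by (auto simp: lie_character_def)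
  show ?thesis
    unfolding twist_def
  proof (rule relact_lie_module)
    show "left_module M" by (rule left_module_axioms)
    fix x y c m assume m: "m \<in> carrier M"
    show "lact M x m \<oplus> \<psi> x \<odot> m \<in> carrier M"
      using m by (simp add: lact_closed smult_closed)
    show "lact M x (c \<odot> m) \<oplus> \<psi> x \<odot> (c \<odot> m) = c \<odot> (lact M x m \<oplus> \<psi> x \<odot> m)"
      using m by (simp add: lact_closed smult_closed lact_smult_right smult_add_right mult.commute flip: smult_assoc)
    show "lact M (x + y) m \<oplus> \<psi> (x + y) \<odot> m = (lact M x m \<oplus> \<psi> x \<odot> m) \<oplus> (lact M y m \<oplus> \<psi> y \<odot> m)"
      using m by (simp add: \<psi> lact_closed smult_closed lact_add_left smult_add_left a_ac)
    show "lact M (c *\<^sub>C x) m \<oplus> \<psi> (c *\<^sub>C x) \<odot> m = c \<odot> (lact M x m \<oplus> \<psi> x \<odot> m)"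
      using m by (simp add: \<psi> lact_closed smult_closed lact_smult_left smult_add_right smult_assoc)
    define A where "A = lact M x (lact M y m)"
    define B where "B = lact M y (lact M x m)"
    define P where "P = \<psi> x \<odot> lact M y m"
    define Q where "Q = \<psi> y \<odot> lact M x m"
    define R where "R = (\<psi> x * \<psi> y) \<odot> m"
    have cl: "A \<in> carrier M" "B \<in> carrier M" "P \<in> carrier M" "Q \<in> carrier M" "R \<in> carrier M"
      using m by (simp_all add: A_def B_def P_def Q_def R_def lact_closed smult_closed)
    have "lact M x (lact M y m \<oplus> \<psi> y \<odot> m) \<oplus> \<psi> x \<odot> (lact M y m \<oplus> \<psi> y \<odot> m) = (A \<oplus> Q) \<oplus> (P \<oplus> R)"
      using m by (simp add: A_def P_def Q_def R_def lact_closed smult_closed lact_add_right lact_smult_right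
          smult_add_right smult_assoc)
    moreover have "lact M y (lact M x m \<oplus> \<psi> x \<odot> m) \<oplus> \<psi> y \<odot> (lact M x m \<oplus> \<psi> x \<odot> m) = (B \<oplus> P) \<oplus> (Q \<oplus> R)"
      using m by (simp add: B_def P_def Q_def R_def lact_closed smult_closed lact_add_right lact_smult_right
          smult_add_right mult.commute flip: smult_assoc)
    \<comment> \<open>The terms P, Q, R are common to both orders of application and cancel, which
      leaves the old commutator; the character vanishes on brackets.\<close>
    moreover have "(A \<oplus> Q) \<oplus> (P \<oplus> R) = (A \<ominus> B) \<oplus> ((B \<oplus> P) \<oplus> (Q \<oplus> R))"
    proof -
      have "(A \<oplus> Q) \<oplus> (P \<oplus> R) = A \<oplus> (P \<oplus> (Q \<oplus> R))" "(B \<oplus> P) \<oplus> (Q \<oplus> R) = B \<oplus> (P \<oplus> (Q \<oplus> R))"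
        using cl by (simp_all add: a_ac)
      moreover have "(A \<ominus> B) \<oplus> (B \<oplus> (P \<oplus> (Q \<oplus> R))) = A \<oplus> (P \<oplus> (Q \<oplus> R))"
        using cl by (simp add: a_minus_def a_assoc r_neg1)
      ultimately show ?thesis by (simp only:)
    qed
    ultimately show "lact M (bracket x y) m \<oplus> \<psi> (bracket x y) \<odot> m =
        (lact M x (lact M y m \<oplus> \<psi> y \<odot> m) \<oplus> \<psi> x \<odot> (lact M y m \<oplus> \<psi> y \<odot> m)) \<ominus>
        (lact M y (lact M x m \<oplus> \<psi> x \<odot> m) \<oplus> \<psi> y \<odot> (lact M x m \<oplus> \<psi> x \<odot> m))"
      using cl m by (simp add: \<psi> smult_zero_left lact_bracket A_def[symmetric] B_def[symmetric] a_minus_def a_assoc r_neg)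
  next
    fix x m n assume "m \<in> carrier M" "n \<in> carrier M"
    then show "lact M x (m \<oplus> n) \<oplus> \<psi> x \<odot> (m \<oplus> n) = (lact M x m \<oplus> \<psi> x \<odot> m) \<oplus> (lact M x n \<oplus> \<psi> x \<odot> n)"
      by (simp add: lact_closed smult_closed lact_add_right smult_add_right a_ac)
  qed
qed

text \<open>The old action is the twisted one minus multiplication by the scalar \<psi> x, so a
  subspace stable under the twisted action is stable under the old one.\<close>

lemma twist_simple:
  fixes M :: "('h::complex_lie_algebra, 'm) lie_mod" (structure)
  assumes "simple_fd M" "lie_character \<psi>"
  shows "simple_fd (twist \<psi> M)"
proof -
  interpret lie_module M by (rule simple_fd_lie_module[OF assms(1)])
  show ?thesis
    using assms(1) twist_lie_module[OF lie_module_axioms assms(2)]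
    unfolding twist_def
  proof (rule relact_simple)
    fix N assume N: "lie_submodule N (relact (\<lambda>h m. lact M h m \<oplus> \<psi> h \<odot> m) M)"
    have "lact M x m \<in> N" if m: "m \<in> N" for x m
    proof -
      have "m \<in> carrier M" using N m by (auto simp: lie_submodule_def)
      then have "(lact M x m \<oplus> \<psi> x \<odot> m) \<oplus> (- \<psi> x) \<odot> m = lact M x m"
        by (simp add: smult_uminus_left lact_closed smult_closed a_assoc r_neg)
      moreover have "(lact M x m \<oplus> \<psi> x \<odot> m) \<oplus> (- \<psi> x) \<odot> m \<in> N"
        using N m by (simp add: lie_submodule_def)
      ultimately show ?thesis by simp
    qed
    then show "lie_submodule N M" using N by (simp add: lie_submodule_def)
  qed
qed

lemma twist_iso:
  fixes M :: "('h::complex_lie_algebra, 'm) lie_mod" (structure)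
  assumes "lie_module M" "lie_module_iso M N"
  shows "lie_module_iso (twist \<psi> M) (twist \<psi> N)"
proof -
  interpret lie_module M by (rule assms(1))
  from assms(2) obtain f where f: "f \<in> module_hom M N" "bij_betw f (carrier M) (carrier N)"
    "\<And>x m. m \<in> carrier M \<Longrightarrow> f (lact M x m) = lact N x (f m)" by (auto simp: lie_module_iso_def)
  have "f \<in> module_hom (twist \<psi> M) (twist \<psi> N)"
    using f(1) by (auto simp: module_hom_def hom_def twist_def)
  moreover have "f (lact M x m \<oplus> \<psi> x \<odot> m) = lact N x (f m) \<oplus>\<^bsub>N\<^esub> \<psi> x \<odot>\<^bsub>N\<^esub> f m" if "m \<in> carrier M" for x m
    using that by (simp add: module_hom_add[OF f(1)] module_hom_smult[OF f(1)] f(3) lact_closed smult_closed)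
  ultimately show ?thesis
    unfolding lie_module_iso_def using f(2) by (intro bexI[of _ f]) (auto simp: twist_def)
qed

lemma character_left_module: "left_module (character_module \<psi>)"
proof (intro left_module.intro left_module_axioms.intro scalar_action.intro scalar_action_axioms.intro)
  show "abelian_group (character_module \<psi>)"
  proof (rule abelian_groupI)
    fix x assume "x \<in> carrier (character_module \<psi>)"
    show "\<exists>y\<in>carrier (character_module \<psi>). y \<oplus>\<^bsub>character_module \<psi>\<^esub> x = \<zero>\<^bsub>character_module \<psi>\<^esub>"
      by (rule bexI[of _ "- x"]) (auto simp: character_module_def)
  qed (auto simp: character_module_def)
qed (auto simp: character_module_def algebra_simps)

text \<open>The isomorphism is s \<mapsto> 1 \<otimes> s; balancedness over the complex numbers
  brings every pure tensor into this form.\<close>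

lemma twist_iso_lie_tensor:
  fixes M :: "('h::complex_lie_algebra, 'm) lie_mod"
  assumes "lie_module M"
  shows "lie_module_iso (twist \<psi> M) (lie_tensor (character_module \<psi>) M)"
proof -
  interpret M: lie_module M by (rule assms)
  let ?C = "character_module \<psi>"
  interpret C: left_module ?C by (rule character_left_module)
  interpret T: tensor_pair ?C M ..
  have idM: "id \<in> module_hom M M" and idC: "id \<in> module_hom ?C ?C"
    by (simp_all add: id_module_hom M.scalar_action_axioms C.scalar_action_axioms)
  have C: "carrier ?C = UNIV" "\<And>a b. a \<odot>\<^bsub>?C\<^esub> b = a * b" "\<And>a b. a \<oplus>\<^bsub>?C\<^esub> b = a + b"
    "\<And>h b. lact ?C h b = \<psi> h * b"
    by (simp_all add: character_module_def)
  have mult_hom: "(\<lambda>m. c * m) \<in> module_hom ?C ?C" for c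
    by (auto simp: module_hom_def hom_def C algebra_simps)
  have lact_hom: "lact M h \<in> module_hom M M" for h
    by (auto simp: module_hom_def hom_def M.lact_closed M.lact_add_right M.lact_smult_right)
  define f where "f s = T.rel #>\<^bsub>T.F\<^esub> frag_of (1, s)" for s
  have fF: "frag_of (a, s) \<in> carrier T.F" if "s \<in> carrier M" for a s
    using that by (simp add: C)
  have scal: "T.rel #>\<^bsub>T.F\<^esub> frag_of (a, s) = f (a \<odot>\<^bsub>M\<^esub> s)" if "s \<in> carrier M" for a s
    unfolding f_def T.coset_eq_iff using T.rel_balanced[of 1 s a] that by (simp add: C)
  have f_add: "f (s \<oplus>\<^bsub>M\<^esub> t) = f s \<otimes>\<^bsub>tensor_group ?C M\<^esub> f t" if "s \<in> carrier M" "t \<in> carrier M" for s t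
    unfolding f_def T.tensor_mult[OF fF[OF that(1)] fF[OF that(2)]] T.coset_eq_iff
    using T.rel_right[of 1 s t] that by (simp add: C diff_diff_add)
  have map1: "tensor_map ?C M (\<lambda>m. c * m) id (f s) = f (c \<odot>\<^bsub>M\<^esub> s)" if "s \<in> carrier M" for c s
  proof -
    interpret TM: tensor_maps ?C M ?C M "\<lambda>m. c * m" id
      by (intro tensor_maps.intro tensor_maps_axioms.intro T.tensor_pair_axioms mult_hom idM)
    show ?thesis unfolding f_def TM.tensor_map_coset by (simp add: scal[OF that, unfolded f_def])
  qed
  have map2: "tensor_map ?C M id (lact M h) (f s) = f (lact M h s)" if "s \<in> carrier M" for h s
  proof -
    interpret TM: tensor_maps ?C M ?C M id "lact M h"
      by (intro tensor_maps.intro tensor_maps_axioms.intro T.tensor_pair_axioms idC lact_hom)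
    show ?thesis unfolding f_def TM.tensor_map_coset by simp
  qed
  have T_simps: "carrier (lie_tensor ?C M) = carrier (tensor_group ?C M)"
    "\<And>s t. s \<oplus>\<^bsub>lie_tensor ?C M\<^esub> t = s \<otimes>\<^bsub>tensor_group ?C M\<^esub> t"
    "\<And>c t. c \<odot>\<^bsub>lie_tensor ?C M\<^esub> t = tensor_map ?C M (\<lambda>m. c * m) id t"
    "\<And>h t. lact (lie_tensor ?C M) h t = tensor_map ?C M (\<lambda>m. \<psi> h * m) id t
        \<otimes>\<^bsub>tensor_group ?C M\<^esub> tensor_map ?C M id (lact M h) t"
    by (simp_all add: lie_tensor_def Let_def C) (simp add: character_module_def)
  interpret TG: comm_group "tensor_group ?C M" by (rule T.tensor_group_comm_group)
  have f_closed: "f s \<in> carrier (tensor_group ?C M)" if "s \<in> carrier M" for s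
    unfolding T.tensor_carrier f_def using fF[OF that] by blast
  have f_inj: "s = t" if s: "s \<in> carrier M" and t: "t \<in> carrier M" and eq: "f s = f t" for s t
  proof -
    \<comment> \<open>Injectivity: the map a \<otimes> s \<mapsto> a s respects the relations and
      takes 1 \<otimes> s back to s.\<close>
    obtain h where h: "h \<in> hom T.F (add_monoid M)"
      "\<And>x. x \<in> carrier ?C \<times> carrier M \<Longrightarrow> h (frag_of x) = (case x of (a, s) \<Rightarrow> a \<odot>\<^bsub>M\<^esub> s)"
      by (rule comm_group.free_Abelian_group_universal[OF M.a_comm_group,
            of "\<lambda>(a, s). a \<odot>\<^bsub>M\<^esub> s" "carrier ?C \<times> carrier M"])
        (auto simp: M.smult_closed)
    have h_add: "h (x + y) = h x \<oplus>\<^bsub>M\<^esub> h y" if "x \<in> carrier T.F" "y \<in> carrier T.F" for x y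
      using h(1) that by (auto simp: hom_def)
    have d: "frag_of (1, s) - frag_of (1, t) \<in> T.rel"
      using eq unfolding f_def T.coset_eq_iff .
    have "h (frag_of (1, s) - frag_of (1, t)) = \<one>\<^bsub>add_monoid M\<^esub>"
    proof (rule T.rel_kernel[OF M.a_comm_group h(1) _ _ _ d])
      fix a a' s assume "s \<in> carrier M"
      then show "h (frag_of (a \<oplus>\<^bsub>?C\<^esub> a', s)) = h (frag_of (a, s)) \<otimes>\<^bsub>add_monoid M\<^esub> h (frag_of (a', s))"
        by (simp add: h(2) C M.smult_add_left)
    next
      fix a s t assume "s \<in> carrier M" "t \<in> carrier M"
      then show "h (frag_of (a, s \<oplus>\<^bsub>M\<^esub> t)) = h (frag_of (a, s)) \<otimes>\<^bsub>add_monoid M\<^esub> h (frag_of (a, t))"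
        by (simp add: h(2) C M.smult_add_right)
    next
      fix r a s assume "s \<in> carrier M"
      then show "h (frag_of (r \<odot>\<^bsub>?C\<^esub> a, s)) = h (frag_of (a, r \<odot>\<^bsub>M\<^esub> s))"
        by (simp add: h(2) C M.smult_closed mult.commute flip: M.smult_assoc)
    qed
    then have "\<zero>\<^bsub>M\<^esub> \<oplus>\<^bsub>M\<^esub> h (frag_of (1, t)) = h (frag_of (1, s))"
      using h_add[of "frag_of (1, s) - frag_of (1, t)" "frag_of (1, t)"] T.rel_carrier[OF d] t by (simp add: C)
    then show ?thesis
      using s t by (simp add: h(2) C M.smult_one)
  qed
  have f_surj: "\<exists>s\<in>carrier M. x = f s" if x: "x \<in> carrier (tensor_group ?C M)" for x
  proof -
    obtain z where z: "z \<in> carrier T.F" "x = T.rel #>\<^bsub>T.F\<^esub> z"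
      using x unfolding T.tensor_carrier by blast
    have "keys z \<subseteq> carrier ?C \<times> carrier M" using z by simp
    then have "\<exists>s\<in>carrier M. T.rel #>\<^bsub>T.F\<^esub> z = f s"
    proof (induction z rule: free_Abelian_group_induct[consumes 1, case_names zero diff single])
      case zero
      have "T.rel #>\<^bsub>T.F\<^esub> 0 = f \<zero>\<^bsub>M\<^esub>"
        unfolding f_def T.coset_eq_iff using T.rel_uminus[OF T.rel_zero_right[of 1]] by (simp add: C)
      then show ?case by blast
    next
      case (diff z w)
      then obtain s t where st: "s \<in> carrier M" "t \<in> carrier M" "T.rel #>\<^bsub>T.F\<^esub> z = f s" "T.rel #>\<^bsub>T.F\<^esub> w = f t"
        by blast
      have zw: "z - w \<in> carrier T.F"
        using diff(1,2) keys_diff[of z w] by (simp only: carrier_free_Abelian_group_iff) blast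
      have "(T.rel #>\<^bsub>T.F\<^esub> (z - w)) \<otimes>\<^bsub>tensor_group ?C M\<^esub> f t = f s"
        using T.tensor_mult[OF zw, of w] diff(2) st by simp
      moreover have "f (s \<ominus>\<^bsub>M\<^esub> t) \<otimes>\<^bsub>tensor_group ?C M\<^esub> f t = f s"
        using st f_add[of "s \<ominus>\<^bsub>M\<^esub> t" t] by (simp add: a_minus_def M.a_assoc M.l_neg)
      moreover have "T.rel #>\<^bsub>T.F\<^esub> (z - w) \<in> carrier (tensor_group ?C M)"
        unfolding T.tensor_carrier using zw by blast
      ultimately have "T.rel #>\<^bsub>T.F\<^esub> (z - w) = f (s \<ominus>\<^bsub>M\<^esub> t)"
        using st f_closed by (metis M.minus_closed TG.right_cancel)
      then show ?case using st by blast
    next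
      case (single p)
      then show ?case using scal[of "snd p" "fst p"] M.smult_closed by (cases p) auto
    qed
    then show ?thesis using z by simp
  qed
  have "bij_betw f (carrier (twist \<psi> M)) (carrier (lie_tensor ?C M))"
    unfolding bij_betw_def inj_on_def T_simps using f_inj f_surj f_closed by (auto simp: twist_def image_iff)
  moreover have "f \<in> module_hom (twist \<psi> M) (lie_tensor ?C M)"
    by (auto simp: module_hom_def hom_def T_simps twist_def f_closed f_add map1)
  moreover have "f (lact (twist \<psi> M) h s) = lact (lie_tensor ?C M) h (f s)" if "s \<in> carrier M" for h s
    using that f_closed by (simp add: T_simps twist_def map1 map2 f_add M.lact_closed M.smult_closed TG.m_comm)
  ultimately show ?thesis
    unfolding lie_module_iso_def by (intro bexI[of _ f]) (auto simp: twist_def)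
qed

section \<open>One-dimensional extensions\<close>

locale lie_extension =
  fixes \<iota> :: "complex \<Rightarrow> 'g::complex_lie_algebra" and \<pi> :: "'g \<Rightarrow> 'h::fd_complex_lie_algebra"
    and \<chi> :: "'h \<Rightarrow> complex"
  assumes character: "lie_character \<chi>" and extension: "one_dim_extension \<iota> \<pi> \<chi>"
begin

definition "c = \<iota> 1"

lemma chi_add: "\<chi> (x + y) = \<chi> x + \<chi> y" and chi_scale: "\<chi> (a *\<^sub>C x) = a * \<chi> x"
  and chi_bracket: "\<chi> (bracket x y) = 0"
  using character by (auto simp: lie_character_def)

lemma pi_add: "\<pi> (x + y) = \<pi> x + \<pi> y" and pi_scale: "\<pi> (a *\<^sub>C x) = a *\<^sub>C \<pi> x"
  and pi_bracket: "\<pi> (bracket x y) = bracket (\<pi> x) (\<pi> y)"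
  using extension by (auto simp: one_dim_extension_def lie_hom_def)

lemma pi_surj: "surj \<pi>"
  using extension by (simp add: one_dim_extension_def)

lemma iota_eq: "\<iota> a = a *\<^sub>C c"
proof -
  have "\<iota> (a * 1) = a *\<^sub>C \<iota> 1"
    using extension unfolding one_dim_extension_def by blast
  then show ?thesis by (simp add: c_def)
qed

lemma pi_zero_iff: "\<pi> x = 0 \<longleftrightarrow> (\<exists>a. x = a *\<^sub>C c)"
proof -
  have "range \<iota> = {x. \<pi> x = 0}" using extension by (simp add: one_dim_extension_def)
  then have "\<pi> x = 0 \<longleftrightarrow> x \<in> range \<iota>" by simp
  then show ?thesis by (auto simp: iota_eq)
qed

lemma pi_diff: "\<pi> (x - y) = \<pi> x - \<pi> y"
  using pi_add[of "x - y" y] by simp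

lemma pi_c: "\<pi> c = 0"
  unfolding pi_zero_iff by (rule exI[of _ 1]) (simp add: scaleC_one)

lemma bracket_c: "bracket x c = \<chi> (\<pi> x) *\<^sub>C c"
  using extension by (simp add: one_dim_extension_def c_def)

lemma c_nonzero: "c \<noteq> 0"
proof
  assume "c = 0"
  then have "\<iota> 1 = \<iota> 0" by (simp add: iota_eq)
  then show False
    using extension by (auto simp: one_dim_extension_def inj_eq)
qed

text \<open>A set-theoretic section; it is linear and respects brackets only up to multiples of
  c.\<close>

definition "sec = inv_into UNIV \<pi>"

lemma pi_sec [simp]: "\<pi> (sec h) = h"
  by (simp add: sec_def surj_f_inv_f[OF pi_surj])

text \<open>\<gg> inherits finite dimension from \<hh>: lifts of a spanning set together with c span
  it.\<close>

lemma finite_span: "\<exists>S. finite S \<and> (\<forall>x :: 'g. x \<in> module.span scaleC S)"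
proof -
  interpret vs: vector_space "scaleC :: complex \<Rightarrow> 'g \<Rightarrow> 'g" by (rule vector_space_scaleC)
  obtain B :: "'h set" where B: "finite B" "\<And>x. \<exists>k. x = (\<Sum>b\<in>B. k b *\<^sub>C b)"
    using finite_dimensional by blast
  have pi_sum: "\<pi> (\<Sum>b\<in>A. k b *\<^sub>C sec b) = (\<Sum>b\<in>A. k b *\<^sub>C b)" for A k
  proof (induction A rule: infinite_finite_induct)
    case empty
    show ?case using pi_add[of 0 0] by simp
  next
    case (infinite A)
    then show ?case using pi_add[of 0 0] by simp
  qed (simp add: pi_add pi_scale)
  let ?S = "insert c (sec ` B)"
  have "x \<in> vs.span ?S" for x
  proof -
    obtain k where k: "\<pi> x = (\<Sum>b\<in>B. k b *\<^sub>C b)" using B(2) by blast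
    let ?y = "\<Sum>b\<in>B. k b *\<^sub>C sec b"
    have "\<pi> (x - ?y) = 0" by (simp add: pi_diff pi_sum k)
    then obtain a where "x - ?y = a *\<^sub>C c" using pi_zero_iff by blast
    then have x: "x = ?y + a *\<^sub>C c" by (simp add: algebra_simps)
    show ?thesis
      by (subst x) (intro vs.span_add vs.span_sum vs.span_scale vs.span_base; blast)
  qed
  then show ?thesis using B(1) by (intro exI[of _ ?S]) simp
qed

definition "\<rho> = sc.lift_uea (\<lambda>x. gen (\<pi> x) :: 'h uea)"

lemma rho_gen: "\<rho> (gen x) = gen (\<pi> x)" and rho_sc: "\<rho> (sc a) = sc a"
  and rho_add: "\<rho> (u + v) = \<rho> u + \<rho> v" and rho_mult: "\<rho> (u * v) = \<rho> u * \<rho> v"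
  unfolding \<rho>_def
  by (rule sc.lift_gen sc.lift_sc sc.lift_add sc.lift_mult;
      simp add: pi_add pi_scale pi_bracket gen_add gen_scale gen_bracket)+

text \<open>The automorphism \<sigma> is \<open>shift 1\<close>; the parameter provides its inverse
  \<open>shift (- 1)\<close> by the same formula.\<close>

definition "shift t = sc.lift_uea (\<lambda>x. gen x - sc (t * \<chi> (\<pi> x)) :: 'g uea)"

lemma sc_uminus: "sc (- a) = - sc a"
proof -
  have "sc a + sc (- a) = 0"
    by (simp only: sc_add[symmetric]) (simp add: sc_zero)
  then show ?thesis by (simp only: add_eq_0_iff)
qed

lemma shift_gen: "shift t (gen x) = gen x - sc (t * \<chi> (\<pi> x))" and shift_sc: "shift t (sc a) = sc a"
  and shift_add: "shift t (u + v) = shift t u + shift t v" and shift_mult: "shift t (u * v) = shift t u * shift t v"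
proof -
  have 1: "gen (x + y) - sc (t * \<chi> (\<pi> (x + y))) =
      (gen x - sc (t * \<chi> (\<pi> x))) + (gen y - sc (t * \<chi> (\<pi> y)))" for x y
    by (simp add: gen_add pi_add chi_add distrib_left sc_add)
  have 2: "gen (a *\<^sub>C x) - sc (t * \<chi> (\<pi> (a *\<^sub>C x))) = sc a * (gen x - sc (t * \<chi> (\<pi> x)))" for a x
    by (simp add: gen_scale pi_scale chi_scale right_diff_distrib mult.left_commute[of t a] flip: sc_mult)
  have 3: "(gen x - sc (t * \<chi> (\<pi> x))) * (gen y - sc (t * \<chi> (\<pi> y))) -
      (gen y - sc (t * \<chi> (\<pi> y))) * (gen x - sc (t * \<chi> (\<pi> x))) =
      gen (bracket x y) - sc (t * \<chi> (\<pi> (bracket x y)))" for x y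
  proof -
    have H: "(g - a) * (k - b) - (k - b) * (g - a) = g * k - k * g"
      if "a * k = k * a" "b * g = g * b" "a * b = b * a" for g k a b :: "'g uea"
      using that by (simp add: algebra_simps)
    have "(gen x - sc (t * \<chi> (\<pi> x))) * (gen y - sc (t * \<chi> (\<pi> y))) -
      (gen y - sc (t * \<chi> (\<pi> y))) * (gen x - sc (t * \<chi> (\<pi> x))) = gen x * gen y - gen y * gen x"
      by (rule H) (rule sc_central)+
    then show ?thesis
      by (simp add: pi_bracket chi_bracket sc_zero gen_bracket)
  qed
  note facts = 1 2 3
  show "shift t (gen x) = gen x - sc (t * \<chi> (\<pi> x))"
    unfolding shift_def by (rule sc.lift_gen[OF facts])
  show "shift t (sc a) = sc a"
    unfolding shift_def by (rule sc.lift_sc[OF facts])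
  show "shift t (u + v) = shift t u + shift t v"
    unfolding shift_def by (rule sc.lift_add[OF facts])
  show "shift t (u * v) = shift t u * shift t v"
    unfolding shift_def by (rule sc.lift_mult[OF facts])
qed

lemma shift_shift: "shift t (shift (- t) u) = u"
proof (induction u rule: uea_induct)
  case (gen x)
  have "shift (- t) (gen x) = gen x + sc (t * \<chi> (\<pi> x))"
    by (simp add: shift_gen sc_uminus)
  then show ?case by (simp only:) (simp add: shift_gen shift_add shift_sc)
qed (simp_all add: shift_sc shift_add shift_mult)

abbreviation "\<sigma> \<equiv> shift 1"

text \<open>On a generator this is c x = x c - [x, c] with [x, c] = \<chi>(\<pi> x) c, and \<sigma>
  is multiplicative.\<close>

lemma c_normal: "gen c * u = \<sigma> u * gen c"
proof (induction u rule: uea_induct)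
  case (sc a)
  show ?case unfolding shift_sc by (rule sc_central[symmetric])
next
  case (gen x)
  have "gen x * gen c - gen c * gen x = sc (\<chi> (\<pi> x)) * gen c"
    by (simp add: gen_bracket bracket_c gen_scale)
  then show ?case by (simp add: shift_gen algebra_simps)
next
  case (add u v)
  then show ?case by (simp add: shift_add algebra_simps)
next
  case (mult u v)
  have "gen c * (u * v) = \<sigma> u * (gen c * v)"
    using mult(1) by (simp flip: mult.assoc)
  then show ?case using mult(2) by (simp add: shift_mult mult.assoc)
qed

lemma c_left_regular: "gen c * u = 0 \<Longrightarrow> u = 0"
  using finite_span uea_left_regular[OF _ _ c_nonzero] by blast

text \<open>Cancellation on the left comes from the action on polynomials; since u c equals c times
  \<open>shift (- 1) u\<close>, it carries over to the right.\<close>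

lemma c_regular:
  assumes "u * gen c = 0"
  shows "u = 0"
proof -
  have "gen c * shift (- 1) u = 0"
    using c_normal[of "shift (- 1) u"] shift_shift[of 1 u] assms by simp
  then have "shift (- 1) u = 0" by (rule c_left_regular)
  moreover have "\<sigma> 0 = 0"
    using shift_add[of 1 0 0] by simp
  ultimately show ?thesis
    using shift_shift[of 1 u] by simp
qed

lemma rho_surj: "surj \<rho>"
proof -
  have "\<exists>u. \<rho> u = v" for v
  proof (induction v rule: uea_induct)
    case (sc a)
    then show ?case using rho_sc by blast
  next
    case (gen x)
    then show ?case using rho_gen[of "sec x"] by auto
  next
    case (add u v)
    then show ?case using rho_add by metis
  next
    case (mult u v)
    then show ?case using rho_mult by metis
  qed
  then show ?thesis by (metis surjI)
qed

lemma rho_zero: "\<rho> 0 = 0"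
  using rho_add[of 0 0] by simp

text \<open>Two-sided although generated from the left, because c is normal; it turns out to be the
  kernel of \<rho>.\<close>

definition "J = {v * gen c | v. True}"

lemma J_add: "u \<in> J \<Longrightarrow> v \<in> J \<Longrightarrow> u + v \<in> J"
  unfolding J_def by (auto simp flip: distrib_right)

lemma J_mult: "u \<in> J \<Longrightarrow> a * u * b \<in> J"
proof -
  assume "u \<in> J"
  then obtain v where "u = v * gen c" by (auto simp: J_def)
  then have "a * u * b = (a * v * \<sigma> b) * gen c"
    by (simp add: mult.assoc c_normal)
  then show ?thesis unfolding J_def by blast
qed

lemma J_zero: "0 \<in> J"
  unfolding J_def by (simp, rule exI[of _ 0], simp)

lemma J_gen: "\<pi> x = 0 \<Longrightarrow> gen x \<in> J"
  unfolding J_def using pi_zero_iff[of x] gen_scale by auto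

lemma gen_diff: "gen (x - y) = gen x - gen y"
  using gen_add[of "x - y" y] by simp

text \<open>For the hard direction \<rho> gets a left inverse modulo \<open>J\<close>. Sending h to
  the lift \<open>sec h\<close> respects the relators of U\<hh> only modulo \<open>J\<close>, so
  this map is evaluated on the free algebra.\<close>

lemma rho_kernel: "\<rho> u = 0 \<longleftrightarrow> (\<exists>v. u = v * gen c)"
proof
  assume "\<exists>v. u = v * gen c"
  then show "\<rho> u = 0" by (auto simp: rho_mult rho_gen pi_c gen_zero)
next
  let ?k = "sc.ext (\<lambda>h. gen (sec h) :: 'g uea)"
  have kJ: "?k p \<in> J" if "p \<in> uea_ideal" for p
    using J_zero J_add J_mult _ _ _ that
  proof (rule sc.ext_ideal)
    show "gen (sec (x + y)) - (gen (sec x) + gen (sec y)) \<in> J" for x y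
      using J_gen[of "sec (x + y) - (sec x + sec y)"] by (simp add: gen_diff gen_add pi_diff pi_add)
    show "gen (sec (a *\<^sub>C x)) - sc a * gen (sec x) \<in> J" for a x
      using J_gen[of "sec (a *\<^sub>C x) - a *\<^sub>C sec x"] by (simp add: gen_diff gen_scale pi_diff pi_scale)
    show "gen (sec x) * gen (sec y) - gen (sec y) * gen (sec x) - gen (sec (bracket x y)) \<in> J" for x y
      using J_gen[of "bracket (sec x) (sec y) - sec (bracket x y)"]
      by (simp add: gen_diff gen_bracket pi_diff pi_bracket)
  qed
  have eq: "?k p - ?k q \<in> J" if "abs_uea p = abs_uea q" for p q
    using kJ[of "p - q"] that by (simp add: abs_uea_eq_iff sc.ext_minus)
  \<comment> \<open>By \<open>eq\<close> the representative picked by \<open>rep_uea\<close> may be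
    exchanged in each case for the obvious one, so the claim is checked on generators.\<close>
  have k: "?k (rep_uea (\<rho> u)) - u \<in> J" for u
  proof (induction u rule: uea_induct)
    case (sc a)
    have "abs_uea (rep_uea (\<rho> (sc a))) = abs_uea (uea_scalar a)"
      by (simp add: rho_sc) (simp add: sc_def)
    from eq[OF this] show ?case by (simp add: sc.ext_scalar)
  next
    case (gen x)
    have "abs_uea (rep_uea (\<rho> (gen x))) = abs_uea (uea_gen (\<pi> x))"
      by (simp add: rho_gen) (simp add: gen_def)
    from eq[OF this] have "?k (rep_uea (\<rho> (gen x))) - gen (sec (\<pi> x)) \<in> J" by (simp add: sc.ext_gen)
    moreover have "gen (sec (\<pi> x) - x) \<in> J" by (rule J_gen) (simp add: pi_diff)
    ultimately have "(?k (rep_uea (\<rho> (gen x))) - gen (sec (\<pi> x))) + gen (sec (\<pi> x) - x) \<in> J"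
      by (rule J_add)
    then show ?case by (simp add: gen_diff)
  next
    case (add u v)
    have "abs_uea (rep_uea (\<rho> (u + v))) = abs_uea (rep_uea (\<rho> u) + rep_uea (\<rho> v))"
      by (simp add: rho_add flip: plus_uea.abs_eq)
    from J_add[OF eq[OF this] J_add[OF add]] show ?case
      by (simp add: sc.ext_add algebra_simps)
  next
    case (mult u v)
    have "abs_uea (rep_uea (\<rho> (u * v))) = abs_uea (rep_uea (\<rho> u) * rep_uea (\<rho> v))"
      by (simp add: rho_mult flip: times_uea.abs_eq)
    note 1 = eq[OF this]
    have 2: "1 * (?k (rep_uea (\<rho> u)) - u) * ?k (rep_uea (\<rho> v)) \<in> J" by (rule J_mult[OF mult(1)])
    have 3: "u * (?k (rep_uea (\<rho> v)) - v) * 1 \<in> J" by (rule J_mult[OF mult(2)])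
    from J_add[OF 1 J_add[OF 2 3]] show ?case
      by (simp add: sc.ext_mult algebra_simps)
  qed
  assume "\<rho> u = 0"
  then have "abs_uea (rep_uea (\<rho> u)) = abs_uea 0" by (simp add: zero_uea_def)
  from eq[OF this] have "?k (rep_uea (\<rho> u)) \<in> J" by simp
  then have "(- 1) * ?k (rep_uea (\<rho> u)) * 1 \<in> J" by (rule J_mult)
  from J_mult[OF J_add[OF k[of u] this], of "- 1" 1] show "\<exists>v. u = v * gen c"
    by (auto simp: J_def)
qed

lemma regular_quotient: "regular_quotient (gen c) \<sigma> \<rho>"
  by standard (use rho_add rho_mult rho_surj rho_kernel c_regular c_normal in auto)

section \<open>Modules and isomorphism classes pulled back along \<pi>\<close>

lemma pullback_lie_module:
  assumes "lie_module M"
  shows "lie_module (lie_pullback \<pi> M)"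
proof -
  interpret lie_module M by (rule assms)
  show ?thesis
    unfolding lie_pullback_relact
    by (rule relact_lie_module[OF left_module_axioms])
      (simp_all add: lact_closed lact_add_right lact_smult_right pi_add pi_scale pi_bracket lact_add_left
        lact_smult_left lact_bracket)
qed

lemma uact_pullback:
  assumes M: "lie_module M" and m: "m \<in> carrier M"
  shows "lie_module.uact (lie_pullback \<pi> M) u m = lie_module.uact M (\<rho> u) m"
proof -
  interpret M: lie_module M by (rule M)
  interpret P: lie_module "lie_pullback \<pi> M" by (rule pullback_lie_module[OF M])
  have s: "carrier (lie_pullback \<pi> M) = carrier M" "ring.add (lie_pullback \<pi> M) = ring.add M"
    "smult (lie_pullback \<pi> M) = smult M" "lact (lie_pullback \<pi> M) x = lact M (\<pi> x)" for x
    by (simp_all add: lie_pullback_def)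
  have "\<forall>m\<in>carrier M. P.uact u m = M.uact (\<rho> u) m"
  proof (induction u rule: uea_induct)
    case (sc a)
    then show ?case by (simp add: rho_sc M.uact_sc P.uact_sc[unfolded s])
  next
    case (gen x)
    then show ?case by (simp add: rho_gen M.uact_gen P.uact_gen[unfolded s])
  next
    case (add u v)
    then show ?case by (simp add: rho_add M.uact_add_left P.uact_add_left[unfolded s])
  next
    case (mult u v)
    then show ?case by (simp add: rho_mult M.uact_mult P.uact_mult[unfolded s] M.uact_closed)
  qed
  with m show ?thesis by blast
qed

abbreviation "tw M \<equiv> twist (\<lambda>h. - \<chi> h) M"

lemma minus_chi_character: "lie_character (\<lambda>h. - \<chi> h)"
  by (auto simp: lie_character_def chi_add chi_scale chi_bracket)

text \<open>On a generator \<sigma> subtracts \<chi>, which is what the twist by -\<chi> does to the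
  action. This is where S_{-\<lambda>} comes from.\<close>

lemma uact_shift:
  assumes M: "lie_module M" and m: "m \<in> carrier M"
  shows "lie_module.uact (lie_pullback \<pi> M) (\<sigma> u) m = lie_module.uact (tw M) (\<rho> u) m"
proof -
  interpret M: lie_module M by (rule M)
  interpret P: lie_module "lie_pullback \<pi> M" by (rule pullback_lie_module[OF M])
  interpret T: lie_module "tw M" by (rule twist_lie_module[OF M minus_chi_character])
  have s: "carrier (lie_pullback \<pi> M) = carrier M" "ring.add (lie_pullback \<pi> M) = ring.add M"
    "smult (lie_pullback \<pi> M) = smult M" "lact (lie_pullback \<pi> M) x = lact M (\<pi> x)" for x
    by (simp_all add: lie_pullback_def)
  have t: "carrier (tw M) = carrier M" "ring.add (tw M) = ring.add M" "smult (tw M) = smult M"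
    "lact (tw M) h m = lact M h m \<oplus>\<^bsub>M\<^esub> (- \<chi> h) \<odot>\<^bsub>M\<^esub> m" for h m
    by (simp_all add: twist_def)
  have "\<forall>m\<in>carrier M. P.uact (\<sigma> u) m = T.uact (\<rho> u) m"
  proof (induction u rule: uea_induct)
    case (sc a)
    then show ?case by (simp add: rho_sc shift_sc T.uact_sc[unfolded t] P.uact_sc[unfolded s])
  next
    case (gen x)
    have "\<sigma> (gen x) = gen x + sc (- \<chi> (\<pi> x))" by (simp add: shift_gen sc_uminus)
    then show ?case
      by (simp add: rho_gen T.uact_gen[unfolded t] P.uact_add_left[unfolded s] P.uact_gen[unfolded s]
          P.uact_sc[unfolded s])
  next
    case (add u v)
    then show ?case
      by (simp add: rho_add shift_add T.uact_add_left[unfolded t] P.uact_add_left[unfolded s])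
  next
    case (mult u v)
    then show ?case
      by (simp add: rho_mult shift_mult T.uact_mult[unfolded t] P.uact_mult[unfolded s] T.uact_closed[unfolded t])
  qed
  with m show ?thesis by blast
qed

lemma pullback_simple:
  assumes "simple_fd M"
  shows "simple_fd (lie_pullback \<pi> M)"
  unfolding lie_pullback_relact
proof (rule relact_simple[OF assms])
  show "lie_module (relact (\<lambda>x. lact M (\<pi> x)) M)"
    using pullback_lie_module[OF simple_fd_lie_module[OF assms]] by (simp add: lie_pullback_relact)
  show "lie_submodule N M" if "lie_submodule N (relact (\<lambda>x. lact M (\<pi> x)) M)" for N
  proof -
    have "lact M h m \<in> N" if m: "m \<in> N" for h m
      using \<open>lie_submodule N _\<close> m pi_sec[of h] unfolding lie_submodule_def by (metis relact_simps(5))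
    then show ?thesis using that by (simp add: lie_submodule_def)
  qed
qed

lemma pullback_iso_iff:
  "lie_module_iso (lie_pullback \<pi> M) (lie_pullback \<pi> N) \<longleftrightarrow> lie_module_iso M N"
proof -
  have "module_hom (lie_pullback \<pi> M) (lie_pullback \<pi> N) = module_hom M N"
    by (auto simp: module_hom_def hom_def lie_pullback_def)
  moreover have "(\<forall>x. \<forall>m\<in>carrier M. f (lact M (\<pi> x) m) = lact N (\<pi> x) (f m)) \<longleftrightarrow>
      (\<forall>x. \<forall>m\<in>carrier M. f (lact M x m) = lact N x (f m))" for f
    using pi_sec by metis
  ultimately show ?thesis
    by (simp add: lie_module_iso_def lie_pullback_def)
qed

lemma pullback_class_iso:
  fixes M :: "('h, nat \<Rightarrow> complex) lie_mod"
  assumes "lie_module M"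
  shows "pullback_class \<pi> (iso_class M) = iso_class (lie_pullback \<pi> M)"
proof -
  have "iso_class (lie_pullback \<pi> N) = iso_class (lie_pullback \<pi> M)" if "N \<in> iso_class M" for N
    using that iso_class_eq[OF pullback_lie_module[OF assms], of "lie_pullback \<pi> N"]
    by (simp add: iso_class_def pullback_iso_iff)
  moreover have "M \<in> iso_class M"
    using assms by (simp add: iso_class_def lie_module_iso_refl)
  ultimately show ?thesis
    unfolding pullback_class_def by blast
qed

lemma pullback_class_inj: "inj_on (pullback_class \<pi>) simple_classes"
proof (rule inj_onI)
  fix X Y :: "'h lie_class"
  assume "X \<in> simple_classes" "Y \<in> simple_classes" and eq: "pullback_class \<pi> X = pullback_class \<pi> Y"
  then obtain M N :: "('h, nat \<Rightarrow> complex) lie_mod"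
    where M: "simple_fd M" "X = iso_class M" and N: "simple_fd N" "Y = iso_class N"
    by (auto simp: simple_classes_def)
  note MN = simple_fd_lie_module[OF M(1)] simple_fd_lie_module[OF N(1)]
  have "iso_class (lie_pullback \<pi> M) = iso_class (lie_pullback \<pi> N)"
    using eq MN by (simp add: M(2) N(2) pullback_class_iso)
  from iso_class_eqD[OF this pullback_lie_module[OF MN(2)]] have "lie_module_iso M N"
    by (simp only: pullback_iso_iff)
  then show "X = Y"
    using iso_class_eq[OF MN(1)] by (simp add: M(2) N(2))
qed

lemma pullback_class_simple: "pullback_class \<pi> ` simple_classes \<subseteq> simple_classes"
  by (auto simp: simple_classes_def pullback_class_iso simple_fd_lie_module intro: pullback_simple)

text \<open>Kernel and image of c are submodules because x c and c x differ by a multiple of c;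
  simplicity leaves 0 or everything for each of them.\<close>

lemma central_action:
  fixes M :: "('g, 'm) lie_mod" (structure)
  assumes M: "simple_fd M"
  shows "(\<forall>m\<in>carrier M. lact M c m = \<zero>) \<or> bij_betw (lact M c) (carrier M) (carrier M)"
proof -
  interpret lie_module M by (rule simple_fd_lie_module[OF M])
  have simple: "N = {\<zero>} \<or> N = carrier M" if "lie_submodule N M" for N
    using M that by (simp add: simple_fd_def)
  have xc: "lact M x (lact M c m) = lact M c (\<chi> (\<pi> x) \<odot> m \<oplus> lact M x m)" if m: "m \<in> carrier M" for x m
  proof -
    have "\<chi> (\<pi> x) \<odot> lact M c m = lact M x (lact M c m) \<ominus> lact M c (lact M x m)"
      using lact_bracket[OF m, of x c] m by (simp add: bracket_c lact_smult_left)
    then have "\<chi> (\<pi> x) \<odot> lact M c m \<oplus> lact M c (lact M x m) = lact M x (lact M c m)"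
      using m by (simp add: a_minus_def a_assoc l_neg lact_closed)
    then show ?thesis
      using m by (simp add: lact_add_right lact_smult_right lact_closed smult_closed)
  qed
  have c0: "lact M c \<zero> = \<zero>"
    using lact_smult_right[of \<zero> c 0] by (simp add: smult_zero_left smult_zero_right lact_closed)
  let ?K = "{m \<in> carrier M. lact M c m = \<zero>}"
  have "lact M c (lact M x m) = \<zero>" if "m \<in> carrier M" "lact M c m = \<zero>" for x m
  proof -
    have "lact M c (\<chi> (\<pi> x) \<odot> m \<oplus> lact M x m) = lact M c (lact M x m)"
      using that by (simp add: lact_add_right lact_smult_right lact_closed smult_closed smult_zero_right)
    moreover have "lact M x \<zero> = \<zero>"
      using lact_smult_right[of \<zero> x 0] by (simp add: smult_zero_left smult_zero_right lact_closed)
    ultimately show ?thesis using xc[OF that(1), of x] that(2) by simp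
  qed
  then have "lie_submodule ?K M"
    by (auto simp: lie_submodule_def c0 lact_add_right lact_smult_right smult_closed smult_zero_right lact_closed)
  from simple[OF this] consider "?K = carrier M" | "?K = {\<zero>}" by blast
  then show ?thesis
  proof cases
    case 1
    then show ?thesis by blast
  next
    case 2
    have "lie_submodule (lact M c ` carrier M) M"
      unfolding lie_submodule_def
    proof (intro conjI ballI allI)
      show "lact M c ` carrier M \<subseteq> carrier M" by (auto simp: lact_closed)
      show "\<zero> \<in> lact M c ` carrier M" using c0 by (metis imageI zero_closed)
      show "m \<oplus> n \<in> lact M c ` carrier M" if mn: "m \<in> lact M c ` carrier M" "n \<in> lact M c ` carrier M" for m n
      proof -
        from mn obtain m' n' where "m' \<in> carrier M" "n' \<in> carrier M" "m = lact M c m'" "n = lact M c n'" by auto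
        then show ?thesis by (intro image_eqI[of _ _ "m' \<oplus> n'"]) (simp_all add: lact_add_right)
      qed
      show "a \<odot> m \<in> lact M c ` carrier M" if "m \<in> lact M c ` carrier M" for a m
      proof -
        from that obtain m' where "m' \<in> carrier M" "m = lact M c m'" by auto
        then show ?thesis by (intro image_eqI[of _ _ "a \<odot> m'"]) (simp_all add: lact_smult_right smult_closed)
      qed
      show "lact M x m \<in> lact M c ` carrier M" if "m \<in> lact M c ` carrier M" for x m
      proof -
        from that obtain m' where "m' \<in> carrier M" "m = lact M c m'" by auto
        then show ?thesis
          by (intro image_eqI[of _ _ "\<chi> (\<pi> x) \<odot> m' \<oplus> lact M x m'"]) (simp_all add: xc smult_closed lact_closed)
      qed
    qed
    from simple[OF this] consider "lact M c ` carrier M = {\<zero>}" | "lact M c ` carrier M = carrier M" by blast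
    then show ?thesis
    proof cases
      case 1
      then show ?thesis by blast
    next
      case s: 2
      have "inj_on (lact M c) (carrier M)"
      proof (rule inj_onI)
        fix m n assume m: "m \<in> carrier M" and n: "n \<in> carrier M" and eq: "lact M c m = lact M c n"
        have "lact M c (\<ominus> n) = \<ominus> lact M c n"
          using lact_smult_right[OF n, of c "- 1"] n by (simp add: smult_uminus_left smult_one lact_closed)
        then have "lact M c (m \<oplus> \<ominus> n) = \<zero>"
          using m n eq by (simp add: lact_add_right lact_closed r_neg)
        then have "m \<oplus> \<ominus> n \<in> ?K" using m n by simp
        then have "m \<oplus> \<ominus> n = \<zero>" using 2 by blast
        then show "m = n" using m n minus_equality[of m "\<ominus> n"] by simp
      qed
      with s show ?thesis by (simp add: bij_betw_def)
    qed
  qed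
qed

text \<open>h acts through a lift to \<gg>; on modules annihilated by c, to which this is applied,
  the choice of the lift has no effect.\<close>

definition descend :: "('g, 'm) lie_mod \<Rightarrow> ('h, 'm) lie_mod" where
  "descend M = relact (\<lambda>h. lact M (sec h)) M"

context
  fixes M :: "('g, 'm) lie_mod"
  assumes M: "simple_fd M" and c0: "\<And>m. m \<in> carrier M \<Longrightarrow> lact M c m = \<zero>\<^bsub>M\<^esub>"
begin

interpretation M: lie_module M
  by (rule simple_fd_lie_module[OF M])

lemma lact_congr:
  assumes m: "m \<in> carrier M" and xy: "\<pi> x = \<pi> y"
  shows "lact M x m = lact M y m"
proof -
  have "\<pi> (x - y) = 0" using xy by (simp add: pi_diff)
  then obtain a where "x - y = a *\<^sub>C c" using pi_zero_iff by blast
  then have "x = y + a *\<^sub>C c" by (simp add: algebra_simps)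
  then show ?thesis
    using m by (simp add: M.lact_add_left M.lact_smult_left c0 M.smult_zero_right M.lact_closed)
qed

lemma descend_lie_module: "lie_module (descend M)"
  unfolding descend_def
proof (rule relact_lie_module[OF M.left_module_axioms])
  fix x y :: 'h and m and a :: complex assume m: "m \<in> carrier M"
  show "lact M (sec (x + y)) m = lact M (sec x) m \<oplus>\<^bsub>M\<^esub> lact M (sec y) m"
    using lact_congr[OF m, of "sec (x + y)" "sec x + sec y"] m by (simp add: pi_add M.lact_add_left)
  show "lact M (sec (a *\<^sub>C x)) m = a \<odot>\<^bsub>M\<^esub> lact M (sec x) m"
    using lact_congr[OF m, of "sec (a *\<^sub>C x)" "a *\<^sub>C sec x"] m by (simp add: pi_scale M.lact_smult_left)
  show "lact M (sec (bracket x y)) m =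
      lact M (sec x) (lact M (sec y) m) \<ominus>\<^bsub>M\<^esub> lact M (sec y) (lact M (sec x) m)"
    using lact_congr[OF m, of "sec (bracket x y)" "bracket (sec x) (sec y)"] m
    by (simp add: pi_bracket M.lact_bracket)
qed (auto simp: M.lact_closed M.lact_add_right M.lact_smult_right)

lemma descend_simple: "simple_fd (descend M)"
  unfolding descend_def
proof (rule relact_simple[OF M])
  show "lie_module (relact (\<lambda>h. lact M (sec h)) M)"
    using descend_lie_module by (simp add: descend_def)
  fix N assume N: "lie_submodule N (relact (\<lambda>h. lact M (sec h)) M)"
  have "lact M x m \<in> N" if m: "m \<in> N" for x m
  proof -
    have "lact M (sec (\<pi> x)) m \<in> N" "m \<in> carrier M"
      using N m by (auto simp: lie_submodule_def)
    then show ?thesis using lact_congr[of m x "sec (\<pi> x)"] by simp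
  qed
  then show "lie_submodule N M" using N by (simp add: lie_submodule_def)
qed

lemma pullback_descend_cong:
  "carrier (lie_pullback \<pi> (descend M)) = carrier M"
  "ring.add (lie_pullback \<pi> (descend M)) = ring.add M"
  "smult (lie_pullback \<pi> (descend M)) = smult M"
  "m \<in> carrier M \<Longrightarrow> lact (lie_pullback \<pi> (descend M)) x m = lact M x m"
  using lact_congr[of m x "sec (\<pi> x)"] by (simp_all add: lie_pullback_def descend_def)

lemma dual_pullback_descend: "lie_dual (lie_pullback \<pi> (descend M)) = lie_dual M"
  by (rule lie_dual_cong) (rule pullback_descend_cong; assumption?)+

lemma iso_pullback_descend: "lie_module_iso M (lie_pullback \<pi> (descend M))"
  by (rule lie_module_iso_cong[OF M.lie_module_axioms]) (rule pullback_descend_cong; assumption?)+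

end

end

section \<open>Comparison of the two spectra\<close>

definition Tor_vanishes :: "('g::complex_lie_algebra, 's) lie_mod \<Rightarrow> ('g, 'v) lie_mod \<Rightarrow> bool" where
  "Tor_vanishes S V \<longleftrightarrow> (\<forall>k. carrier (Tor k (dual_module S) (uea_left_module V)) =
     {\<one>\<^bsub>Tor k (dual_module S) (uea_left_module V)\<^esub>})"

lemma taylor_spectrum_eq: "taylor_spectrum V =
    {iso_class S | S :: ('g::complex_lie_algebra, nat \<Rightarrow> complex) lie_mod. simple_fd S \<and> \<not> Tor_vanishes S V}"
  by (simp add: taylor_spectrum_def Tor_vanishes_def Let_def)

lemma Tor_vanishes_cong: "lie_dual S = lie_dual S' \<Longrightarrow> Tor_vanishes S V = Tor_vanishes S' V"
  by (simp add: Tor_vanishes_def)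

locale lie_extension_module = lie_extension \<iota> \<pi> \<chi> + V: lie_module V
  for \<iota> :: "complex \<Rightarrow> 'g::complex_lie_algebra" and \<pi> :: "'g \<Rightarrow> 'h::fd_complex_lie_algebra"
    and \<chi> and V :: "('h, 'v) lie_mod"
begin

text \<open>One resolution is fixed, as a pair, so that the resolution \<open>G\<close> can be set
  up as a sublocale.\<close>

definition "DE = (SOME DE. based_resolution (uea_left_module V) (\<lambda>k. UNIV :: ('v \<times> 'h uea) list set) (fst DE) (snd DE))"

lemma based_DE: "based_resolution (uea_left_module V) (\<lambda>k. UNIV) (fst DE) (snd DE)"
proof -
  obtain D \<epsilon> where "based_resolution (uea_left_module V) (\<lambda>k. UNIV :: ('v \<times> 'h uea) list set) D \<epsilon>"
    using based_resolution_exists[OF V.uea_left_module] by blast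
  then have "\<exists>DE. based_resolution (uea_left_module V) (\<lambda>k. UNIV :: ('v \<times> 'h uea) list set) (fst DE) (snd DE)"
    by (intro exI[of _ "(D, \<epsilon>)"]) simp
  then show ?thesis unfolding DE_def by (rule someI_ex)
qed

lemma W_lie_module: "lie_module (lie_pullback \<pi> V)"
  by (rule pullback_lie_module[OF V.lie_module_axioms])

sublocale regular_quotient_resolution "gen c" \<sigma> \<rho> "uea_left_module V" "fst DE" "snd DE"
  "uea_left_module (lie_pullback \<pi> V)"
proof (intro regular_quotient_resolution.intro regular_quotient_resolution_axioms.intro
    regular_quotient based_DE lie_module.uea_left_module[OF W_lie_module])
  fix v r assume "v \<in> carrier (uea_left_module V)"
  then have "v \<in> carrier V" by (simp add: uea_left_module_def)
  then show "r \<odot>\<^bsub>uea_left_module (lie_pullback \<pi> V)\<^esub> v = \<rho> r \<odot>\<^bsub>uea_left_module V\<^esub> v"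
    by (simp add: V.smult_uea_left_module lie_module.smult_uea_left_module[OF W_lie_module]
        uact_pullback[OF V.lie_module_axioms])
qed (simp_all add: uea_left_module_def lie_pullback_def)

lemma Tor_vanishes_iff:
  fixes S :: "('h, 's) lie_mod"
  assumes "lie_module S"
  shows "Tor_vanishes S V \<longleftrightarrow>
    (\<forall>k. exact_at (lie_module.dimg S) (lie_module.dact S) (\<lambda>k. UNIV) (fst DE) k)"
  unfolding Tor_vanishes_def by (simp only: Tor_dual_trivial_iff[OF assms based_DE])

lemma Tor_vanishes_pullback_iff:
  fixes S :: "('g, 's) lie_mod"
  assumes "lie_module S"
  shows "Tor_vanishes S (lie_pullback \<pi> V) \<longleftrightarrow>
    (\<forall>k. exact_at (lie_module.dimg S) (lie_module.dact S) B G k)"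
  unfolding Tor_vanishes_def by (simp only: Tor_dual_trivial_iff[OF assms based_G])

text \<open>If c is bijective on S, so is its transpose on the dual: its inverse is precomposition
  with the inverse of c.\<close>

lemma Tor_vanishes_of_bij:
  fixes S :: "('g, 's) lie_mod"
  assumes S: "lie_module S" and bij: "bij_betw (lact S c) (carrier S) (carrier S)"
  shows "Tor_vanishes S (lie_pullback \<pi> V)"
proof -
  interpret S: lie_module S by (rule S)
  interpret E: embedded_right_module "dual_module S" "dual_embed S" by (rule S.dual_embedded)
  let ?i = "inv_into (carrier S) (lact S c)"
  have i: "?i s \<in> carrier S" "lact S c (?i s) = s" "?i (lact S c s) = s" if "s \<in> carrier S" for s
    using that bij by (auto simp: bij_betw_def inv_into_into f_inv_into_f)
  have act: "S.dact m (gen c) = (\<lambda>s. if s \<in> carrier S then m (lact S c s) else 0)" if "m \<in> S.dimg" for m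
    using S.dact_eq[OF that] by (simp add: fun_eq_iff S.uact_gen)
  have "bij_betw (\<lambda>m. S.dact m (gen c)) S.dimg S.dimg"
  proof (rule bij_betw_byWitness[where f' = "\<lambda>m s. if s \<in> carrier S then m (?i s) else 0"])
    have inv_add: "?i (s \<oplus>\<^bsub>S\<^esub> t) = ?i s \<oplus>\<^bsub>S\<^esub> ?i t" if "s \<in> carrier S" "t \<in> carrier S" for s t
      using i(3)[of "?i s \<oplus>\<^bsub>S\<^esub> ?i t"] that by (simp add: S.lact_add_right i)
    have inv_smult: "?i (a \<odot>\<^bsub>S\<^esub> s) = a \<odot>\<^bsub>S\<^esub> ?i s" if "s \<in> carrier S" for a s
      using i(3)[of "a \<odot>\<^bsub>S\<^esub> ?i s"] that by (simp add: S.lact_smult_right i S.smult_closed)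
    show "(\<lambda>m s. if s \<in> carrier S then m (?i s) else 0) ` S.dimg \<subseteq> S.dimg"
      by (auto simp: S.dimg_iff inv_add inv_smult i S.smult_closed)
    show "(\<lambda>m. S.dact m (gen c)) ` S.dimg \<subseteq> S.dimg"
      by (auto intro: E.img.act_mem)
    show "\<forall>m\<in>S.dimg. (\<lambda>s. if s \<in> carrier S then S.dact m (gen c) (?i s) else 0) = m"
      by (auto simp: act i S.dimg_iff fun_eq_iff)
    show "\<forall>m\<in>S.dimg. S.dact (\<lambda>s. if s \<in> carrier S then m (?i s) else 0) (gen c) = m"
    proof
      fix m assume m: "m \<in> S.dimg"
      then have "(\<lambda>s. if s \<in> carrier S then m (?i s) else 0) \<in> S.dimg"
        by (auto simp: S.dimg_iff inv_add inv_smult i S.smult_closed)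
      from act[OF this] m show "S.dact (\<lambda>s. if s \<in> carrier S then m (?i s) else 0) (gen c) = m"
        by (auto simp: fun_eq_iff i S.lact_closed S.dimg_iff)
    qed
  qed
  then show ?thesis
    unfolding Tor_vanishes_pullback_iff[OF S]
    using exact_of_invertible[OF E.right_action_img] by blast
qed

context
  fixes S :: "('h, 's) lie_mod"
  assumes S: "lie_module S"
begin

interpretation S: lie_module S by (rule S)
interpretation P: lie_module "lie_pullback \<pi> S" by (rule pullback_lie_module[OF S])
interpretation T: lie_module "tw S" by (rule twist_lie_module[OF S minus_chi_character])

lemma dimg_eq: "P.dimg = S.dimg" "T.dimg = S.dimg"
  by (auto simp: set_eq_iff S.dimg_iff P.dimg_iff T.dimg_iff) (auto simp: lie_pullback_def twist_def)

lemma carrier_eq: "carrier (lie_pullback \<pi> S) = carrier S" "carrier (tw S) = carrier S"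
  by (simp_all add: lie_pullback_def twist_def)

lemma dact_pullback: "m \<in> S.dimg \<Longrightarrow> P.dact m u = S.dact m (\<rho> u)"
  by (simp add: S.dact_eq P.dact_eq dimg_eq carrier_eq fun_eq_iff uact_pullback[OF S])

lemma dact_shift: "m \<in> S.dimg \<Longrightarrow> P.dact m (\<sigma> u) = T.dact m (\<rho> u)"
  by (simp add: T.dact_eq P.dact_eq dimg_eq carrier_eq fun_eq_iff uact_shift[OF S])

lemma right_actions: "right_action S.dimg P.dact" "right_action S.dimg S.dact" "right_action S.dimg T.dact"
  using embedded_right_module.right_action_img[OF P.dual_embedded]
    embedded_right_module.right_action_img[OF S.dual_embedded]
    embedded_right_module.right_action_img[OF T.dual_embedded] by (simp_all add: dimg_eq)

text \<open>The second claim of the theorem in contrapositive form, with \<open>tw S\<close> in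
  place of S_{-\<lambda>}.\<close>

lemma Tor_vanishes_pullback:
  assumes "Tor_vanishes S V" "Tor_vanishes (tw S) V"
  shows "Tor_vanishes (lie_pullback \<pi> S) (lie_pullback \<pi> V)"
  using assms unfolding Tor_vanishes_pullback_iff[OF P.lie_module_axioms] Tor_vanishes_iff[OF S]
    Tor_vanishes_iff[OF T.lie_module_axioms] dimg_eq
  using exact_of_exact_quotient[OF right_actions dact_pullback dact_shift] by blast

text \<open>For \<chi> = 0 the twist changes nothing on the carrier, so both copies of F in G carry
  the same action, as \<open>exact_quotient_of_exact\<close> requires.\<close>

lemma Tor_vanishes_of_pullback:
  assumes \<chi>: "\<And>h. \<chi> h = 0" and "Tor_vanishes (lie_pullback \<pi> S) (lie_pullback \<pi> V)"
  shows "Tor_vanishes S V"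
proof -
  have "lie_dual (tw S) = lie_dual S"
    by (rule lie_dual_cong) (simp_all add: twist_def \<chi> S.smult_zero_left S.lact_closed)
  then have "T.dact m u = S.dact m u" if "m \<in> S.dimg" for m u
    by (simp add: dual_embed_def[abs_def] twist_def)
  then show ?thesis
    using assms(2) unfolding Tor_vanishes_pullback_iff[OF P.lie_module_axioms] Tor_vanishes_iff[OF S] dimg_eq
    using exact_quotient_of_exact[OF right_actions dact_pullback dact_shift] by blast
qed

end

text \<open>If c acted bijectively on a simple module of the spectrum, \<open>Tor\<close> would
  vanish; so c acts as zero and the module comes from \<hh>.\<close>

lemma spectrum_descends:
  assumes "X \<in> taylor_spectrum (lie_pullback \<pi> V)"
  obtains S :: "('h, nat \<Rightarrow> complex) lie_mod" where "simple_fd S" "X = iso_class (lie_pullback \<pi> S)"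
    "\<not> Tor_vanishes (lie_pullback \<pi> S) (lie_pullback \<pi> V)"
proof -
  from assms obtain M :: "('g, nat \<Rightarrow> complex) lie_mod"
    where M: "X = iso_class M" "simple_fd M" "\<not> Tor_vanishes M (lie_pullback \<pi> V)"
    by (auto simp: taylor_spectrum_eq)
  have c0: "lact M c m = \<zero>\<^bsub>M\<^esub>" if "m \<in> carrier M" for m
    using central_action[OF M(2)] Tor_vanishes_of_bij[OF simple_fd_lie_module[OF M(2)]] M(3) that by blast
  show ?thesis
  proof (rule that)
    show "simple_fd (descend M)" by (rule descend_simple[OF M(2) c0])
    show "X = iso_class (lie_pullback \<pi> (descend M))"
      using iso_class_eq[OF simple_fd_lie_module[OF M(2)] iso_pullback_descend[OF M(2) c0]] M(1) by simp
    show "\<not> Tor_vanishes (lie_pullback \<pi> (descend M)) (lie_pullback \<pi> V)"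
      using M(3) Tor_vanishes_cong[OF dual_pullback_descend[OF M(2) c0]] by blast
  qed
qed

lemma spectrum_subset: "taylor_spectrum (lie_pullback \<pi> V) \<subseteq> pullback_class \<pi> ` simple_classes"
proof
  fix X assume "X \<in> taylor_spectrum (lie_pullback \<pi> V)"
  then obtain S :: "('h, nat \<Rightarrow> complex) lie_mod"
    where "simple_fd S" "X = iso_class (lie_pullback \<pi> S)"
    by (rule spectrum_descends)
  then show "X \<in> pullback_class \<pi> ` simple_classes"
    by (auto simp: simple_classes_def pullback_class_iso[OF simple_fd_lie_module, symmetric])
qed

lemma spectrum_twist:
  fixes S :: "('h, nat \<Rightarrow> complex) lie_mod"
  assumes S: "simple_fd S" and X: "iso_class (lie_pullback \<pi> S) \<in> taylor_spectrum (lie_pullback \<pi> V)"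
  shows "iso_class S \<in> taylor_spectrum V \<or>
    iso_class (lie_tensor (character_module (\<lambda>h. - \<chi> h)) S) \<in> taylor_spectrum V"
proof -
  \<comment> \<open>Membership in the spectrum fixes only an isomorphism class, so nonvanishing is
    known for some R whose pullback is isomorphic to that of S; as \<pi> is surjective, R and S are
    isomorphic over \<hh>.\<close>
  obtain R :: "('h, nat \<Rightarrow> complex) lie_mod" where R: "simple_fd R" "iso_class (lie_pullback \<pi> S) = iso_class (lie_pullback \<pi> R)"
    "\<not> Tor_vanishes (lie_pullback \<pi> R) (lie_pullback \<pi> V)"
    using X by (rule spectrum_descends)
  note SR = simple_fd_lie_module[OF S] simple_fd_lie_module[OF R(1)]
  have iso: "lie_module_iso S R"
    using iso_class_eqD[OF R(2) pullback_lie_module[OF SR(2)]] by (simp add: pullback_iso_iff)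
  have "iso_class S = iso_class R" by (rule iso_class_eq[OF SR(1) iso])
  moreover have "iso_class (lie_tensor (character_module (\<lambda>h. - \<chi> h)) S) = iso_class (tw R)"
    using iso_class_eq[OF twist_lie_module[OF SR(1) minus_chi_character] twist_iso_lie_tensor[OF SR(1)]]
      iso_class_eq[OF twist_lie_module[OF SR(1) minus_chi_character] twist_iso[OF SR(1) iso]] by simp
  moreover have "\<not> Tor_vanishes R V \<or> \<not> Tor_vanishes (tw R) V"
    using Tor_vanishes_pullback[OF SR(2)] R(3) by blast
  ultimately show ?thesis
    using R(1) twist_simple[OF R(1) minus_chi_character] unfolding taylor_spectrum_eq by blast
qed

lemma spectrum_central:
  assumes \<chi>: "\<And>h. \<chi> h = 0"
  shows "taylor_spectrum (lie_pullback \<pi> V) = pullback_class \<pi> ` taylor_spectrum V"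
proof
  show "taylor_spectrum (lie_pullback \<pi> V) \<subseteq> pullback_class \<pi> ` taylor_spectrum V"
  proof
    fix X assume "X \<in> taylor_spectrum (lie_pullback \<pi> V)"
    then obtain S :: "('h, nat \<Rightarrow> complex) lie_mod"
      where S: "simple_fd S" "X = iso_class (lie_pullback \<pi> S)"
      "\<not> Tor_vanishes (lie_pullback \<pi> S) (lie_pullback \<pi> V)"
      by (rule spectrum_descends)
    interpret S: lie_module S by (rule simple_fd_lie_module[OF S(1)])
    have "lie_dual (tw S) = lie_dual S"
      by (rule lie_dual_cong) (simp_all add: twist_def \<chi> S.smult_zero_left S.lact_closed)
    then have "\<not> Tor_vanishes S V"
      using Tor_vanishes_pullback[OF S.lie_module_axioms] S(3) Tor_vanishes_cong by blast
    then have "iso_class S \<in> taylor_spectrum V"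
      using S(1) unfolding taylor_spectrum_eq by blast
    then show "X \<in> pullback_class \<pi> ` taylor_spectrum V"
      using S(2) pullback_class_iso[OF S.lie_module_axioms] by auto
  qed
  show "pullback_class \<pi> ` taylor_spectrum V \<subseteq> taylor_spectrum (lie_pullback \<pi> V)"
  proof
    fix X assume "X \<in> pullback_class \<pi> ` taylor_spectrum V"
    then obtain S :: "('h, nat \<Rightarrow> complex) lie_mod"
      where S: "simple_fd S" "X = pullback_class \<pi> (iso_class S)" "\<not> Tor_vanishes S V"
      by (auto simp: taylor_spectrum_eq)
    note S' = simple_fd_lie_module[OF S(1)]
    have "\<not> Tor_vanishes (lie_pullback \<pi> S) (lie_pullback \<pi> V)"
      using Tor_vanishes_of_pullback[OF S' \<chi>] S(3) by blast
    then show "X \<in> taylor_spectrum (lie_pullback \<pi> V)"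
      using S(2) pullback_class_iso[OF S'] pullback_simple[OF S(1)] unfolding taylor_spectrum_eq by blast
  qed
qed

end

theorem proposition3p8:
  fixes \<iota> :: "complex \<Rightarrow> 'g::complex_lie_algebra"
    and \<pi> :: "'g \<Rightarrow> 'h::fd_complex_lie_algebra"
    and \<chi> :: "'h \<Rightarrow> complex"
    and V :: "('h, 'v) lie_mod"
  assumes "lie_character \<chi>"
    and "one_dim_extension \<iota> \<pi> \<chi>"
    and "lie_module V"
  shows "(taylor_spectrum (lie_pullback \<pi> V) \<subseteq> pullback_class \<pi> ` simple_classes \<and>
          pullback_class \<pi> ` (simple_classes :: 'h lie_class set) \<subseteq> simple_classes \<and>
          inj_on (pullback_class \<pi>) (simple_classes :: 'h lie_class set)) \<and>
         (\<forall>S :: ('h, nat \<Rightarrow> complex) lie_mod. simple_fd S \<longrightarrow>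
            iso_class (lie_pullback \<pi> S) \<in> taylor_spectrum (lie_pullback \<pi> V) \<longrightarrow>
            iso_class S \<in> taylor_spectrum V \<or>
            iso_class (lie_tensor (character_module (\<lambda>h. - \<chi> h)) S) \<in> taylor_spectrum V) \<and>
         ((\<forall>h. \<chi> h = 0) \<longrightarrow>
            taylor_spectrum (lie_pullback \<pi> V) = pullback_class \<pi> ` taylor_spectrum V)"
proof -
  interpret lie_extension_module \<iota> \<pi> \<chi> V
    using assms by (simp add: lie_extension_module_def lie_extension_def)
  show ?thesis
    using spectrum_subset pullback_class_simple pullback_class_inj spectrum_twist spectrum_central by blast
qed

end
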